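(* Let $(G_{r+1})$ be a coclass family, with $P$, $T$, $m$, $M_r=T/p^{r+1}T$, $\tau_r$ and the set $\mathcal{E}$ (depending on $r_0$) as described in the context. Suppose $r_0\ge 3m$ and $m\ge1$. Choose a subset $\mathcal{E}_0\subseteq\mathcal{E}$ such that for every conjugacy class $C$ of elementary abelian $p$-subgroups of $G_{r_0+1}$ there is exactly one $(U,f_\bullet,W)\in\mathcal{E}_0$ such that $E_{r_0}(U,f_\bullet,W)$ lies in $C$. For $r\ge r_0$ define $\mathcal{C}_r$ to be the full subcategory of the Quillen category $\mathscr{A}_p(G_{r+1})$ on the objects $E_r(U,f_\bullet,W)$ with $(U,f_\bullet,W)\in\mathcal{E}_0$. Then: (1) $\mathcal{C}_r$ is a skeleton of $\mathscr{A}_p(G_{r+1})$ for every $r\ge r_0$. (2) The categories $\mathcal{C}_r$ ($r\ge r_0$) are all isomorphic to each other. Hence the Quillen categories $\mathscr{A}_p(G_{r+1})$, $r\ge r_0$, are all equivalent to each other.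
   Context: Quillen category: for a finite group $H$, $\mathscr{A}_p(H)$ has as objects the elementary abelian $p$-subgroups of $H$ (including the trivial one), and as morphisms $E\to E'$ the injective homomorphisms $x\mapsto hxh^{-1}$ with $h\in H$, $hEh^{-1}\le E'$. Cochains: $C^n(G,M)$ is the module of normalized cochains $G^n\to M$ (zero if some argument is $1$), $\Delta$ the standard coboundary, $Z^n=\ker\Delta$. Coclass family: $S$ is an infinite pro-$p$-group of coclass $c$; $l,d\ge 1$ are such that $\gamma_l(S)\cong\mathbb{Z}_p^d$ and $S/\gamma_l(S)$ is a finite $p$-group of coclass $c$; $T_i=\gamma_{l+i}(S)$ satisfies $[T_i:T_{i+1}]=p$ and $p^jT_i=T_{i+jd}$. Fix $\ell\ge0$ and put $P=S/T_\ell$ (a finite $p$-group), $T=T_\ell$ (written additively, a $\mathbb{Z}_pP$-module via conjugation), $m=\log_p|P|$. Let $\rho\in Z^2(P,T)$ be a cocycle defining $S$ as an extension of $P$ by $T$, let $\eta\in Z^3(P,T)$ and let $\sigma\in C^2(P,T)$ satisfy $\Delta(\sigma)=p^m\eta$. For $r\ge m$ put $M_r=T/p^{r+1}T$, let $\tau_r\in Z^2(P,M_r)$ be the image of $\rho+p^{r+1-m}\sigma$, and let $G_{r+1}$ be the extension of $P$ by $M_r$ with underlying set $M_r\times P$ and multiplication $(t_1,g_1)(t_2,g_2)=(t_1+{}^{g_1}t_2+\tau_r(g_1,g_2),g_1g_2)$. These groups form the coclass family. Cochain sequences: for $U\le P$ and $r_0\ge0$, an element $f_\bullet\in\mathbb{C}^1_{r_0}(U,M_\bullet)$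 is a sequence $(f_r)_{r\ge r_0}$, $f_r\in C^1(U,M_r)$, for which there are $\phi\in C^1(U,T)$, $\psi\in C^1(U,pT)$ and $\omega\in\{0,\dots,r_0\}$ with $f_r=$ the image of $\phi+p^{r-\omega}\psi$ for all $r\ge r_0$; its level is the smallest possible such $\omega$. $\mathcal{E}$ is the set of triples $(U,f_\bullet,W)$ with $U\le P$ elementary abelian; $f_\bullet\in\mathbb{C}^1_{r_0}(U,M_\bullet)$ of level at most $2m$ with $\Delta(f_r)=\tau_r|_U$ for all $r\ge r_0$; and $W\le(T/pT)^U$ a subgroup. For $w\in T/pT$ write $p^rw$ for its image under the isomorphism $T/pT\to p^rT/p^{r+1}T$, $x+pT\mapsto p^rx+p^{r+1}T$. For $r\ge r_0$ define the elementary abelian subgroup $E_r(U,f_\bullet,W)=\{(p^rw-f_r(u),u)\mid u\in U,\ w\in W\}\le G_{r+1}$. *)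

theory Defs
  imports
    "HOL-Analysis.Product_Topology"
    "HOL-Analysis.Function_Topology"
    "HOL-Analysis.T1_Spaces"
    "HOL-Algebra.Product_Groups"
    "HOL-Algebra.FiniteProduct"
    "HOL-Computational_Algebra.Primes"
begin

section \<open>Categories\<close>

text \<open>Morphisms are only ever compared inside a fixed hom-set, so composition (applicative order,
  \<open>Comp C x y z g f\<close> for \<open>f : x \<rightarrow> y\<close> and \<open>g : y \<rightarrow> z\<close>) and the arrow
  part of a functor carry their objects as arguments.\<close>

record ('o, 'a) cat =
  Obj :: "'o set"
  Hom :: "'o \<Rightarrow> 'o \<Rightarrow> 'a set"
  Ident :: "'o \<Rightarrow> 'a"
  Comp :: "'o \<Rightarrow> 'o \<Rightarrow> 'o \<Rightarrow> 'a \<Rightarrow> 'a \<Rightarrow> 'a"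

definition category :: "('o, 'a) cat \<Rightarrow> bool" where
  "category C \<longleftrightarrow>
     (\<forall>x\<in>Obj C. Ident C x \<in> Hom C x x) \<and>
     (\<forall>x\<in>Obj C. \<forall>y\<in>Obj C. \<forall>z\<in>Obj C. \<forall>f\<in>Hom C x y. \<forall>g\<in>Hom C y z.
        Comp C x y z g f \<in> Hom C x z) \<and>
     (\<forall>x\<in>Obj C. \<forall>y\<in>Obj C. \<forall>f\<in>Hom C x y.
        Comp C x x y f (Ident C x) = f \<and> Comp C x y y (Ident C y) f = f) \<and>
     (\<forall>x\<in>Obj C. \<forall>y\<in>Obj C. \<forall>z\<in>Obj C. \<forall>v\<in>Obj C.
        \<forall>f\<in>Hom C x y. \<forall>g\<in>Hom C y z. \<forall>h\<in>Hom C z v.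
        Comp C x z v h (Comp C x y z g f) = Comp C x y v (Comp C y z v h g) f)"

definition is_functor ::
  "('o, 'a) cat \<Rightarrow> ('o2, 'a2) cat \<Rightarrow> ('o \<Rightarrow> 'o2) \<Rightarrow> ('o \<Rightarrow> 'o \<Rightarrow> 'a \<Rightarrow> 'a2) \<Rightarrow> bool" where
  "is_functor A B Fo Fa \<longleftrightarrow>
     category A \<and> category B \<and>
     (\<forall>x\<in>Obj A. Fo x \<in> Obj B) \<and>
     (\<forall>x\<in>Obj A. \<forall>y\<in>Obj A. \<forall>f\<in>Hom A x y. Fa x y f \<in> Hom B (Fo x) (Fo y)) \<and>
     (\<forall>x\<in>Obj A. Fa x x (Ident A x) = Ident B (Fo x)) \<and>
     (\<forall>x\<in>Obj A. \<forall>y\<in>Obj A. \<forall>z\<in>Obj A. \<forall>f\<in>Hom A x y. \<forall>g\<in>Hom A y z.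
        Fa x z (Comp A x y z g f) = Comp B (Fo x) (Fo y) (Fo z) (Fa y z g) (Fa x y f))"

definition isomorphic_cats :: "('o, 'a) cat \<Rightarrow> ('o2, 'a2) cat \<Rightarrow> bool" where
  "isomorphic_cats A B \<longleftrightarrow>
     (\<exists>Fo Fa. is_functor A B Fo Fa \<and> bij_betw Fo (Obj A) (Obj B) \<and>
        (\<forall>x\<in>Obj A. \<forall>y\<in>Obj A. bij_betw (Fa x y) (Hom A x y) (Hom B (Fo x) (Fo y))))"

definition iso_arrows :: "('o, 'a) cat \<Rightarrow> 'o \<Rightarrow> 'o \<Rightarrow> 'a set" where
  "iso_arrows C x y = {f \<in> Hom C x y. \<exists>g\<in>Hom C y x.
     Comp C x y x g f = Ident C x \<and> Comp C y x y f g = Ident C y}"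

definition nat_isomorphic ::
  "('o, 'a) cat \<Rightarrow> ('o2, 'a2) cat \<Rightarrow> ('o \<Rightarrow> 'o2) \<Rightarrow> ('o \<Rightarrow> 'o \<Rightarrow> 'a \<Rightarrow> 'a2) \<Rightarrow>
   ('o \<Rightarrow> 'o2) \<Rightarrow> ('o \<Rightarrow> 'o \<Rightarrow> 'a \<Rightarrow> 'a2) \<Rightarrow> bool" where
  "nat_isomorphic A B Fo Fa Go Ga \<longleftrightarrow>
     (\<exists>\<alpha>. (\<forall>x\<in>Obj A. \<alpha> x \<in> iso_arrows B (Fo x) (Go x)) \<and>
        (\<forall>x\<in>Obj A. \<forall>y\<in>Obj A. \<forall>f\<in>Hom A x y.
           Comp B (Fo x) (Fo y) (Go y) (\<alpha> y) (Fa x y f) =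
           Comp B (Fo x) (Go x) (Go y) (Ga x y f) (\<alpha> x)))"

definition equivalent_cats :: "('o, 'a) cat \<Rightarrow> ('o2, 'a2) cat \<Rightarrow> bool" where
  "equivalent_cats A B \<longleftrightarrow>
     (\<exists>Fo Fa Go Ga. is_functor A B Fo Fa \<and> is_functor B A Go Ga \<and>
        nat_isomorphic A A (\<lambda>x. Go (Fo x)) (\<lambda>x y f. Ga (Fo x) (Fo y) (Fa x y f))
          (\<lambda>x. x) (\<lambda>x y f. f) \<and>
        nat_isomorphic B B (\<lambda>x. Fo (Go x)) (\<lambda>x y f. Fa (Go x) (Go y) (Ga x y f))
          (\<lambda>x. x) (\<lambda>x y f. f))"

definition full_subcat :: "('o, 'a) cat \<Rightarrow> 'o set \<Rightarrow> ('o, 'a) cat" where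
  "full_subcat C K = C\<lparr>Obj := K\<rparr>"

definition is_skeleton :: "('o, 'a) cat \<Rightarrow> ('o, 'a) cat \<Rightarrow> bool" where
  "is_skeleton K C \<longleftrightarrow>
     category C \<and> Obj K \<subseteq> Obj C \<and> K = full_subcat C (Obj K) \<and>
     (\<forall>x\<in>Obj C. \<exists>!y. y \<in> Obj K \<and> iso_arrows C x y \<noteq> {})"


section \<open>Quillen categories\<close>

definition elementary_abelian_subgroups :: "nat \<Rightarrow> ('a, 'b) monoid_scheme \<Rightarrow> 'a set set" where
  "elementary_abelian_subgroups p H = {E. subgroup E H \<and>
     (\<forall>x\<in>E. \<forall>y\<in>E. x \<otimes>\<^bsub>H\<^esub> y = y \<otimes>\<^bsub>H\<^esub> x) \<and> (\<forall>x\<in>E. x [^]\<^bsub>H\<^esub> p = \<one>\<^bsub>H\<^esub>)}"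

definition conj_by :: "('a, 'b) monoid_scheme \<Rightarrow> 'a \<Rightarrow> 'a \<Rightarrow> 'a" where
  "conj_by H h x = h \<otimes>\<^bsub>H\<^esub> x \<otimes>\<^bsub>H\<^esub> inv\<^bsub>H\<^esub> h"

text \<open>A morphism is the conjugation map itself, as a function restricted to its domain; elements
  \<open>h\<close> inducing the same map give the same morphism.\<close>

definition quillen_cat :: "nat \<Rightarrow> ('a, 'b) monoid_scheme \<Rightarrow> ('a set, 'a \<Rightarrow> 'a) cat" where
  "quillen_cat p H = \<lparr>
     Obj = elementary_abelian_subgroups p H,
     Hom = (\<lambda>E E'. {restrict (conj_by H h) E | h. h \<in> carrier H \<and> conj_by H h ` E \<subseteq> E'}),
     Ident = (\<lambda>E. restrict (\<lambda>x. x) E),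
     Comp = (\<lambda>E E' E'' g f. compose E g f)\<rparr>"

definition elementary_abelian_classes :: "nat \<Rightarrow> ('a, 'b) monoid_scheme \<Rightarrow> 'a set set set" where
  "elementary_abelian_classes p H =
     {{conj_by H h ` E | h. h \<in> carrier H} | E. E \<in> elementary_abelian_subgroups p H}"


section \<open>Finite and pro-p groups of given coclass\<close>

definition commutator_subgroup :: "('a, 'b) monoid_scheme \<Rightarrow> 'a set \<Rightarrow> 'a set \<Rightarrow> 'a set" where
  "commutator_subgroup G H K =
     generate G {h \<otimes>\<^bsub>G\<^esub> k \<otimes>\<^bsub>G\<^esub> inv\<^bsub>G\<^esub> h \<otimes>\<^bsub>G\<^esub> inv\<^bsub>G\<^esub> k | h k. h \<in> H \<and> k \<in> K}"

text \<open>The numbering starts with \<open>\<gamma>\<^sub>1(G) = G\<close>; the value at \<open>0\<close> is irrelevant.\<close>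

fun lower_central :: "('a, 'b) monoid_scheme \<Rightarrow> nat \<Rightarrow> 'a set" where
  "lower_central G 0 = carrier G"
| "lower_central G (Suc 0) = carrier G"
| "lower_central G (Suc (Suc n)) = commutator_subgroup G (lower_central G (Suc n)) (carrier G)"

definition nilpotency_class :: "('a, 'b) monoid_scheme \<Rightarrow> nat" where
  "nilpotency_class G = (LEAST n. lower_central G (Suc n) = {\<one>\<^bsub>G\<^esub>})"

definition finite_p_group_of_coclass :: "nat \<Rightarrow> nat \<Rightarrow> ('a, 'b) monoid_scheme \<Rightarrow> bool" where
  "finite_p_group_of_coclass p c G \<longleftrightarrow>
     group G \<and> (\<exists>n. order G = p ^ n \<and> n = nilpotency_class G + c)"

definition topological_group :: "('a, 'b) monoid_scheme \<Rightarrow> 'a topology \<Rightarrow> bool" where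
  "topological_group G \<T> \<longleftrightarrow>
     group G \<and> topspace \<T> = carrier G \<and>
     continuous_map (prod_topology \<T> \<T>) \<T> (\<lambda>(x, y). x \<otimes>\<^bsub>G\<^esub> y) \<and>
     continuous_map \<T> \<T> (\<lambda>x. inv\<^bsub>G\<^esub> x)"

definition profinite_group :: "('a, 'b) monoid_scheme \<Rightarrow> 'a topology \<Rightarrow> bool" where
  "profinite_group G \<T> \<longleftrightarrow>
     topological_group G \<T> \<and> compact_space \<T> \<and> Hausdorff_space \<T> \<and>
     (\<forall>V. openin \<T> V \<and> \<one>\<^bsub>G\<^esub> \<in> V \<longrightarrow> (\<exists>H. subgroup H G \<and> openin \<T> H \<and> H \<subseteq> V))"

definition pro_p_group :: "nat \<Rightarrow> ('a, 'b) monoid_scheme \<Rightarrow> 'a topology \<Rightarrow> bool" where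
  "pro_p_group p G \<T> \<longleftrightarrow>
     profinite_group G \<T> \<and>
     (\<forall>N. N \<lhd> G \<and> openin \<T> N \<longrightarrow> (\<exists>k. card (rcosets\<^bsub>G\<^esub> N) = p ^ k))"

text \<open>As usual for pro-p groups, the terms of the lower central series are the closed ones.\<close>

fun closed_lower_central :: "('a, 'b) monoid_scheme \<Rightarrow> 'a topology \<Rightarrow> nat \<Rightarrow> 'a set" where
  "closed_lower_central G \<T> 0 = carrier G"
| "closed_lower_central G \<T> (Suc 0) = carrier G"
| "closed_lower_central G \<T> (Suc (Suc n)) =
     \<T> closure_of (commutator_subgroup G (closed_lower_central G \<T> (Suc n)) (carrier G))"

text \<open>The coclass of a pro-p group is the eventual value of the coclass of its quotients by the
  terms of the lower central series.\<close>

definition pro_p_group_of_coclass ::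
  "nat \<Rightarrow> nat \<Rightarrow> ('a, 'b) monoid_scheme \<Rightarrow> 'a topology \<Rightarrow> bool" where
  "pro_p_group_of_coclass p c G \<T> \<longleftrightarrow>
     pro_p_group p G \<T> \<and>
     (\<exists>i0. \<forall>i\<ge>i0. finite_p_group_of_coclass p c (G Mod closed_lower_central G \<T> i))"

text \<open>The additive group of the p-adic integers as the inverse limit of the groups
  \<open>\<int>/p\<^sup>n\<int>\<close>, each represented on \<open>{0..<p\<^sup>n}\<close>.\<close>

definition padic_int :: "nat \<Rightarrow> (nat \<Rightarrow> int) monoid" where
  "padic_int p = \<lparr>
     carrier = {x. \<forall>n. 0 \<le> x n \<and> x n < int p ^ n \<and> x (Suc n) mod int p ^ n = x n},
     monoid.mult = (\<lambda>x y n. (x n + y n) mod int p ^ n),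
     one = (\<lambda>n. 0)\<rparr>"

definition padic_topology :: "nat \<Rightarrow> (nat \<Rightarrow> int) topology" where
  "padic_topology p =
     subtopology (product_topology (\<lambda>n. discrete_topology UNIV) UNIV) (carrier (padic_int p))"

definition topologically_isomorphic ::
  "('a, 'b) monoid_scheme \<Rightarrow> 'a topology \<Rightarrow> ('c, 'd) monoid_scheme \<Rightarrow> 'c topology \<Rightarrow> bool" where
  "topologically_isomorphic G \<T> H \<T>' \<longleftrightarrow> (\<exists>\<phi>\<in>iso G H. homeomorphic_map \<T> \<T>' \<phi>)"


section \<open>Normalized cochains and extensions\<close>

text \<open>A module for a group \<open>G\<close> consists of an abelian group \<open>M\<close>, written multiplicatively as
  everywhere for \<open>comm_group\<close>, and an action \<open>act :: 'g \<Rightarrow> 'a \<Rightarrow> 'a\<close> from the left; so sums and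
  integer multiples in the module are products and powers below. An n-tuple is a list of length
  \<open>n\<close>. Cochains are extensional functions, so that equality of cochains is equality on their
  domain.\<close>

definition tuples :: "nat \<Rightarrow> 'g set \<Rightarrow> 'g list set" where
  "tuples n A = {gs. length gs = n \<and> set gs \<subseteq> A}"

definition cochains ::
  "nat \<Rightarrow> ('g, 'b) monoid_scheme \<Rightarrow> ('a, 'c) monoid_scheme \<Rightarrow> ('g list \<Rightarrow> 'a) set" where
  "cochains n G M = {f \<in> tuples n (carrier G) \<rightarrow>\<^sub>E carrier M.
     \<forall>gs\<in>tuples n (carrier G). \<one>\<^bsub>G\<^esub> \<in> set gs \<longrightarrow> f gs = \<one>\<^bsub>M\<^esub>}"

text \<open>Tuple entries are numbered from \<open>0\<close>, whence the sign \<open>(-1)\<^sup>i\<^sup>+\<^sup>1\<close>.\<close>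

definition coboundary ::
  "nat \<Rightarrow> ('g, 'b) monoid_scheme \<Rightarrow> ('a, 'c) monoid_scheme \<Rightarrow> ('g \<Rightarrow> 'a \<Rightarrow> 'a) \<Rightarrow>
   ('g list \<Rightarrow> 'a) \<Rightarrow> 'g list \<Rightarrow> 'a" where
  "coboundary n G M act f = (\<lambda>gs\<in>tuples (Suc n) (carrier G).
     act (hd gs) (f (tl gs)) \<otimes>\<^bsub>M\<^esub>
     finprod M (\<lambda>i. f (take i gs @ [gs ! i \<otimes>\<^bsub>G\<^esub> gs ! Suc i] @ drop (i + 2) gs)
                      [^]\<^bsub>M\<^esub> ((- 1 :: int) ^ (i + 1))) {..<n} \<otimes>\<^bsub>M\<^esub>
     f (butlast gs) [^]\<^bsub>M\<^esub> ((- 1 :: int) ^ (n + 1)))"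

definition cocycles ::
  "nat \<Rightarrow> ('g, 'b) monoid_scheme \<Rightarrow> ('a, 'c) monoid_scheme \<Rightarrow> ('g \<Rightarrow> 'a \<Rightarrow> 'a) \<Rightarrow>
   ('g list \<Rightarrow> 'a) set" where
  "cocycles n G M act = {f \<in> cochains n G M.
     coboundary n G M act f = (\<lambda>gs\<in>tuples (Suc n) (carrier G). \<one>\<^bsub>M\<^esub>)}"

definition extension_group ::
  "('g, 'b) monoid_scheme \<Rightarrow> ('a, 'c) monoid_scheme \<Rightarrow> ('g \<Rightarrow> 'a \<Rightarrow> 'a) \<Rightarrow>
   ('g list \<Rightarrow> 'a) \<Rightarrow> ('a \<times> 'g) monoid" where
  "extension_group G M act \<tau> = \<lparr>
     carrier = carrier M \<times> carrier G,
     monoid.mult = (\<lambda>(t1, g1) (t2, g2).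
       (t1 \<otimes>\<^bsub>M\<^esub> act g1 t2 \<otimes>\<^bsub>M\<^esub> \<tau> [g1, g2], g1 \<otimes>\<^bsub>G\<^esub> g2)),
     one = (\<one>\<^bsub>M\<^esub>, \<one>\<^bsub>G\<^esub>)\<rparr>"


section \<open>Coclass families\<close>

text \<open>Below, \<open>T\<close> is an abelian normal subgroup of \<open>S\<close>; the group \<open>P = S/T\<close> is \<open>S Mod T\<close>.\<close>

definition sub_group :: "'s monoid \<Rightarrow> 's set \<Rightarrow> 's monoid" where
  "sub_group S A = S\<lparr>carrier := A\<rparr>"

text \<open>The action of \<open>S/T\<close> on \<open>T\<close> by conjugation: as \<open>T\<close> is abelian, \<open>s t s\<^sup>-\<^sup>1\<close> does not depend on
  the representative \<open>s\<close> of the coset \<open>g\<close>.\<close>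

definition conj_action :: "'s monoid \<Rightarrow> 's set \<Rightarrow> 's \<Rightarrow> 's" where
  "conj_action S g t = (THE u. \<exists>s\<in>g. u = conj_by S s t)"

definition quotient_action :: "'s monoid \<Rightarrow> 's set \<Rightarrow> 's set \<Rightarrow> 's set" where
  "quotient_action S g w = conj_action S g ` w"

text \<open>The subgroup \<open>p\<^sup>kT\<close>.\<close>

definition p_mult :: "nat \<Rightarrow> 's monoid \<Rightarrow> 's set \<Rightarrow> nat \<Rightarrow> 's set" where
  "p_mult p S T k = (\<lambda>t. t [^]\<^bsub>S\<^esub> (p ^ k)) ` T"

text \<open>The quotient \<open>T/p\<^sup>kT\<close> and the projection of \<open>T\<close> onto it.\<close>

definition p_quotient :: "nat \<Rightarrow> 's monoid \<Rightarrow> 's set \<Rightarrow> nat \<Rightarrow> 's set monoid" where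
  "p_quotient p S T k = sub_group S T Mod p_mult p S T k"

definition p_proj :: "nat \<Rightarrow> 's monoid \<Rightarrow> 's set \<Rightarrow> nat \<Rightarrow> 's \<Rightarrow> 's set" where
  "p_proj p S T k t = p_mult p S T k #>\<^bsub>S\<^esub> t"

definition coeff :: "nat \<Rightarrow> 's monoid \<Rightarrow> 's set \<Rightarrow> nat \<Rightarrow> 's set monoid" where
  "coeff p S T r = p_quotient p S T (r + 1)"

text \<open>The cocycle \<open>\<rho>\<close> defines \<open>S\<close> as an extension of \<open>S/T\<close> by \<open>T\<close>: the extension given by \<open>\<rho>\<close> is
  equivalent to the extension \<open>T \<rightarrow> S \<rightarrow> S/T\<close>.\<close>

definition defines_extension :: "'s monoid \<Rightarrow> 's set \<Rightarrow> ('s set list \<Rightarrow> 's) \<Rightarrow> bool" where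
  "defines_extension S T \<rho> \<longleftrightarrow>
     (\<exists>\<phi>\<in>iso (extension_group (S Mod T) (sub_group S T) (conj_action S) \<rho>) S.
        (\<forall>t\<in>T. \<phi> (t, \<one>\<^bsub>S Mod T\<^esub>) = t) \<and>
        (\<forall>t\<in>T. \<forall>g\<in>carrier (S Mod T). T #>\<^bsub>S\<^esub> \<phi> (t, g) = g))"

definition tau ::
  "nat \<Rightarrow> 's monoid \<Rightarrow> 's set \<Rightarrow> nat \<Rightarrow> ('s set list \<Rightarrow> 's) \<Rightarrow> ('s set list \<Rightarrow> 's) \<Rightarrow>
   nat \<Rightarrow> 's set list \<Rightarrow> 's set" where
  "tau p S T m \<rho> \<sigma> r = (\<lambda>gs\<in>tuples 2 (carrier (S Mod T)).
     p_proj p S T (r + 1) (\<rho> gs \<otimes>\<^bsub>S\<^esub> \<sigma> gs [^]\<^bsub>S\<^esub> (p ^ (r + 1 - m))))"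

text \<open>The group at index \<open>r\<close> is the one denoted \<open>G\<^sub>r\<^sub>+\<^sub>1\<close>.\<close>

definition coclass_group ::
  "nat \<Rightarrow> 's monoid \<Rightarrow> 's set \<Rightarrow> nat \<Rightarrow> ('s set list \<Rightarrow> 's) \<Rightarrow> ('s set list \<Rightarrow> 's) \<Rightarrow>
   nat \<Rightarrow> ('s set \<times> 's set) monoid" where
  "coclass_group p S T m \<rho> \<sigma> r =
     extension_group (S Mod T) (coeff p S T r) (quotient_action S) (tau p S T m \<rho> \<sigma> r)"

locale coclass_family =
  fixes p c :: nat and S :: "'s monoid" and \<T> :: "'s topology" and l d ell m :: nat
    and \<rho> \<eta> \<sigma> :: "'s set list \<Rightarrow> 's" and T :: "'s set"
  assumes prime: "prime p"
    and pro_p: "pro_p_group_of_coclass p c S \<T>"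
    and infinite: "infinite (carrier S)"
    and l_pos: "l \<ge> 1"
    and d_pos: "d \<ge> 1"
    and padic: "topologically_isomorphic
        (sub_group S (closed_lower_central S \<T> l)) (subtopology \<T> (closed_lower_central S \<T> l))
        (product_group {..<d} (\<lambda>i. padic_int p)) (product_topology (\<lambda>i. padic_topology p) {..<d})"
    and coclass_quot: "finite_p_group_of_coclass p c (S Mod closed_lower_central S \<T> l)"
    and index: "\<And>i. card (rcosets\<^bsub>sub_group S (closed_lower_central S \<T> (l + i))\<^esub>
                  (closed_lower_central S \<T> (l + (i + 1)))) = p"
    and multiples: "\<And>i j. p_mult p S (closed_lower_central S \<T> (l + i)) j =
                  closed_lower_central S \<T> (l + (i + j * d))"
    and T_eq: "T = closed_lower_central S \<T> (l + ell)"
    and order_P: "order (S Mod T) = p ^ m"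
    and rho_cocycle: "\<rho> \<in> cocycles 2 (S Mod T) (sub_group S T) (conj_action S)"
    and rho_extension: "defines_extension S T \<rho>"
    and eta_cocycle: "\<eta> \<in> cocycles 3 (S Mod T) (sub_group S T) (conj_action S)"
    and sigma_cochain: "\<sigma> \<in> cochains 2 (S Mod T) (sub_group S T)"
    and coboundary_sigma: "coboundary 2 (S Mod T) (sub_group S T) (conj_action S) \<sigma> =
          (\<lambda>gs\<in>tuples 3 (carrier (S Mod T)). \<eta> gs [^]\<^bsub>S\<^esub> (p ^ m))"


section \<open>Cochain sequences and the subgroups they define\<close>

abbreviation sub_P :: "'s monoid \<Rightarrow> 's set \<Rightarrow> 's set set \<Rightarrow> 's set monoid" where
  "sub_P S T U \<equiv> (S Mod T)\<lparr>carrier := U\<rparr>"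

definition cochain_seq_with ::
  "nat \<Rightarrow> 's monoid \<Rightarrow> 's set \<Rightarrow> nat \<Rightarrow> 's set set \<Rightarrow> nat \<Rightarrow>
   (nat \<Rightarrow> 's set list \<Rightarrow> 's set) \<Rightarrow> bool" where
  "cochain_seq_with p S T r0 U \<omega> f \<longleftrightarrow>
     (\<exists>\<phi>\<in>cochains 1 (sub_P S T U) (sub_group S T).
      \<exists>\<psi>\<in>cochains 1 (sub_P S T U) (sub_group S (p_mult p S T 1)).
      \<forall>r\<ge>r0. \<forall>us\<in>tuples 1 U.
        f r us = p_proj p S T (r + 1) (\<phi> us \<otimes>\<^bsub>S\<^esub> \<psi> us [^]\<^bsub>S\<^esub> (p ^ (r - \<omega>))))"

definition cochain_seqs ::
  "nat \<Rightarrow> 's monoid \<Rightarrow> 's set \<Rightarrow> nat \<Rightarrow> 's set set \<Rightarrow> (nat \<Rightarrow> 's set list \<Rightarrow> 's set) set" where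
  "cochain_seqs p S T r0 U =
     {f \<in> (\<Pi>\<^sub>E r\<in>{r0..}. cochains 1 (sub_P S T U) (coeff p S T r)).
        \<exists>\<omega>\<in>{0..r0}. cochain_seq_with p S T r0 U \<omega> f}"

definition level ::
  "nat \<Rightarrow> 's monoid \<Rightarrow> 's set \<Rightarrow> nat \<Rightarrow> 's set set \<Rightarrow> (nat \<Rightarrow> 's set list \<Rightarrow> 's set) \<Rightarrow> nat" where
  "level p S T r0 U f = (LEAST \<omega>. \<omega> \<in> {0..r0} \<and> cochain_seq_with p S T r0 U \<omega> f)"

type_synonym 's triple = "'s set set \<times> (nat \<Rightarrow> 's set list \<Rightarrow> 's set) \<times> 's set set"

definition fixed_points :: "nat \<Rightarrow> 's monoid \<Rightarrow> 's set \<Rightarrow> 's set set \<Rightarrow> 's set set" where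
  "fixed_points p S T U =
     {w \<in> carrier (p_quotient p S T 1). \<forall>u\<in>U. quotient_action S u w = w}"

definition triples ::
  "nat \<Rightarrow> 's monoid \<Rightarrow> 's set \<Rightarrow> nat \<Rightarrow> ('s set list \<Rightarrow> 's) \<Rightarrow> ('s set list \<Rightarrow> 's) \<Rightarrow>
   nat \<Rightarrow> 's triple set" where
  "triples p S T m \<rho> \<sigma> r0 = {(U, f, W).
     U \<in> elementary_abelian_subgroups p (S Mod T) \<and>
     f \<in> cochain_seqs p S T r0 U \<and> level p S T r0 U f \<le> 2 * m \<and>
     (\<forall>r\<ge>r0. coboundary 1 (sub_P S T U) (coeff p S T r) (quotient_action S) (f r) =
        restrict (tau p S T m \<rho> \<sigma> r) (tuples 2 U)) \<and>
     subgroup W (p_quotient p S T 1) \<and> W \<subseteq> fixed_points p S T U}"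

text \<open>The isomorphism \<open>T/pT \<rightarrow> p\<^sup>rT/p\<^sup>r\<^sup>+\<^sup>1T\<close>: the set of all \<open>p\<^sup>rx\<close> with \<open>x\<close> in the coset
  \<open>x\<^sub>0 + pT\<close> is precisely the coset \<open>p\<^sup>rx\<^sub>0 + p\<^sup>r\<^sup>+\<^sup>1T\<close>.\<close>

definition p_shift :: "nat \<Rightarrow> 's monoid \<Rightarrow> nat \<Rightarrow> 's set \<Rightarrow> 's set" where
  "p_shift p S r w = (\<lambda>x. x [^]\<^bsub>S\<^esub> (p ^ r)) ` w"

definition E_sub ::
  "nat \<Rightarrow> 's monoid \<Rightarrow> 's set \<Rightarrow> nat \<Rightarrow> 's triple \<Rightarrow> ('s set \<times> 's set) set" where
  "E_sub p S T r = (\<lambda>(U, f, W).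
     {(p_shift p S r w \<otimes>\<^bsub>coeff p S T r\<^esub> inv\<^bsub>coeff p S T r\<^esub> (f r [u]), u) | u w. u \<in> U \<and> w \<in> W})"

definition transversal ::
  "nat \<Rightarrow> 's monoid \<Rightarrow> 's set \<Rightarrow> nat \<Rightarrow> ('s set list \<Rightarrow> 's) \<Rightarrow> ('s set list \<Rightarrow> 's) \<Rightarrow>
   nat \<Rightarrow> 's triple set \<Rightarrow> bool" where
  "transversal p S T m \<rho> \<sigma> r0 E0 \<longleftrightarrow>
     E0 \<subseteq> triples p S T m \<rho> \<sigma> r0 \<and>
     (\<forall>C\<in>elementary_abelian_classes p (coclass_group p S T m \<rho> \<sigma> r0).
        \<exists>!x. x \<in> E0 \<and> E_sub p S T r0 x \<in> C)"

definition cat_C ::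
  "nat \<Rightarrow> 's monoid \<Rightarrow> 's set \<Rightarrow> nat \<Rightarrow> ('s set list \<Rightarrow> 's) \<Rightarrow> ('s set list \<Rightarrow> 's) \<Rightarrow>
   's triple set \<Rightarrow> nat \<Rightarrow>
   (('s set \<times> 's set) set, 's set \<times> 's set \<Rightarrow> 's set \<times> 's set) cat" where
  "cat_C p S T m \<rho> \<sigma> E0 r =
     full_subcat (quillen_cat p (coclass_group p S T m \<rho> \<sigma> r)) (E_sub p S T r ` E0)"

end

(* Embed the lattice T into an additive group. A triple is then a pair of functions phi, psi on U with
   values in T, where f_r = phi + p^(r+1-2m) psi, together with the preimage W of a subgroup of T/pT.

   Every elementary abelian subgroup E of G_(r+1) arises from such data: E splits over its image U in P,
   so a section gives F : U -> T with Delta F = rho + p^(r+1-m) sigma + p^(r+1) chi. Applying Delta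
   yields Delta chi = -eta, hence sigma + p^m chi is a cocycle on U, and as p^m annihilates H^2(U, T)
   there is psi with Delta psi = p^m (sigma + p^m chi). Now phi = F - p^(r+1-2m) psi satisfies
   Delta phi = rho, and phi, psi define a sequence for all levels at once.

   Conjugation by (t, g) carries the subgroup of one triple into that of another according to a
   congruence modulo p^(r+1). It forces a 1-cocycle that does not depend on r to be a coboundary modulo
   p^(r+1-2m), hence, p^m annihilating H^1, to be one exactly. After this correction the congruence can
   be divided by p^(r+1-3m) and no longer involves r, so that (t, g) can be replaced by an element
   inducing the corresponding map at any other level. *)

theory Submission
  imports
    Defs
    "HOL-Algebra.Generated_Groups"
    "HOL-Library.Function_Algebras"
    "HOL-Number_Theory.Cong"
begin

section \<open>Transport between Quillen categories\<close>

text \<open>The bound on \<open>r0\<close> counts losses of divisibility. In \<tau> the cochain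
  \<sigma> carries p^(r+1-m); solving for psi costs a second factor p^m and removing the 1-cocycle a
  third, so r+1-3m has to be a genuine exponent. That p^m annihilates H^1 and H^2 of every U \<le> P
  is the averaging argument: summing a cocycle identity over one variable produces the factor |U|,
  which divides p^m. Two properties of the lattice link congruences and equations: being
  torsion-free, it allows a congruence to be divided by a power of p, and since the subgroups p^k T
  meet trivially, congruences modulo arbitrarily high powers are equations. The obstacle in
  comparing levels is that the groups G_(r+1) consist of different cosets and come with no maps
  between them. The elements of each subgroup are therefore labelled by pairs from W x U, a set
  independent of r, and a morphism is described by the labels that it relates. Two labels name the
  same element precisely when their U-parts are equal and their W-parts agree modulo p, again
  independently of r. This is what makes the categories at different levels comparable.\<close>

lemma (in group) conj_by_conj_by:
  assumes "g \<in> carrier G" "h \<in> carrier G" "x \<in> carrier G"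
  shows "conj_by G g (conj_by G h x) = conj_by G (g \<otimes> h) x"
  using assms by (simp add: conj_by_def inv_mult_group m_assoc)

lemma (in group) conj_by_one: "x \<in> carrier G \<Longrightarrow> conj_by G \<one> x = x"
  by (simp add: conj_by_def)

lemma elementary_abelian_subset_carrier:
  "E \<in> elementary_abelian_subgroups p H \<Longrightarrow> E \<subseteq> carrier H"
  by (auto simp: elementary_abelian_subgroups_def dest: subgroup.subset)

lemma quillen_homI:
  "h \<in> carrier H \<Longrightarrow> conj_by H h ` E \<subseteq> E' \<Longrightarrow>
    restrict (conj_by H h) E \<in> Hom (quillen_cat p H) E E'"
  by (auto simp: quillen_cat_def)

lemma quillen_homE:
  assumes "f \<in> Hom (quillen_cat p H) E E'"
  obtains h where "h \<in> carrier H" "conj_by H h ` E \<subseteq> E'" "f = restrict (conj_by H h) E"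
  using assms by (auto simp: quillen_cat_def)

lemma quillen_ident: "Ident (quillen_cat p H) E = restrict (\<lambda>x. x) E"
  by (simp add: quillen_cat_def)

lemma quillen_comp: "Comp (quillen_cat p H) E E' E'' g f = compose E g f"
  by (simp add: quillen_cat_def)

lemma quillen_obj: "Obj (quillen_cat p H) = elementary_abelian_subgroups p H"
  by (simp add: quillen_cat_def)

lemma quillen_comp_closed:
  assumes "group H" "E \<subseteq> carrier H"
    and "f \<in> Hom (quillen_cat p H) E E'" "g \<in> Hom (quillen_cat p H) E' E''"
  shows "compose E g f \<in> Hom (quillen_cat p H) E E''"
proof -
  interpret group H by fact
  obtain h where h: "h \<in> carrier H" "conj_by H h ` E \<subseteq> E'" "f = restrict (conj_by H h) E"
    using assms(3) by (rule quillen_homE)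
  obtain k where k: "k \<in> carrier H" "conj_by H k ` E' \<subseteq> E''" "g = restrict (conj_by H k) E'"
    using assms(4) by (rule quillen_homE)
  have *: "conj_by H k (conj_by H h x) = conj_by H (k \<otimes>\<^bsub>H\<^esub> h) x" if "x \<in> E" for x
    using that assms(2) h k by (intro conj_by_conj_by) auto
  have "compose E g f = restrict (conj_by H (k \<otimes>\<^bsub>H\<^esub> h)) E"
    using h(2) * by (auto simp: compose_def h(3) k(3) fun_eq_iff)
  moreover have "conj_by H (k \<otimes>\<^bsub>H\<^esub> h) ` E \<subseteq> E''"
    using h(2) k(2) by (force simp: *[symmetric])
  ultimately show ?thesis
    using quillen_homI h(1) k(1) by (metis m_closed)
qed

lemma quillen_ident_hom:
  assumes "group H" "E \<subseteq> carrier H" "E \<subseteq> E'"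
  shows "restrict (\<lambda>x. x) E \<in> Hom (quillen_cat p H) E E'"
proof -
  interpret group H by fact
  have "restrict (\<lambda>x. x) E = restrict (conj_by H \<one>\<^bsub>H\<^esub>) E"
    using assms(2) by (intro restrict_ext) (auto simp: conj_by_one)
  moreover have "conj_by H \<one>\<^bsub>H\<^esub> ` E \<subseteq> E'"
    using assms(2,3) by (auto simp: conj_by_one subset_iff)
  ultimately show ?thesis
    using quillen_homI[of "\<one>\<^bsub>H\<^esub>" H E E' p] by simp
qed

lemma quillen_hom_funcset:
  "f \<in> Hom (quillen_cat p H) E E' \<Longrightarrow> f \<in> E \<rightarrow>\<^sub>E E'"
  by (auto simp: quillen_cat_def)

lemma category_quillen_cat:
  assumes "group H"
  shows "category (quillen_cat p H)"
  unfolding category_def quillen_obj quillen_ident quillen_comp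
proof (intro conjI ballI)
  fix E E' f assume "f \<in> Hom (quillen_cat p H) E E'"
  then have f: "f \<in> E \<rightarrow>\<^sub>E E'"
    by (rule quillen_hom_funcset)
  show "compose E f (restrict (\<lambda>x. x) E) = f" "compose E (restrict (\<lambda>x. x) E') f = f"
    using f by (auto simp: compose_def fun_eq_iff PiE_def extensional_def)
next
  fix E E' E'' E''' f g h
  assume "f \<in> Hom (quillen_cat p H) E E'"
  from quillen_hom_funcset[OF this] have "f \<in> E \<rightarrow> E'"
    by (auto simp: PiE_def)
  then show "compose E h (compose E g f) = compose E (compose E' h g) f"
    by (rule compose_assoc)
qed (use assms quillen_comp_closed quillen_ident_hom elementary_abelian_subset_carrier
     in \<open>metis order_refl\<close>)+

lemma category_full_subcat:
  assumes "category C" "K \<subseteq> Obj C"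
  shows "category (full_subcat C K)"
  using assms unfolding category_def full_subcat_def by (simp add: subset_iff)

lemma iso_arrows_sym:
  "iso_arrows C x y \<noteq> {} \<Longrightarrow> iso_arrows C y x \<noteq> {}"
  unfolding iso_arrows_def by blast

lemma iso_arrows_trans:
  assumes C: "category C" and obj: "x \<in> Obj C" "y \<in> Obj C" "z \<in> Obj C"
    and xy: "iso_arrows C x y \<noteq> {}" and yz: "iso_arrows C y z \<noteq> {}"
  shows "iso_arrows C x z \<noteq> {}"
proof -
  obtain f f' where f: "f \<in> Hom C x y" "f' \<in> Hom C y x"
    "Comp C x y x f' f = Ident C x" "Comp C y x y f f' = Ident C y"
    using xy unfolding iso_arrows_def by auto
  obtain g g' where g: "g \<in> Hom C y z" "g' \<in> Hom C z y"
    "Comp C y z y g' g = Ident C y" "Comp C z y z g g' = Ident C z"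
    using yz unfolding iso_arrows_def by auto
  have assoc: "Comp C a c d w (Comp C a b c v u) = Comp C a b d (Comp C b c d w v) u"
    if "a \<in> Obj C" "b \<in> Obj C" "c \<in> Obj C" "d \<in> Obj C"
      "u \<in> Hom C a b" "v \<in> Hom C b c" "w \<in> Hom C c d" for a b c d u v w
    using C that unfolding category_def by blast
  have cl: "Comp C a b c v u \<in> Hom C a c"
    if "a \<in> Obj C" "b \<in> Obj C" "c \<in> Obj C" "u \<in> Hom C a b" "v \<in> Hom C b c" for a b c u v
    using C that unfolding category_def by blast
  have idr: "Comp C a b b (Ident C b) u = u"
    if "a \<in> Obj C" "b \<in> Obj C" "u \<in> Hom C a b" for a b u
    using C that unfolding category_def by blast
  have "Comp C x z x (Comp C z y x f' g') (Comp C x y z g f) =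
        Comp C x y x f' (Comp C x y y (Comp C y z y g' g) f)"
    using obj f g cl assoc by (metis (no_types))
  then have 1: "Comp C x z x (Comp C z y x f' g') (Comp C x y z g f) = Ident C x"
    using obj f g idr by simp
  have "Comp C z x z (Comp C x y z g f) (Comp C z y x f' g') =
        Comp C z y z g (Comp C z y y (Comp C y x y f f') g')"
    using obj f g cl assoc by (metis (no_types))
  then have 2: "Comp C z x z (Comp C x y z g f) (Comp C z y x f' g') = Ident C z"
    using obj f g idr by simp
  show ?thesis
    using 1 2 cl obj f g unfolding iso_arrows_def by blast
qed

text \<open>An arrow with a right inverse is onto its target, so the conjugation carries X onto Y
  and not merely into it. Hence skeletons correspond to transversals of the conjugacy
  classes.\<close>

lemma quillen_iso_iff_conj:
  assumes "group H" and X: "X \<subseteq> carrier H" and Y: "Y \<subseteq> carrier H"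
  shows "iso_arrows (quillen_cat p H) X Y \<noteq> {} \<longleftrightarrow> (\<exists>h\<in>carrier H. conj_by H h ` X = Y)"
proof
  interpret group H by fact
  assume "iso_arrows (quillen_cat p H) X Y \<noteq> {}"
  then obtain f g where fg: "f \<in> Hom (quillen_cat p H) X Y" "g \<in> Hom (quillen_cat p H) Y X"
    "compose Y f g = restrict (\<lambda>x. x) Y"
    unfolding iso_arrows_def by (auto simp: quillen_ident quillen_comp)
  obtain h where h: "h \<in> carrier H" "conj_by H h ` X \<subseteq> Y" "f = restrict (conj_by H h) X"
    using fg(1) by (rule quillen_homE)
  have "y \<in> conj_by H h ` X" if "y \<in> Y" for y
  proof -
    have "g y \<in> X"
      using quillen_hom_funcset[OF fg(2)] that by auto
    moreover have "f (g y) = y"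
      using fun_cong[OF fg(3), of y] that by (simp add: compose_def)
    ultimately show ?thesis
      using h(3) by (metis imageI restrict_apply')
  qed
  then show "\<exists>h\<in>carrier H. conj_by H h ` X = Y"
    using h by blast
next
  interpret group H by fact
  assume "\<exists>h\<in>carrier H. conj_by H h ` X = Y"
  then obtain h where h: "h \<in> carrier H" "conj_by H h ` X = Y" by blast
  have inv1: "conj_by H (inv\<^bsub>H\<^esub> h) (conj_by H h x) = x" if "x \<in> X" for x
    using that X h by (subst conj_by_conj_by) (auto simp: conj_by_one)
  have inv2: "conj_by H h (conj_by H (inv\<^bsub>H\<^esub> h) y) = y" if "y \<in> Y" for y
    using that Y h by (subst conj_by_conj_by) (auto simp: conj_by_one)
  have im: "conj_by H (inv\<^bsub>H\<^esub> h) ` Y = X"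
    using inv1 by (force simp: h(2)[symmetric])
  have "compose X (restrict (conj_by H (inv\<^bsub>H\<^esub> h)) Y) (restrict (conj_by H h) X) = restrict (\<lambda>x. x) X"
    using h(2) inv1 by (auto simp: compose_def fun_eq_iff)
  moreover have "compose Y (restrict (conj_by H h) X) (restrict (conj_by H (inv\<^bsub>H\<^esub> h)) Y) = restrict (\<lambda>x. x) Y"
    using im inv2 by (auto simp: compose_def fun_eq_iff)
  ultimately have "restrict (conj_by H h) X \<in> iso_arrows (quillen_cat p H) X Y"
    unfolding iso_arrows_def quillen_ident quillen_comp
    using h im quillen_homI[of h H X Y p] quillen_homI[of "inv\<^bsub>H\<^esub> h" H Y X p] by auto
  then show "iso_arrows (quillen_cat p H) X Y \<noteq> {}" by blast
qed

text \<open>The subgroups at all indices share the names in \<open>I\<close>, and their elements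
  share the labels in \<open>D x\<close>. By \<open>kernel\<close> it does not depend on the index
  which labels coincide, so elements can be renamed; by \<open>transfer\<close> a conjugation at one
  index can be imitated at any other with the same effect on labels.\<close>

locale quillen_transport =
  fixes p :: nat and R :: "'r set" and H :: "'r \<Rightarrow> 'a monoid"
    and I :: "'i set" and D :: "'i \<Rightarrow> 'd set" and e :: "'r \<Rightarrow> 'i \<Rightarrow> 'd \<Rightarrow> 'a"
  assumes group_H: "r \<in> R \<Longrightarrow> group (H r)"
    and objects: "r \<in> R \<Longrightarrow> elementary_abelian_subgroups p (H r) = (\<lambda>x. e r x ` D x) ` I"
    and kernel: "\<lbrakk>r \<in> R; s \<in> R; x \<in> I; a \<in> D x; b \<in> D x; e r x a = e r x b\<rbrakk> \<Longrightarrow> e s x a = e s x b"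
    and transfer: "\<lbrakk>r \<in> R; s \<in> R; x \<in> I; y \<in> I; h \<in> carrier (H r);
        conj_by (H r) h ` e r x ` D x \<subseteq> e r y ` D y\<rbrakk> \<Longrightarrow>
        \<exists>h'\<in>carrier (H s). \<forall>a\<in>D x. \<forall>b\<in>D y.
          conj_by (H r) h (e r x a) = e r y b \<longleftrightarrow> conj_by (H s) h' (e s x a) = e s y b"
begin

abbreviation E where "E r x \<equiv> e r x ` D x"
abbreviation Q where "Q r \<equiv> quillen_cat p (H r)"

text \<open>The relabelling bijection from \<open>E r x\<close> to \<open>E s x\<close>; by
  \<open>kernel\<close> the label picked by \<open>SOME\<close> is immaterial.\<close>

definition theta where "theta r s x z = e s x (SOME a. a \<in> D x \<and> e r x a = z)"
text \<open>Conjugates \<open>f\<close> by the relabelling, restricted because arrows of the Quillen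
  category are extensional functions.\<close>

definition tr where "tr r s x y f = (\<lambda>z\<in>E s x. theta r s y (f (theta s r x z)))"

lemma theta_e:
  assumes "r \<in> R" "s \<in> R" "x \<in> I" "a \<in> D x"
  shows "theta r s x (e r x a) = e s x a"
proof -
  let ?b = "SOME b. b \<in> D x \<and> e r x b = e r x a"
  have "?b \<in> D x \<and> e r x ?b = e r x a"
    by (rule someI[of "\<lambda>b. b \<in> D x \<and> e r x b = e r x a" a]) (use assms in auto)
  then show ?thesis
    unfolding theta_def using kernel assms by blast
qed

lemma E_carrier: "r \<in> R \<Longrightarrow> x \<in> I \<Longrightarrow> E r x \<subseteq> carrier (H r)"
  by (rule elementary_abelian_subset_carrier[of _ p]) (simp add: objects)

lemma E_obj: "r \<in> R \<Longrightarrow> x \<in> I \<Longrightarrow> E r x \<in> Obj (Q r)"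
  by (simp add: quillen_obj objects)

text \<open>On labels the transported map acts as conjugation by the element \<open>h'\<close> that
  \<open>transfer\<close> provides. So it is again an arrow, although \<open>theta\<close> need not
  extend to a map of the ambient groups.\<close>

lemma tr_hom:
  assumes "r \<in> R" "s \<in> R" "x \<in> I" "y \<in> I" and f: "f \<in> Hom (Q r) (E r x) (E r y)"
  shows "tr r s x y f \<in> Hom (Q s) (E s x) (E s y)"
proof -
  obtain h where h: "h \<in> carrier (H r)" "conj_by (H r) h ` E r x \<subseteq> E r y"
    "f = restrict (conj_by (H r) h) (E r x)"
    using f by (rule quillen_homE)
  obtain h' where h': "h' \<in> carrier (H s)" "\<And>a b. a \<in> D x \<Longrightarrow> b \<in> D y \<Longrightarrow>
      conj_by (H r) h (e r x a) = e r y b \<longleftrightarrow> conj_by (H s) h' (e s x a) = e s y b"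
    using transfer[OF assms(1-4) h(1,2)] by blast
  have key: "tr r s x y f (e s x a) = conj_by (H s) h' (e s x a) \<and> conj_by (H s) h' (e s x a) \<in> E s y"
    if a: "a \<in> D x" for a
  proof -
    obtain b where b: "b \<in> D y" "conj_by (H r) h (e r x a) = e r y b"
      using h(2) a by blast
    have "tr r s x y f (e s x a) = theta r s y (e r y b)"
      using a b assms by (simp add: tr_def theta_e h(3))
    then show ?thesis
      using a b assms h'(2) by (auto simp: theta_e)
  qed
  then have "tr r s x y f = restrict (conj_by (H s) h') (E s x)"
    by (auto simp: fun_eq_iff) (simp add: tr_def)
  moreover have "conj_by (H s) h' ` E s x \<subseteq> E s y"
    using key by blast
  ultimately show ?thesis
    using quillen_homI[OF h'(1)] by simp
qed

lemma hom_apply: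
  assumes "f \<in> Hom (Q r) (E r x) (E r y)" "a \<in> D x"
  obtains b where "b \<in> D y" "f (e r x a) = e r y b"
  using quillen_hom_funcset[OF assms(1)] assms(2) by (auto simp: PiE_def Pi_def)

lemma tr_ident:
  assumes "r \<in> R" "s \<in> R" "x \<in> I"
  shows "tr r s x x (Ident (Q r) (E r x)) = Ident (Q s) (E s x)"
proof
  fix v show "tr r s x x (Ident (Q r) (E r x)) v = Ident (Q s) (E s x) v"
  proof (cases "v \<in> E s x")
    case True
    then obtain a where "a \<in> D x" "v = e s x a" by blast
    then show ?thesis
      using assms by (simp add: tr_def quillen_ident theta_e)
  qed (simp add: tr_def quillen_ident)
qed

lemma tr_comp:
  assumes "r \<in> R" "s \<in> R" "x \<in> I" "y \<in> I" "z \<in> I"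
    and f: "f \<in> Hom (Q r) (E r x) (E r y)" and g: "g \<in> Hom (Q r) (E r y) (E r z)"
  shows "tr r s x z (compose (E r x) g f) = compose (E s x) (tr r s y z g) (tr r s x y f)"
proof
  fix v show "tr r s x z (compose (E r x) g f) v = compose (E s x) (tr r s y z g) (tr r s x y f) v"
  proof (cases "v \<in> E s x")
    case True
    then obtain a where a: "a \<in> D x" "v = e s x a" by blast
    obtain b where b: "b \<in> D y" "f (e r x a) = e r y b"
      using hom_apply[OF f a(1)] .
    obtain c where c: "c \<in> D z" "g (e r y b) = e r z c"
      using hom_apply[OF g b(1)] .
    show ?thesis
      using a b c assms(1-5) by (simp add: tr_def compose_def theta_e)
  qed (simp add: tr_def compose_def)
qed

lemma tr_tr:
  assumes "r \<in> R" "s \<in> R" "x \<in> I" "y \<in> I" and f: "f \<in> Hom (Q r) (E r x) (E r y)"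
  shows "tr s r x y (tr r s x y f) = f"
proof
  fix v show "tr s r x y (tr r s x y f) v = f v"
  proof (cases "v \<in> E r x")
    case True
    then obtain a where a: "a \<in> D x" "v = e r x a" by blast
    obtain b where b: "b \<in> D y" "f (e r x a) = e r y b"
      using hom_apply[OF f a(1)] .
    show ?thesis
      using a b assms(1-4) by (simp add: tr_def theta_e)
  next
    case False
    then show ?thesis
      using quillen_hom_funcset[OF f] by (auto simp: tr_def PiE_def extensional_def)
  qed
qed

lemma tr_bij:
  assumes "r \<in> R" "s \<in> R" "x \<in> I" "y \<in> I"
  shows "bij_betw (tr r s x y) (Hom (Q r) (E r x) (E r y)) (Hom (Q s) (E s x) (E s y))"
  by (rule bij_betw_byWitness[where f' = "tr s r x y"])
    (use assms tr_tr tr_hom in auto)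

lemma tr_iso:
  assumes "r \<in> R" "s \<in> R" "x \<in> I" "y \<in> I" and f: "f \<in> iso_arrows (Q r) (E r x) (E r y)"
  shows "tr r s x y f \<in> iso_arrows (Q s) (E s x) (E s y)"
proof -
  obtain g where g: "f \<in> Hom (Q r) (E r x) (E r y)" "g \<in> Hom (Q r) (E r y) (E r x)"
    "compose (E r x) g f = Ident (Q r) (E r x)" "compose (E r y) f g = Ident (Q r) (E r y)"
    using f unfolding iso_arrows_def quillen_comp by blast
  have "compose (E s x) (tr r s y x g) (tr r s x y f) = Ident (Q s) (E s x)"
    using tr_comp[OF assms(1-4,3) g(1,2)] tr_ident[OF assms(1-3)] g(3) by simp
  moreover have "compose (E s y) (tr r s x y f) (tr r s y x g) = Ident (Q s) (E s y)"
    using tr_comp[OF assms(1,2,4,3,4) g(2,1)] tr_ident[OF assms(1,2,4)] g(4) by simp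
  ultimately show ?thesis
    using tr_hom assms(1-4) g(1,2) unfolding iso_arrows_def quillen_comp by blast
qed

section \<open>Equivalence of the full Quillen categories\<close>

definition choice where "choice r X = (SOME x. x \<in> I \<and> X = E r x)"

lemma choice:
  assumes "r \<in> R" "X \<in> Obj (Q r)"
  shows "choice r X \<in> I" "E r (choice r X) = X"
proof -
  have "\<exists>x. x \<in> I \<and> X = E r x"
    using assms by (auto simp: quillen_obj objects)
  from someI_ex[OF this] show "choice r X \<in> I" "E r (choice r X) = X"
    by (auto simp: choice_def)
qed

abbreviation Fo where "Fo r s X \<equiv> E s (choice r X)"
abbreviation Fa where "Fa r s X Y f \<equiv> tr r s (choice r X) (choice r Y) f"

lemma functor_Fo_Fa:
  assumes "r \<in> R" "s \<in> R"
  shows "is_functor (Q r) (Q s) (Fo r s) (Fa r s)"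
  unfolding is_functor_def
proof (intro conjI ballI)
  show "category (Q r)" "category (Q s)"
    using assms group_H category_quillen_cat by auto
  fix X assume X: "X \<in> Obj (Q r)"
  note cX = choice[OF assms(1) X]
  show "Fo r s X \<in> Obj (Q s)"
    using E_obj assms cX by blast
  show "Fa r s X X (Ident (Q r) X) = Ident (Q s) (Fo r s X)"
    using tr_ident[OF assms cX(1)] cX(2) by simp
  fix Y assume Y: "Y \<in> Obj (Q r)"
  note cY = choice[OF assms(1) Y]
  fix f assume f: "f \<in> Hom (Q r) X Y"
  show "Fa r s X Y f \<in> Hom (Q s) (Fo r s X) (Fo r s Y)"
    using tr_hom[OF assms cX(1) cY(1)] cX(2) cY(2) f by simp
next
  fix X Y Z f g assume X: "X \<in> Obj (Q r)" and Y: "Y \<in> Obj (Q r)" and Z: "Z \<in> Obj (Q r)"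
    and f: "f \<in> Hom (Q r) X Y" and g: "g \<in> Hom (Q r) Y Z"
  note cX = choice[OF assms(1) X] and cY = choice[OF assms(1) Y] and cZ = choice[OF assms(1) Z]
  show "Fa r s X Z (Comp (Q r) X Y Z g f) =
     Comp (Q s) (Fo r s X) (Fo r s Y) (Fo r s Z) (Fa r s Y Z g) (Fa r s X Y f)"
    using tr_comp[OF assms cX(1) cY(1) cZ(1)] cX(2) cY(2) cZ(2) f g by (simp add: quillen_comp)
qed

text \<open>A subgroup may have several labels, and the one chosen at \<open>s\<close> for
  \<open>Fo r s X\<close> need not be \<open>choice r X\<close>; so going to \<open>s\<close> and
  back need not return \<open>X\<close>. Both labels name the same subgroup at \<open>s\<close>, and
  its identity, transported back to \<open>r\<close>, is the component of the natural
  isomorphism.\<close>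

lemma nat_isomorphic_Fo_Fa:
  assumes r: "r \<in> R" and s: "s \<in> R"
  shows "nat_isomorphic (Q r) (Q r) (\<lambda>X. Fo s r (Fo r s X))
    (\<lambda>X Y f. Fa s r (Fo r s X) (Fo r s Y) (Fa r s X Y f)) (\<lambda>X. X) (\<lambda>X Y f. f)"
proof -
  let ?x = "choice r" and ?y = "\<lambda>X. choice s (Fo r s X)"
  define \<alpha> where "\<alpha> X = tr s r (?y X) (?x X) (Ident (Q s) (Fo r s X))" for X
  have x: "?x X \<in> I" "E r (?x X) = X" "?y X \<in> I" "E s (?y X) = E s (?x X)"
    if "X \<in> Obj (Q r)" for X
    using choice[OF r that] choice[OF s E_obj[OF s choice(1)[OF r that]]] by auto
  have idiso: "Ident (Q s) X \<in> iso_arrows (Q s) X X" if "X \<in> Obj (Q s)" for X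
    using category_quillen_cat[OF group_H[OF s], of p] that
    unfolding category_def iso_arrows_def by blast
  show ?thesis
    unfolding nat_isomorphic_def
  proof (intro exI[of _ \<alpha>] conjI ballI)
    fix X assume X: "X \<in> Obj (Q r)"
    note cX = x[OF X]
    show "\<alpha> X \<in> iso_arrows (Q r) (Fo s r (Fo r s X)) X"
      using tr_iso[OF s r cX(3,1), of "Ident (Q s) (Fo r s X)"] idiso[OF E_obj[OF s cX(1)]]
      unfolding \<alpha>_def cX(2) cX(4) by blast
    fix Y f assume Y: "Y \<in> Obj (Q r)" and f: "f \<in> Hom (Q r) X Y"
    note cY = x[OF Y]
    let ?g = "Fa r s X Y f"
    have f': "f \<in> Hom (Q r) (E r (?x X)) (E r (?x Y))"
      using f cX cY by simp
    have g: "?g \<in> Hom (Q s) (E s (?x X)) (E s (?x Y))"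
      using tr_hom[OF r s cX(1) cY(1) f'] .
    have inverse: "tr s r (?x X) (?x Y) ?g = f"
      by (rule tr_tr[OF r s cX(1) cY(1) f'])
    have idX: "Ident (Q s) (Fo r s X) \<in> Hom (Q s) (E s (?y X)) (E s (?x X))"
      and idY: "Ident (Q s) (Fo r s Y) \<in> Hom (Q s) (E s (?y Y)) (E s (?x Y))"
      using idiso[OF E_obj[OF s cX(1)]] idiso[OF E_obj[OF s cY(1)]] cX(4) cY(4)
      unfolding iso_arrows_def by auto
    have g': "?g \<in> Hom (Q s) (E s (?y X)) (E s (?y Y))"
      using g cX(4) cY(4) by simp
    have catQ: "Comp (Q s) X X Y f (Ident (Q s) X) = f \<and> Comp (Q s) X Y Y (Ident (Q s) Y) f = f"
      if "X \<in> Obj (Q s)" "Y \<in> Obj (Q s)" "f \<in> Hom (Q s) X Y" for X Y f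
      using category_quillen_cat[OF group_H[OF s], of p] that unfolding category_def by blast
    have c1: "compose (E s (?x X)) (Ident (Q s) (Fo r s Y)) ?g = ?g"
      and c2: "compose (E s (?x X)) ?g (Ident (Q s) (Fo r s X)) = ?g"
      using catQ[OF E_obj[OF s cX(1)] E_obj[OF s cY(1)] g] by (simp_all add: quillen_comp)
    \<comment> \<open>Naturality: both composites are the transport of \<open>?g\<close> from the
      label \<open>?y X\<close> to the label \<open>?x Y\<close>.\<close>
    have "compose (E r (?y X)) (\<alpha> Y) (tr s r (?y X) (?y Y) ?g) = tr s r (?y X) (?x Y) ?g"
      unfolding \<alpha>_def using tr_comp[OF s r cX(3) cY(3) cY(1) g' idY] c1 cX(4) by simp
    also have "\<dots> = compose (E r (?y X)) (tr s r (?x X) (?x Y) ?g) (\<alpha> X)"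
      unfolding \<alpha>_def using tr_comp[OF s r cX(3) cX(1) cY(1) idX g] c2 cX(4) by simp
    finally show "Comp (Q r) (Fo s r (Fo r s X)) (Fo s r (Fo r s Y)) Y (\<alpha> Y)
        (Fa s r (Fo r s X) (Fo r s Y) (Fa r s X Y f)) =
      Comp (Q r) (Fo s r (Fo r s X)) X Y f (\<alpha> X)"
      using inverse by (simp add: quillen_comp)
  qed
qed

theorem equivalent_quillen_cats: "r \<in> R \<Longrightarrow> s \<in> R \<Longrightarrow> equivalent_cats (Q r) (Q s)"
  unfolding equivalent_cats_def
  using functor_Fo_Fa[of r s] functor_Fo_Fa[of s r] nat_isomorphic_Fo_Fa[of r s]
    nat_isomorphic_Fo_Fa[of s r] by blast

section \<open>Transversals, skeletons and isomorphic subcategories\<close>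

definition representatives where
  "representatives r E0 \<longleftrightarrow> E0 \<subseteq> I \<and>
     (\<forall>C\<in>elementary_abelian_classes p (H r). \<exists>!x. x \<in> E0 \<and> E r x \<in> C)"

lemma mem_class_iff:
  assumes "r \<in> R" "x \<in> I" "y \<in> I"
  shows "E r y \<in> {conj_by (H r) h ` E r x | h. h \<in> carrier (H r)} \<longleftrightarrow>
    iso_arrows (Q r) (E r x) (E r y) \<noteq> {}"
  unfolding quillen_iso_iff_conj[OF group_H[OF assms(1)] E_carrier[OF assms(1,2)] E_carrier[OF assms(1,3)]]
    mem_Collect_eq by metis

lemma classes_eq:
  assumes "r \<in> R"
  shows "elementary_abelian_classes p (H r) =
    (\<lambda>x. {conj_by (H r) h ` E r x | h. h \<in> carrier (H r)}) ` I"
  unfolding elementary_abelian_classes_def objects[OF assms] by auto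

lemma iso_refl:
  assumes "r \<in> R" "x \<in> I" shows "iso_arrows (Q r) (E r x) (E r x) \<noteq> {}"
  using category_quillen_cat[OF group_H[OF assms(1)], of p] E_obj[OF assms]
  unfolding category_def iso_arrows_def by blast

lemma iso_trans:
  assumes "r \<in> R" "x \<in> I" "y \<in> I" "z \<in> I"
    and "iso_arrows (Q r) (E r x) (E r y) \<noteq> {}" "iso_arrows (Q r) (E r y) (E r z) \<noteq> {}"
  shows "iso_arrows (Q r) (E r x) (E r z) \<noteq> {}"
  using assms by (intro iso_arrows_trans[OF category_quillen_cat[OF group_H[OF assms(1)]]
    E_obj[OF assms(1,2)] E_obj[OF assms(1,3)] E_obj[OF assms(1,4)]])

text \<open>Replaces conjugacy by isomorphism in the Quillen category, which \<open>tr\<close>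
  carries from one index to another; in this form transversals at different indices can be
  compared.\<close>

lemma representatives_iff:
  assumes "r \<in> R"
  shows "representatives r E0 \<longleftrightarrow> E0 \<subseteq> I \<and>
    (\<forall>x\<in>I. \<exists>!y. y \<in> E0 \<and> iso_arrows (Q r) (E r x) (E r y) \<noteq> {})"
proof -
  define cl where "cl x = {conj_by (H r) h ` E r x | h. h \<in> carrier (H r)}" for x
  have "E r y \<in> cl x \<longleftrightarrow> iso_arrows (Q r) (E r x) (E r y) \<noteq> {}" if "x \<in> I" "y \<in> I" for x y
    using mem_class_iff[OF assms that] by (simp only: cl_def)
  then have "y \<in> E0 \<and> E r y \<in> cl x \<longleftrightarrow> y \<in> E0 \<and> iso_arrows (Q r) (E r x) (E r y) \<noteq> {}"
    if "E0 \<subseteq> I" "x \<in> I" for x y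
    using that by blast
  then have *: "(\<exists>!y. y \<in> E0 \<and> E r y \<in> cl x) \<longleftrightarrow>
      (\<exists>!y. y \<in> E0 \<and> iso_arrows (Q r) (E r x) (E r y) \<noteq> {})"
    if "E0 \<subseteq> I" "x \<in> I" for x
    using that by presburger
  have "elementary_abelian_classes p (H r) = cl ` I"
    unfolding classes_eq[OF assms] by (rule image_cong[OF refl]) (simp only: cl_def)
  then have "representatives r E0 \<longleftrightarrow> E0 \<subseteq> I \<and>
      (\<forall>x\<in>I. \<exists>!y. y \<in> E0 \<and> E r y \<in> cl x)"
    unfolding representatives_def by simp
  also have "\<dots> \<longleftrightarrow> E0 \<subseteq> I \<and>
      (\<forall>x\<in>I. \<exists>!y. y \<in> E0 \<and> iso_arrows (Q r) (E r x) (E r y) \<noteq> {})"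
    by (intro conj_cong ball_cong refl *)
  finally show ?thesis .
qed

text \<open>Isomorphic labels have the same isomorphic partners, so \<open>SOME\<close> is applied
  to equal predicates and picks the same representative for both.\<close>

lemma ex_representatives:
  assumes r: "r \<in> R"
  shows "\<exists>E0. representatives r E0"
proof -
  define rep where "rep x = (SOME y. y \<in> I \<and> iso_arrows (Q r) (E r x) (E r y) \<noteq> {})" for x
  have rep: "rep x \<in> I" "iso_arrows (Q r) (E r x) (E r (rep x)) \<noteq> {}" if "x \<in> I" for x
    using someI[of "\<lambda>y. y \<in> I \<and> iso_arrows (Q r) (E r x) (E r y) \<noteq> {}" x] iso_refl[OF r that] that
    unfolding rep_def by auto
  have rep_eq: "rep x = rep y"
    if "x \<in> I" "y \<in> I" "iso_arrows (Q r) (E r x) (E r y) \<noteq> {}" for x y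
  proof -
    have "iso_arrows (Q r) (E r x) (E r z) \<noteq> {} \<longleftrightarrow> iso_arrows (Q r) (E r y) (E r z) \<noteq> {}"
      if "z \<in> I" for z
      using iso_trans[OF r \<open>x \<in> I\<close> \<open>y \<in> I\<close> that] iso_trans[OF r \<open>y \<in> I\<close> \<open>x \<in> I\<close> that]
        \<open>iso_arrows (Q r) (E r x) (E r y) \<noteq> {}\<close> iso_arrows_sym[of "Q r" "E r x" "E r y"] by fast
    then show ?thesis
      unfolding rep_def by (simp only: cong: conj_cong)
  qed
  have "representatives r (rep ` I)"
    unfolding representatives_iff[OF r]
  proof (intro conjI ballI)
    show "rep ` I \<subseteq> I"
      using rep by blast
    fix x assume x: "x \<in> I"
    show "\<exists>!y. y \<in> rep ` I \<and> iso_arrows (Q r) (E r x) (E r y) \<noteq> {}"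
    proof (rule ex1I[of _ "rep x"])
      show "rep x \<in> rep ` I \<and> iso_arrows (Q r) (E r x) (E r (rep x)) \<noteq> {}"
        using rep[OF x] x by blast
      fix y assume y: "y \<in> rep ` I \<and> iso_arrows (Q r) (E r x) (E r y) \<noteq> {}"
      then obtain z where z: "z \<in> I" "y = rep z" by blast
      have "iso_arrows (Q r) (E r x) (E r z) \<noteq> {}"
        using y by (intro iso_trans[OF r x rep(1)[OF z(1)] z(1) _ iso_arrows_sym[OF rep(2)[OF z(1)]]])
          (simp add: z(2))
      then show "y = rep x"
        using rep_eq[OF x z(1)] z(2) by simp
    qed
  qed
  then show ?thesis by blast
qed

text \<open>Since \<open>tr_iso\<close> works in both directions, two labels are isomorphic at
  \<open>r\<close> exactly when they are at \<open>s\<close>. This is why a transversal chosen at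
  one level serves all levels.\<close>

lemma representatives_cong:
  assumes "r \<in> R" "s \<in> R" "representatives r E0"
  shows "representatives s E0"
proof -
  have "iso_arrows (Q r) (E r x) (E r y) \<noteq> {} \<longleftrightarrow> iso_arrows (Q s) (E s x) (E s y) \<noteq> {}"
    if "x \<in> I" "y \<in> I" for x y
    using tr_iso[OF assms(1,2) that] tr_iso[OF assms(2,1) that] by blast
  then have "(y \<in> E0 \<and> iso_arrows (Q r) (E r x) (E r y) \<noteq> {}) =
      (y \<in> E0 \<and> iso_arrows (Q s) (E s x) (E s y) \<noteq> {})" if "E0 \<subseteq> I" "x \<in> I" for x y
    using that by blast
  then have "(\<exists>!y. y \<in> E0 \<and> iso_arrows (Q r) (E r x) (E r y) \<noteq> {}) =
      (\<exists>!y. y \<in> E0 \<and> iso_arrows (Q s) (E s x) (E s y) \<noteq> {})" if "E0 \<subseteq> I" "x \<in> I" for x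
    using that by presburger
  then have "representatives r E0 \<longleftrightarrow> representatives s E0"
    unfolding representatives_iff[OF assms(1)] representatives_iff[OF assms(2)]
    by (intro conj_cong ball_cong refl)
  then show ?thesis
    using assms(3) by simp
qed

lemma skeleton:
  assumes r: "r \<in> R" and E0: "representatives r E0"
  shows "is_skeleton (full_subcat (Q r) (E r ` E0)) (Q r)"
proof -
  have sub: "E0 \<subseteq> I" and ex1: "\<And>x. x \<in> I \<Longrightarrow> \<exists>!y. y \<in> E0 \<and> iso_arrows (Q r) (E r x) (E r y) \<noteq> {}"
    using E0 unfolding representatives_iff[OF r] by auto
  show ?thesis
    unfolding is_skeleton_def
  proof (intro conjI ballI)
    show "category (Q r)"
      using group_H[OF r] by (rule category_quillen_cat)
    show "Obj (full_subcat (Q r) (E r ` E0)) \<subseteq> Obj (Q r)"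
      using sub E_obj[OF r] by (auto simp: full_subcat_def)
    show "full_subcat (Q r) (E r ` E0) = full_subcat (Q r) (Obj (full_subcat (Q r) (E r ` E0)))"
      by (simp add: full_subcat_def)
    fix X assume "X \<in> Obj (Q r)"
    then obtain x where x: "x \<in> I" "X = E r x"
      by (auto simp: quillen_obj objects[OF r])
    show "\<exists>!Y. Y \<in> Obj (full_subcat (Q r) (E r ` E0)) \<and> iso_arrows (Q r) X Y \<noteq> {}"
      proof -
      obtain y where y: "y \<in> E0" "iso_arrows (Q r) (E r x) (E r y) \<noteq> {}"
        "\<And>z. z \<in> E0 \<Longrightarrow> iso_arrows (Q r) (E r x) (E r z) \<noteq> {} \<Longrightarrow> z = y"
        using ex1[OF x(1)] by blast
      show ?thesis
      proof (rule ex1I[of _ "E r y"])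
        show "E r y \<in> Obj (full_subcat (Q r) (E r ` E0)) \<and> iso_arrows (Q r) X (E r y) \<noteq> {}"
          using y(1,2) unfolding x(2) by (simp add: full_subcat_def)
        fix Y assume "Y \<in> Obj (full_subcat (Q r) (E r ` E0)) \<and> iso_arrows (Q r) X Y \<noteq> {}"
        then obtain z where z: "z \<in> E0" "Y = E r z" "iso_arrows (Q r) X Y \<noteq> {}"
          by (auto simp: full_subcat_def)
        then have "z = y"
          using y(3) unfolding x(2) by blast
        then show "Y = E r y"
          using z(2) by simp
      qed
    qed
  qed
qed

text \<open>Two labels of one subgroup would both represent its class.\<close>

lemma inj_on_representatives:
  assumes r: "r \<in> R" and E0: "representatives r E0"
  shows "inj_on (E r) E0"
proof (rule inj_onI)
  fix x y assume xy: "x \<in> E0" "y \<in> E0" "E r x = E r y"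
  have "E0 \<subseteq> I" and ex1: "\<And>x. x \<in> I \<Longrightarrow> \<exists>!y. y \<in> E0 \<and> iso_arrows (Q r) (E r x) (E r y) \<noteq> {}"
    using E0 unfolding representatives_iff[OF r] by auto
  then have x: "x \<in> I" using xy by blast
  have "iso_arrows (Q r) (E r x) (E r y) \<noteq> {}"
    using iso_refl[OF r x] unfolding xy(3) .
  then show "x = y"
    using ex1[OF x] iso_refl[OF r x] xy(1,2) by blast
qed

text \<open>Within a transversal each subgroup has a single label. Hence the object map involves no
  choice and is bijective, which turns the equivalence into an isomorphism.\<close>

lemma isomorphic_subcats:
  assumes r: "r \<in> R" and s: "s \<in> R" and E0: "representatives r E0"
  shows "isomorphic_cats (full_subcat (Q r) (E r ` E0)) (full_subcat (Q s) (E s ` E0))"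
proof -
  define c where "c = inv_into E0 (E r)"
  have inj: "inj_on (E r) E0" "inj_on (E s) E0"
    by (rule inj_on_representatives[OF r E0], rule inj_on_representatives[OF s representatives_cong[OF r s E0]])
  have sub: "E0 \<subseteq> I"
    using E0 unfolding representatives_def by blast
  have c: "c (E r x) = x" if "x \<in> E0" for x
    using that inj(1) unfolding c_def by (rule inv_into_f_f[rotated])
  let ?A = "full_subcat (Q r) (E r ` E0)" and ?B = "full_subcat (Q s) (E s ` E0)"
  have obj: "Obj ?A = E r ` E0" "Obj ?B = E s ` E0"
    by (simp_all add: full_subcat_def)
  have hom: "Hom ?A = Hom (Q r)" "Hom ?B = Hom (Q s)" "Ident ?A = Ident (Q r)" "Ident ?B = Ident (Q s)"
    "Comp ?A = Comp (Q r)" "Comp ?B = Comp (Q s)"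
    by (simp_all add: full_subcat_def)
  have "E t ` E0 \<subseteq> Obj (Q t)" if "t \<in> R" for t
    using sub E_obj[OF that] by auto
  then have cat: "category ?A" "category ?B"
    using category_full_subcat[OF category_quillen_cat[OF group_H]] r s by blast+
  have I: "x \<in> I" if "x \<in> E0" for x
    using that sub by blast
  have "is_functor ?A ?B (\<lambda>X. E s (c X)) (\<lambda>X Y. tr r s (c X) (c Y))"
    unfolding is_functor_def obj hom quillen_comp ball_simps(9)
    by (intro conjI ballI cat) (simp_all add: c I tr_hom[OF r s] tr_ident[OF r s] tr_comp[OF r s])
  moreover have "bij_betw (\<lambda>X. E s (c X)) (E r ` E0) (E s ` E0)"
    using bij_betw_trans[OF bij_betw_inv_into[OF inj_on_imp_bij_betw[OF inj(1)]]
        inj_on_imp_bij_betw[OF inj(2)]]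
    by (simp add: comp_def c_def)
  moreover have "bij_betw (tr r s (c X) (c Y)) (Hom (Q r) X Y) (Hom (Q s) (E s (c X)) (E s (c Y)))"
    if XY: "X \<in> E r ` E0" "Y \<in> E r ` E0" for X Y
  proof -
    obtain x y where "x \<in> E0" "X = E r x" "y \<in> E0" "Y = E r y"
      using XY by (elim imageE)
    then show ?thesis
      using tr_bij[OF r s I I] by (simp add: c)
  qed
  ultimately show ?thesis
    unfolding isomorphic_cats_def obj hom
    by (intro exI[of _ "\<lambda>X. E s (c X)"] exI[of _ "\<lambda>X Y. tr r s (c X) (c Y)"] conjI ballI)
qed

end

text \<open>The new names have to reach every old one up to the subgroups that they define. This
  passes from the lattice data, where the work is done, to the triples, each of which may arise from
  several such data.\<close>

lemma quillen_transport_reindex: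
  assumes qt: "quillen_transport p R H I D e" and y: "\<And>j. j \<in> J \<Longrightarrow> y j \<in> I"
    and surj: "\<And>x. x \<in> I \<Longrightarrow> \<exists>j\<in>J. \<forall>r\<in>R. e r (y j) ` D (y j) = e r x ` D x"
  shows "quillen_transport p R H J (\<lambda>j. D (y j)) (\<lambda>r j. e r (y j))"
proof (rule quillen_transport.intro)
  fix r assume r: "r \<in> R"
  then show "group (H r)"
    by (rule quillen_transport.group_H[OF qt])
  show "elementary_abelian_subgroups p (H r) = (\<lambda>j. e r (y j) ` D (y j)) ` J"
    unfolding quillen_transport.objects[OF qt r]
  proof (intro equalityI subsetI)
    fix E assume "E \<in> (\<lambda>x. e r x ` D x) ` I"
    then obtain x where "x \<in> I" "E = e r x ` D x" by (elim imageE)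
    then show "E \<in> (\<lambda>j. e r (y j) ` D (y j)) ` J"
      using surj[of x] r by (metis (no_types, lifting) image_eqI)
  next
    fix E assume "E \<in> (\<lambda>j. e r (y j) ` D (y j)) ` J"
    then obtain j where "j \<in> J" "E = e r (y j) ` D (y j)" by (elim imageE)
    then show "E \<in> (\<lambda>x. e r x ` D x) ` I"
      using y[of j] by (intro image_eqI)
  qed
next
  fix r s j a b
  assume "r \<in> R" "s \<in> R" "j \<in> J" "a \<in> D (y j)" "b \<in> D (y j)" "e r (y j) a = e r (y j) b"
  then show "e s (y j) a = e s (y j) b"
    by (rule quillen_transport.kernel[OF qt _ _ y])
next
  fix r s i j h
  assume "r \<in> R" "s \<in> R" "i \<in> J" "j \<in> J" "h \<in> carrier (H r)"
    "conj_by (H r) h ` e r (y i) ` D (y i) \<subseteq> e r (y j) ` D (y j)"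
  then show "\<exists>h'\<in>carrier (H s). \<forall>a\<in>D (y i). \<forall>b\<in>D (y j).
      conj_by (H r) h (e r (y i) a) = e r (y j) b \<longleftrightarrow> conj_by (H s) h' (e s (y i) a) = e s (y j) b"
    by (rule quillen_transport.transfer[OF qt _ _ y y])
qed

section \<open>Sections of elementary abelian groups over quotients\<close>

text \<open>As x commutes with K and x^p = 1, products collect into the form k x^i, and x^(i(p-1))
  is the inverse of x^i.\<close>

lemma (in group) adjoin_element:
  assumes K: "subgroup K G" and x: "x \<in> carrier G" and xp: "x [^] (p::nat) = \<one>" and p: "p > 0"
    and comm: "\<And>k. k \<in> K \<Longrightarrow> k \<otimes> x = x \<otimes> k"
  shows "subgroup {k \<otimes> x [^] (i::nat) | k i. k \<in> K} G"
proof -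
  have Kc: "k \<in> carrier G" if "k \<in> K" for k
    using K that by (rule subgroup.mem_carrier)
  have comm': "x [^] (i::nat) \<otimes> k = k \<otimes> x [^] i" if "k \<in> K" for k i
  proof (induction i)
    case 0 then show ?case using Kc[OF that] by simp
  next
    case (Suc i)
    have "x [^] Suc i \<otimes> k = x [^] i \<otimes> (x \<otimes> k)"
      using Kc[OF that] x by (simp add: m_assoc)
    also have "\<dots> = (x [^] i \<otimes> k) \<otimes> x"
      using Kc[OF that] x comm[OF that] by (simp add: m_assoc)
    finally show ?case
      using Kc[OF that] x Suc by (simp add: m_assoc)
  qed
  show ?thesis
  proof (rule subgroupI)
    show "{k \<otimes> x [^] (i::nat) | k i. k \<in> K} \<subseteq> carrier G"
      using Kc x by auto
    show "{k \<otimes> x [^] (i::nat) | k i. k \<in> K} \<noteq> {}"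
      using subgroup.one_closed[OF K] by auto
  next
    fix a assume "a \<in> {k \<otimes> x [^] (i::nat) | k i. k \<in> K}"
    then obtain k i where a: "a = k \<otimes> x [^] (i::nat)" "k \<in> K" by auto
    have "(k \<otimes> x [^] i) \<otimes> (inv k \<otimes> x [^] (i * (p - 1))) =
      k \<otimes> (x [^] i \<otimes> inv k) \<otimes> x [^] (i * (p - 1))"
      using Kc[OF a(2)] x by (simp add: m_assoc)
    also have "\<dots> = x [^] i \<otimes> x [^] (i * (p - 1))"
      using comm'[OF subgroup.m_inv_closed[OF K a(2)]] Kc[OF a(2)] x by (simp flip: m_assoc)
    also have "\<dots> = x [^] (p * i)"
    proof -
      have "p * i = i + i * (p - 1)"
        using p by (cases p) auto
      then show ?thesis
        using x by (simp add: nat_pow_mult)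
    qed
    also have "\<dots> = \<one>"
      using xp x by (simp flip: nat_pow_pow)
    finally have "(inv k \<otimes> x [^] (i * (p - 1))) \<otimes> (k \<otimes> x [^] i) = \<one>"
      by (rule inv_comm) (use Kc[OF a(2)] x in auto)
    then have "inv a = inv k \<otimes> x [^] (i * (p - 1))"
      unfolding a(1) using Kc[OF a(2)] x by (intro inv_equality) auto
    then show "inv a \<in> {k \<otimes> x [^] (i::nat) | k i. k \<in> K}"
      using subgroup.m_inv_closed[OF K a(2)] by blast
  next
    fix a b assume "a \<in> {k \<otimes> x [^] (i::nat) | k i. k \<in> K}" "b \<in> {k \<otimes> x [^] (i::nat) | k i. k \<in> K}"
    then obtain k i l j where ab: "a = k \<otimes> x [^] (i::nat)" "k \<in> K" "b = l \<otimes> x [^] (j::nat)" "l \<in> K"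
      by auto
    have "a \<otimes> b = k \<otimes> (x [^] i \<otimes> l) \<otimes> x [^] j"
      using ab Kc x by (simp add: m_assoc)
    also have "\<dots> = (k \<otimes> l) \<otimes> x [^] (i + j)"
      using ab Kc x by (simp add: comm' m_assoc nat_pow_mult)
    finally show "a \<otimes> b \<in> {k \<otimes> x [^] (i::nat) | k i. k \<in> K}"
      using subgroup.m_closed[OF K ab(2,4)] by blast
  qed
qed

text \<open>\<open>E\<close> is a vector space over the field with p elements, and a subgroup
  \<open>K\<close> of \<open>E\<close> maximal among those on which \<pi> is injective is a
  complement of the kernel; the section inverts \<pi> on \<open>K\<close>. Finiteness of
  \<open>P\<close> bounds \<open>card K\<close>, so a maximal \<open>K\<close> exists.\<close>

lemma ex_section_elementary_abelian:
  assumes p: "prime p" and G: "group G" and P: "group P" "finite (carrier P)"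
    and E: "E \<in> elementary_abelian_subgroups p G" and \<pi>: "\<pi> \<in> hom G P"
  shows "\<exists>s. (\<forall>u\<in>\<pi> ` E. s u \<in> E \<and> \<pi> (s u) = u) \<and>
    (\<forall>u\<in>\<pi> ` E. \<forall>v\<in>\<pi> ` E. s (u \<otimes>\<^bsub>P\<^esub> v) = s u \<otimes>\<^bsub>G\<^esub> s v)"
proof -
  interpret G: group G by fact
  interpret P: group P by fact
  interpret \<pi>: group_hom G P \<pi>
    using \<pi> by (unfold_locales) 
  have sE: "subgroup E G" and commE: "\<And>x y. x \<in> E \<Longrightarrow> y \<in> E \<Longrightarrow> x \<otimes>\<^bsub>G\<^esub> y = y \<otimes>\<^bsub>G\<^esub> x"
    and expE: "\<And>x. x \<in> E \<Longrightarrow> x [^]\<^bsub>G\<^esub> p = \<one>\<^bsub>G\<^esub>"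
    using E by (auto simp: elementary_abelian_subgroups_def)
  have Ec: "x \<in> carrier G" if "x \<in> E" for x
    using sE that by (rule subgroup.mem_carrier)
  define good where "good K \<longleftrightarrow> subgroup K G \<and> K \<subseteq> E \<and> inj_on \<pi> K" for K
  have bounded: "finite K \<and> card K \<le> card (carrier P)" if "good K" for K
  proof -
    have "\<pi> ` K \<subseteq> carrier P"
      using that Ec by (auto simp: good_def)
    then show ?thesis
      using that P(2) unfolding good_def
      by (meson card_inj_on_le finite_imageD finite_subset)
  qed
  have "good {\<one>\<^bsub>G\<^esub>}"
    using G.triv_subgroup subgroup.one_closed[OF sE] by (auto simp: good_def)
  then obtain K where K: "good K" and max: "\<And>L. good L \<Longrightarrow> card L \<le> card K"
    using ex_has_greatest_nat[of good "{\<one>\<^bsub>G\<^esub>}" card "Suc (card (carrier P))"] bounded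
    by (metis le_imp_less_Suc)
  then have sK: "subgroup K G" and KE: "K \<subseteq> E" and inj: "inj_on \<pi> K"
    by (auto simp: good_def)
  interpret \<pi>K: subgroup "\<pi> ` K" P
    by (rule \<pi>.subgroup_img_is_subgroup[OF sK])
  \<comment> \<open>If \<pi> x were missed, adjoining x to \<open>K\<close> would keep \<pi>
    injective, against maximality.\<close>
  have surj: "\<pi> x \<in> \<pi> ` K" if x: "x \<in> E" for x
  proof (rule ccontr)
    assume notin: "\<pi> x \<notin> \<pi> ` K"
    define L where "L = {k \<otimes>\<^bsub>G\<^esub> x [^]\<^bsub>G\<^esub> (i::nat) | k i. k \<in> K}"
    have xc: "x \<in> carrier G" and Kc: "\<And>k. k \<in> K \<Longrightarrow> k \<in> carrier G"
      using x KE Ec by auto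
    have sL: "subgroup L G"
      unfolding L_def using sK KE xc x commE expE p prime_gt_0_nat
      by (intro G.adjoin_element[of _ _ p]) auto
    have xi: "x [^]\<^bsub>G\<^esub> (i::nat) \<in> E" for i
      by (induction i) (use x sE subgroup.one_closed subgroup.m_closed in auto)
    have LE: "L \<subseteq> E"
      unfolding L_def using KE xi subgroup.m_closed[OF sE] by auto
    have "l = \<one>\<^bsub>G\<^esub>" if l: "l \<in> L" "\<pi> l = \<one>\<^bsub>P\<^esub>" for l
    proof -
      obtain k i where ki: "l = k \<otimes>\<^bsub>G\<^esub> x [^]\<^bsub>G\<^esub> (i::nat)" "k \<in> K"
        using l(1) unfolding L_def by auto
      have eq: "\<pi> k \<otimes>\<^bsub>P\<^esub> \<pi> x [^]\<^bsub>P\<^esub> i = \<one>\<^bsub>P\<^esub>"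
        using l(2) ki Kc xc by (simp add: \<pi>.hom_nat_pow)
      \<comment> \<open>Otherwise i is invertible modulo p, and a power of (\<pi> x)^i, which lies
        in the image of \<open>K\<close>, would be \<pi> x itself.\<close>
      have "p dvd i"
      proof (rule ccontr)
        assume "\<not> p dvd i"
        then have "coprime i p"
          using p prime_imp_coprime coprime_commute by blast
        then obtain j where "[i * j = 1] (mod p)"
          using cong_solve_coprime_nat by auto
        then have "i * j mod p = 1"
          using prime_gt_1_nat[OF p] by (simp add: cong_def)
        then obtain b where b: "i * j = p * b + 1"
          by (metis mult_div_mod_eq)
        have "\<pi> x [^]\<^bsub>P\<^esub> i \<otimes>\<^bsub>P\<^esub> \<pi> k = \<one>\<^bsub>P\<^esub>"
          by (rule P.inv_comm[OF eq]) (use Kc[OF ki(2)] xc in auto)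
        then have "\<pi> x [^]\<^bsub>P\<^esub> i = \<pi> (inv\<^bsub>G\<^esub> k)"
          using Kc[OF ki(2)] xc P.inv_equality[of "\<pi> x [^]\<^bsub>P\<^esub> i" "\<pi> k"] by simp
        then have "\<pi> x [^]\<^bsub>P\<^esub> i \<in> \<pi> ` K"
          using subgroup.m_inv_closed[OF sK ki(2)] by simp
        then have "(\<pi> x [^]\<^bsub>P\<^esub> i) [^]\<^bsub>P\<^esub> j \<in> \<pi> ` K"
          by (induction j) (auto intro: \<pi>K.m_closed)
        moreover have "(\<pi> x [^]\<^bsub>P\<^esub> i) [^]\<^bsub>P\<^esub> j = \<pi> (x [^]\<^bsub>G\<^esub> (p * b + 1))"
          unfolding b[symmetric] using xc by (simp add: P.nat_pow_pow \<pi>.hom_nat_pow)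
        moreover have "x [^]\<^bsub>G\<^esub> (p * b + 1) = x"
          using xc expE[OF x] by (simp flip: G.nat_pow_mult G.nat_pow_pow)
        ultimately show False
          using notin by simp
      qed
      then have "x [^]\<^bsub>G\<^esub> i = \<one>\<^bsub>G\<^esub>"
        using xc expE[OF x] by (auto simp flip: G.nat_pow_pow)
      then have "l = k" "\<pi> k = \<pi> \<one>\<^bsub>G\<^esub>"
        using ki Kc l(2) by auto
      then show ?thesis
        using inj ki(2) subgroup.one_closed[OF sK] by (auto simp: inj_on_def)
    qed
    then have injL: "inj_on \<pi> L"
    proof -
      assume *: "\<And>l. l \<in> L \<Longrightarrow> \<pi> l = \<one>\<^bsub>P\<^esub> \<Longrightarrow> l = \<one>\<^bsub>G\<^esub>"
      show ?thesis
      proof (rule inj_onI)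
        fix a b assume ab: "a \<in> L" "b \<in> L" "\<pi> a = \<pi> b"
        have c: "a \<in> carrier G" "b \<in> carrier G"
          using ab subgroup.mem_carrier[OF sL] by simp_all
        have "a \<otimes>\<^bsub>G\<^esub> inv\<^bsub>G\<^esub> b = \<one>\<^bsub>G\<^esub>"
          using subgroup.m_closed[OF sL ab(1) subgroup.m_inv_closed[OF sL ab(2)]] ab(3) c
          by (intro *) auto
        then show "a = b"
          using c G.inv_equality[of a "inv\<^bsub>G\<^esub> b"] by simp
      qed
    qed
    have "good L"
      using sL LE injL by (auto simp: good_def)
    moreover have "k \<in> L" if "k \<in> K" for k
      unfolding L_def mem_Collect_eq using Kc[OF that] that
      by (intro exI[of _ k] exI[of _ "0::nat"]) simp
    then have "K \<subseteq> L" by blast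
    moreover have "x \<in> L"
      unfolding L_def mem_Collect_eq using xc subgroup.one_closed[OF sK]
      by (intro exI[of _ "\<one>\<^bsub>G\<^esub>"] exI[of _ "1::nat"]) simp
    moreover have "x \<notin> K"
      using notin by auto
    ultimately show False
      using \<open>K \<subseteq> L\<close> max[of L] bounded[of L] psubset_card_mono[of L K] by auto
  qed
  define s where "s = inv_into K \<pi>"
  have s: "s u \<in> K" "\<pi> (s u) = u" if "u \<in> \<pi> ` E" for u
    using that surj by (auto simp: s_def inv_into_into f_inv_into_f)
  have "s (u \<otimes>\<^bsub>P\<^esub> v) = s u \<otimes>\<^bsub>G\<^esub> s v" if uv: "u \<in> \<pi> ` E" "v \<in> \<pi> ` E" for u v
  proof -
    have c: "s u \<in> carrier G" "s v \<in> carrier G"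
      using s uv KE Ec by auto
    have "\<pi> (s u \<otimes>\<^bsub>G\<^esub> s v) = u \<otimes>\<^bsub>P\<^esub> v"
      using c s uv by simp
    then show ?thesis
      unfolding s_def using inj subgroup.m_closed[OF sK s(1)[OF uv(1)] s(1)[OF uv(2)]]
      by (metis inv_into_f_f s_def)
  qed
  then show ?thesis
    using s KE by blast
qed

section \<open>Multiples in abelian groups\<close>

primrec nscale :: "nat \<Rightarrow> 'b::ab_group_add \<Rightarrow> 'b" where
  "nscale 0 a = 0"
| "nscale (Suc n) a = a + nscale n a"

lemma nscale_add_right: "nscale n (a + b) = nscale n a + nscale n b"
  by (induction n) (simp_all add: algebra_simps)

lemma nscale_zero [simp]: "nscale n 0 = 0"
  by (induction n) simp_all

lemma nscale_minus: "nscale n (- a) = - nscale n a"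
  by (induction n) simp_all

lemma nscale_diff_right: "nscale n (a - b) = nscale n a - nscale n b"
  using nscale_add_right[of n a "- b"] by (simp add: nscale_minus)

lemma nscale_add_left: "nscale (k + n) a = nscale k a + nscale n a"
  by (induction k) (simp_all add: algebra_simps)

lemma nscale_nscale: "nscale k (nscale n a) = nscale (k * n) a"
  by (induction k) (simp_all add: nscale_add_left)

lemma nscale_one [simp]: "nscale 1 a = a" "nscale (Suc 0) a = a"
  by simp_all

lemma sum_const_nscale: "finite I \<Longrightarrow> (\<Sum>i\<in>I. a) = nscale (card I) a"
  by (induction I rule: finite_induct) simp_all

lemma nscale_pow: "nscale (p ^ i) (nscale (p ^ j) a) = nscale (p ^ (i + j)) a"
  by (simp add: nscale_nscale power_add)

lemmas nscale_simps = nscale_add_right nscale_diff_right nscale_minus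

section \<open>Cohomology of a finite p-group with coefficients in a lattice\<close>

text \<open>\<open>A\<close> is an additive copy of the lattice, and cochains are curried functions
  whose values outside the carrier of \<open>P\<close> are immaterial. In the cocycle identities the
  negative terms are moved across, so that they read as equations between sums.\<close>

locale extension_data =
  fixes p m :: nat and P :: "'g monoid" and A :: "'b::ab_group_add set" and act :: "'g \<Rightarrow> 'b \<Rightarrow> 'b"
    and \<rho> \<sigma> :: "'g \<Rightarrow> 'g \<Rightarrow> 'b" and \<eta> :: "'g \<Rightarrow> 'g \<Rightarrow> 'g \<Rightarrow> 'b"
  assumes p: "prime p" and group_P: "group P" and order_P: "order P = p ^ m"
    and A_zero [simp]: "0 \<in> A" and A_add [simp]: "a \<in> A \<Longrightarrow> b \<in> A \<Longrightarrow> a + b \<in> A"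
    and A_minus [simp]: "a \<in> A \<Longrightarrow> - a \<in> A"
    and act_closed [simp]: "g \<in> carrier P \<Longrightarrow> a \<in> A \<Longrightarrow> act g a \<in> A"
    and act_add: "g \<in> carrier P \<Longrightarrow> a \<in> A \<Longrightarrow> b \<in> A \<Longrightarrow> act g (a + b) = act g a + act g b"
    and act_one [simp]: "a \<in> A \<Longrightarrow> act \<one>\<^bsub>P\<^esub> a = a"
    and act_act: "g \<in> carrier P \<Longrightarrow> h \<in> carrier P \<Longrightarrow> a \<in> A \<Longrightarrow> act g (act h a) = act (g \<otimes>\<^bsub>P\<^esub> h) a"
    and torsion_free: "a \<in> A \<Longrightarrow> nscale p a = 0 \<Longrightarrow> a = 0"
    and separated: "a \<in> A \<Longrightarrow> (\<And>k. \<exists>b\<in>A. a = nscale (p ^ k) b) \<Longrightarrow> a = 0"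
    and \<rho>_closed [simp]: "g \<in> carrier P \<Longrightarrow> h \<in> carrier P \<Longrightarrow> \<rho> g h \<in> A"
    and \<sigma>_closed [simp]: "g \<in> carrier P \<Longrightarrow> h \<in> carrier P \<Longrightarrow> \<sigma> g h \<in> A"
    and \<eta>_closed [simp]: "g \<in> carrier P \<Longrightarrow> h \<in> carrier P \<Longrightarrow> k \<in> carrier P \<Longrightarrow> \<eta> g h k \<in> A"
    and \<rho>_one [simp]: "g \<in> carrier P \<Longrightarrow> \<rho> g \<one>\<^bsub>P\<^esub> = 0" "g \<in> carrier P \<Longrightarrow> \<rho> \<one>\<^bsub>P\<^esub> g = 0"
    and \<sigma>_one [simp]: "g \<in> carrier P \<Longrightarrow> \<sigma> g \<one>\<^bsub>P\<^esub> = 0" "g \<in> carrier P \<Longrightarrow> \<sigma> \<one>\<^bsub>P\<^esub> g = 0"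
    and \<rho>_cocycle: "g \<in> carrier P \<Longrightarrow> h \<in> carrier P \<Longrightarrow> k \<in> carrier P \<Longrightarrow>
      act g (\<rho> h k) + \<rho> g (h \<otimes>\<^bsub>P\<^esub> k) = \<rho> (g \<otimes>\<^bsub>P\<^esub> h) k + \<rho> g h"
    and \<sigma>_coboundary: "g \<in> carrier P \<Longrightarrow> h \<in> carrier P \<Longrightarrow> k \<in> carrier P \<Longrightarrow>
      act g (\<sigma> h k) + \<sigma> g (h \<otimes>\<^bsub>P\<^esub> k) = \<sigma> (g \<otimes>\<^bsub>P\<^esub> h) k + \<sigma> g h + nscale (p ^ m) (\<eta> g h k)"
begin

sublocale P: group P by (rule group_P)

lemma finite_P: "finite (carrier P)"
  using order_P p P.order_gt_0_iff_finite by (simp add: prime_gt_0_nat)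

lemma A_diff [simp]: "a \<in> A \<Longrightarrow> b \<in> A \<Longrightarrow> a - b \<in> A"
  using A_add[of a "- b"] by simp

lemma A_sum: "(\<And>i. i \<in> I \<Longrightarrow> f i \<in> A) \<Longrightarrow> (\<Sum>i\<in>I. f i) \<in> A"
  by (induction I rule: infinite_finite_induct) simp_all

lemma A_nscale [simp]: "a \<in> A \<Longrightarrow> nscale n a \<in> A"
  by (induction n) simp_all

lemma act_zero [simp]: "g \<in> carrier P \<Longrightarrow> act g 0 = 0"
  using act_add[of g 0 0] by simp

lemma act_minus: "g \<in> carrier P \<Longrightarrow> a \<in> A \<Longrightarrow> act g (- a) = - act g a"
  using act_add[of g a "- a"] by (simp add: eq_neg_iff_add_eq_0 add.commute)

lemma act_diff: "g \<in> carrier P \<Longrightarrow> a \<in> A \<Longrightarrow> b \<in> A \<Longrightarrow> act g (a - b) = act g a - act g b"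
  using act_add[of g a "- b"] by (simp add: act_minus)

lemma act_nscale: "g \<in> carrier P \<Longrightarrow> a \<in> A \<Longrightarrow> act g (nscale n a) = nscale n (act g a)"
  by (induction n) (simp_all add: act_add)

lemma act_sum: "g \<in> carrier P \<Longrightarrow> (\<And>i. i \<in> I \<Longrightarrow> f i \<in> A) \<Longrightarrow> act g (\<Sum>i\<in>I. f i) = (\<Sum>i\<in>I. act g (f i))"
  by (induction I rule: infinite_finite_induct) (simp_all add: act_add A_sum)

lemmas act_simps = act_add act_diff act_minus act_nscale act_act

lemma nscale_p_power_cancel:
  assumes "a \<in> A" "b \<in> A" "nscale (p ^ n) a = nscale (p ^ n) b" shows "a = b"
proof -
  have "c = 0" if "c \<in> A" "nscale (p ^ n) c = 0" for c
    using that
  proof (induction n)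
    case (Suc n)
    then have "nscale p (nscale (p ^ n) c) = 0"
      by (simp add: nscale_nscale)
    then show ?case
      using Suc torsion_free[of "nscale (p ^ n) c"] by simp
  qed simp
  from this[of "a - b"] show ?thesis
    using assms by (simp add: nscale_diff_right)
qed

section \<open>Congruences modulo p^n A\<close>

definition cong_p where "cong_p n a b \<longleftrightarrow> (\<exists>c\<in>A. a = b + nscale (p ^ n) c)"

lemma cong_p_refl [simp]: "cong_p n a a"
  unfolding cong_p_def by (rule bexI[of _ 0]) simp_all

lemma cong_pI: "a - b = nscale (p ^ n) c \<Longrightarrow> c \<in> A \<Longrightarrow> cong_p n a b"
  unfolding cong_p_def by (rule bexI[of _ c]) (simp_all add: algebra_simps)

lemma cong_p_sym: "cong_p n a b \<Longrightarrow> cong_p n b a"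
  unfolding cong_p_def by (metis A_minus add_diff_cancel_right' diff_conv_add_uminus nscale_minus)

lemma cong_p_trans: "cong_p n a b \<Longrightarrow> cong_p n b c \<Longrightarrow> cong_p n a c"
  unfolding cong_p_def by (metis A_add add.assoc add.commute nscale_add_right)

lemma cong_p_add: "cong_p n a b \<Longrightarrow> cong_p n a' b' \<Longrightarrow> cong_p n (a + a') (b + b')"
proof -
  assume "cong_p n a b" "cong_p n a' b'"
  then obtain c c' where "c \<in> A" "c' \<in> A" "a = b + nscale (p ^ n) c" "a' = b' + nscale (p ^ n) c'"
    unfolding cong_p_def by blast
  then show ?thesis
    by (intro cong_pI[of _ _ _ "c + c'"]) (simp_all add: nscale_simps algebra_simps)
qed

lemma cong_p_minus: "cong_p n a b \<Longrightarrow> cong_p n (- a) (- b)"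
proof -
  assume "cong_p n a b"
  then obtain c where "c \<in> A" "a = b + nscale (p ^ n) c"
    unfolding cong_p_def by blast
  then show ?thesis
    by (intro cong_pI[of _ _ _ "- c"]) (simp_all add: nscale_minus)
qed

lemma cong_p_diff: "cong_p n a b \<Longrightarrow> cong_p n a' b' \<Longrightarrow> cong_p n (a - a') (b - b')"
  using cong_p_add[of n a b "- a'" "- b'"] cong_p_minus by simp

lemma cong_p_act: "cong_p n a b \<Longrightarrow> b \<in> A \<Longrightarrow> g \<in> carrier P \<Longrightarrow> cong_p n (act g a) (act g b)"
proof -
  assume *: "cong_p n a b" "b \<in> A" "g \<in> carrier P"
  then obtain c where "c \<in> A" "a = b + nscale (p ^ n) c"
    unfolding cong_p_def by blast
  then show ?thesis
    using * by (intro cong_pI[of _ _ _ "act g c"]) (simp_all add: act_simps)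
qed

lemma cong_p_mono: "cong_p n a b \<Longrightarrow> k \<le> n \<Longrightarrow> cong_p k a b"
  unfolding cong_p_def by (metis A_nscale le_add_diff_inverse nscale_pow)

text \<open>Dividing a congruence by p^k is possible because \<open>A\<close> is
  torsion-free.\<close>

lemma cong_p_nscale_iff:
  assumes "a \<in> A" "b \<in> A"
  shows "cong_p (k + n) (nscale (p ^ k) a) (nscale (p ^ k) b) \<longleftrightarrow> cong_p n a b"
proof
  assume "cong_p (k + n) (nscale (p ^ k) a) (nscale (p ^ k) b)"
  then obtain c where c: "c \<in> A" "nscale (p ^ k) a = nscale (p ^ k) (b + nscale (p ^ n) c)"
    unfolding cong_p_def by (auto simp: nscale_add_right nscale_pow)
  have "a = b + nscale (p ^ n) c"
    by (rule nscale_p_power_cancel[OF assms(1) _ c(2)]) (simp add: assms(2) c(1))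
  then show "cong_p n a b"
    using c(1) unfolding cong_p_def by blast
next
  assume "cong_p n a b"
  then obtain c where "c \<in> A" "a = b + nscale (p ^ n) c"
    unfolding cong_p_def by blast
  then show "cong_p (k + n) (nscale (p ^ k) a) (nscale (p ^ k) b)"
    by (intro cong_pI[of _ _ _ c]) (simp_all add: nscale_add_right nscale_pow)
qed

text \<open>Arbitrarily large exponents suffice, since a congruence modulo p^k implies those modulo
  lower powers; then \<open>separated\<close> applies to the difference.\<close>

lemma cong_p_eqI:
  assumes "a \<in> A" "b \<in> A" "\<And>n. \<exists>k\<ge>n. cong_p k a b"
  shows "a = b"
proof -
  have "\<exists>c\<in>A. a - b = nscale (p ^ n) c" for n
  proof -
    have "cong_p n a b"
      using assms(3)[of n] cong_p_mono by blast
    then show ?thesis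
      unfolding cong_p_def by (auto simp: algebra_simps)
  qed
  then have "a - b = 0"
    using assms by (intro separated) simp_all
  then show ?thesis by simp
qed

section \<open>The order of P annihilates H^1 and H^2 of its subgroups\<close>

lemma p_power_eq_mult_card:
  assumes "subgroup U P" obtains j where "p ^ m = j * card U"
  using P.lagrange[OF assms] order_P by metis

lemma sum_translate:
  assumes U: "subgroup U P" and u: "u \<in> U"
  shows "(\<Sum>v\<in>U. f (u \<otimes>\<^bsub>P\<^esub> v)) = (\<Sum>v\<in>U. f v)"
proof (rule sum.reindex_bij_witness[where i = "\<lambda>v. inv\<^bsub>P\<^esub> u \<otimes>\<^bsub>P\<^esub> v" and j = "\<lambda>v. u \<otimes>\<^bsub>P\<^esub> v"])
  have c: "w \<in> carrier P" if "w \<in> U" for w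
    using U that by (rule subgroup.mem_carrier)
  fix v assume v: "v \<in> U"
  show "inv\<^bsub>P\<^esub> u \<otimes>\<^bsub>P\<^esub> (u \<otimes>\<^bsub>P\<^esub> v) = v" "u \<otimes>\<^bsub>P\<^esub> (inv\<^bsub>P\<^esub> u \<otimes>\<^bsub>P\<^esub> v) = v"
    using c[OF u] c[OF v] by (simp_all flip: P.m_assoc)
  show "inv\<^bsub>P\<^esub> u \<otimes>\<^bsub>P\<^esub> v \<in> U" "u \<otimes>\<^bsub>P\<^esub> v \<in> U"
    using U u v subgroup.m_closed subgroup.m_inv_closed by metis+
qed simp

text \<open>Summing c(uv) = u c(v) + c(u) over v gives |U| c(u) = s - u s, where s is the sum of all
  values of c, because v -> uv permutes U. As |U| divides p^m, a multiple of -s is the required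
  element.\<close>

lemma one_cocycle_order:
  assumes U: "subgroup U P" and cA: "\<And>u. u \<in> U \<Longrightarrow> c u \<in> A"
    and c: "\<And>u v. u \<in> U \<Longrightarrow> v \<in> U \<Longrightarrow> c (u \<otimes>\<^bsub>P\<^esub> v) = act u (c v) + c u"
  shows "\<exists>a\<in>A. \<forall>u\<in>U. nscale (p ^ m) (c u) = act u a - a"
proof -
  have Uc: "w \<in> carrier P" if "w \<in> U" for w
    using U that by (rule subgroup.mem_carrier)
  have fin: "finite U"
    using finite_subset[OF subgroup.subset[OF U] finite_P] .
  obtain j where j: "p ^ m = j * card U"
    using p_power_eq_mult_card[OF U] .
  define s where "s = (\<Sum>v\<in>U. c v)"
  have sA: "s \<in> A"
    unfolding s_def by (rule A_sum) (rule cA)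
  show ?thesis
  proof (intro bexI[of _ "- nscale j s"] ballI)
    show "- nscale j s \<in> A"
      using sA by simp
    fix u assume u: "u \<in> U"
    have "s = (\<Sum>v\<in>U. act u (c v) + c u)"
      unfolding s_def sum_translate[OF U u, of c, symmetric] by (intro sum.cong refl c u)
    also have "\<dots> = act u s + nscale (card U) (c u)"
      unfolding s_def using fin Uc[OF u] cA by (simp add: sum.distrib act_sum sum_const_nscale)
    finally have "nscale (card U) (c u) = s - act u s"
      by (simp add: algebra_simps)
    then have "nscale (p ^ m) (c u) = nscale j (s - act u s)"
      unfolding j nscale_nscale[symmetric] by simp
    then show "nscale (p ^ m) (c u) = act u (- nscale j s) - - nscale j s"
      using Uc[OF u] sA by (simp add: act_simps nscale_simps)
  qed
qed

text \<open>Summing the identity over w shows that |U| z is the coboundary of the function sending u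
  to the sum of all z(u, w); multiplying by p^m/|U| gives \<psi>. By \<open>z1\<close> it is
  normalized.\<close>

lemma two_cocycle_order:
  assumes U: "subgroup U P" and zA: "\<And>u v. u \<in> U \<Longrightarrow> v \<in> U \<Longrightarrow> z u v \<in> A"
    and z1: "\<And>v. v \<in> U \<Longrightarrow> z \<one>\<^bsub>P\<^esub> v = 0"
    and z: "\<And>u v w. u \<in> U \<Longrightarrow> v \<in> U \<Longrightarrow> w \<in> U \<Longrightarrow>
      act u (z v w) + z u (v \<otimes>\<^bsub>P\<^esub> w) = z (u \<otimes>\<^bsub>P\<^esub> v) w + z u v"
  shows "\<exists>\<psi>. (\<forall>u\<in>U. \<psi> u \<in> A) \<and> \<psi> \<one>\<^bsub>P\<^esub> = 0 \<and>
    (\<forall>u\<in>U. \<forall>v\<in>U. nscale (p ^ m) (z u v) = act u (\<psi> v) - \<psi> (u \<otimes>\<^bsub>P\<^esub> v) + \<psi> u)"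
proof -
  have Uc: "w \<in> carrier P" if "w \<in> U" for w
    using U that by (rule subgroup.mem_carrier)
  have fin: "finite U"
    using finite_subset[OF subgroup.subset[OF U] finite_P] .
  obtain j where j: "p ^ m = j * card U"
    using p_power_eq_mult_card[OF U] .
  define s where "s u = (\<Sum>v\<in>U. z u v)" for u
  have sA: "s u \<in> A" if "u \<in> U" for u
    unfolding s_def by (rule A_sum) (rule zA[OF that])
  have m_closed: "u \<otimes>\<^bsub>P\<^esub> v \<in> U" if "u \<in> U" "v \<in> U" for u v
    using subgroup.m_closed[OF U that] .
  show ?thesis
  proof (intro exI[of _ "\<lambda>u. nscale j (s u)"] conjI ballI)
    show "nscale j (s u) \<in> A" if "u \<in> U" for u
      using sA[OF that] by simp
    show "nscale j (s \<one>\<^bsub>P\<^esub>) = 0"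
      unfolding s_def using z1 by simp
    fix u v assume uv: "u \<in> U" "v \<in> U"
    have "act u (s v) + s u = (\<Sum>w\<in>U. act u (z v w) + z u (v \<otimes>\<^bsub>P\<^esub> w))"
      unfolding s_def using Uc uv zA
      by (simp add: sum.distrib act_sum sum_translate[OF U uv(2), of "z u"])
    also have "\<dots> = (\<Sum>w\<in>U. z (u \<otimes>\<^bsub>P\<^esub> v) w + z u v)"
      by (intro sum.cong refl z uv)
    also have "\<dots> = s (u \<otimes>\<^bsub>P\<^esub> v) + nscale (card U) (z u v)"
      unfolding s_def using fin by (simp add: sum.distrib sum_const_nscale)
    finally have "nscale (card U) (z u v) = act u (s v) - s (u \<otimes>\<^bsub>P\<^esub> v) + s u"
      by (simp add: algebra_simps)
    then have "nscale (p ^ m) (z u v) = nscale j (act u (s v) - s (u \<otimes>\<^bsub>P\<^esub> v) + s u)"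
      unfolding j nscale_nscale[symmetric] by simp
    then show "nscale (p ^ m) (z u v) =
      act u (nscale j (s v)) - nscale j (s (u \<otimes>\<^bsub>P\<^esub> v)) + nscale j (s u)"
      using Uc uv sA by (simp add: act_simps nscale_simps)
  qed
qed

end

section \<open>The extensions along the family\<close>

lemma (in group) conj_by_eq_iff:
  assumes "h \<in> carrier G" "x \<in> carrier G" "y \<in> carrier G"
  shows "conj_by G h x = y \<longleftrightarrow> h \<otimes> x = y \<otimes> h"
  unfolding conj_by_def using assms inv_solve_right[of y "h \<otimes> x" h] by (metis m_closed inv_solve_right')

text \<open>\<open>q r\<close> stands for the projection of \<open>A\<close> onto T/p^(r+1)T, and
  \<open>H r\<close> for G_(r+1). The group is described on representatives, so that equations in it
  become congruences in \<open>A\<close>.\<close>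

locale extension_family = extension_data p m P A act \<rho> \<sigma> \<eta>
  for p m and P :: "'g monoid" and A :: "'b::ab_group_add set" and act \<rho> \<sigma> \<eta> +
  fixes r0 :: nat and q :: "nat \<Rightarrow> 'b \<Rightarrow> 'c" and H :: "nat \<Rightarrow> ('c \<times> 'g) monoid"
  assumes m_pos: "m \<ge> 1" and r0: "3 * m \<le> r0"
    and q_eq_iff: "a \<in> A \<Longrightarrow> b \<in> A \<Longrightarrow> q r a = q r b \<longleftrightarrow> cong_p (r + 1) a b"
    and carrier_H: "r \<ge> r0 \<Longrightarrow> carrier (H r) = q r ` A \<times> carrier P"
    and mult_H: "r \<ge> r0 \<Longrightarrow> a \<in> A \<Longrightarrow> b \<in> A \<Longrightarrow> g \<in> carrier P \<Longrightarrow> h \<in> carrier P \<Longrightarrow>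
      (q r a, g) \<otimes>\<^bsub>H r\<^esub> (q r b, h) =
      (q r (a + act g b + (\<rho> g h + nscale (p ^ (r + 1 - m)) (\<sigma> g h))), g \<otimes>\<^bsub>P\<^esub> h)"
    and one_H: "r \<ge> r0 \<Longrightarrow> \<one>\<^bsub>H r\<^esub> = (q r 0, \<one>\<^bsub>P\<^esub>)"
begin

definition \<tau> where "\<tau> r g h = \<rho> g h + nscale (p ^ (r + 1 - m)) (\<sigma> g h)"

lemma \<tau>_closed [simp]: "g \<in> carrier P \<Longrightarrow> h \<in> carrier P \<Longrightarrow> \<tau> r g h \<in> A"
  by (simp add: \<tau>_def)

lemma \<tau>_one [simp]: "g \<in> carrier P \<Longrightarrow> \<tau> r g \<one>\<^bsub>P\<^esub> = 0" "g \<in> carrier P \<Longrightarrow> \<tau> r \<one>\<^bsub>P\<^esub> g = 0"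
  by (simp_all add: \<tau>_def)

lemmas mult_H' = mult_H[folded \<tau>_def]

text \<open>The m missing in the exponent at \<sigma> is regained from \<Delta>\<sigma> = p^m
  \<eta>, so \<tau> is a cocycle modulo p^(r+1).\<close>

lemma \<tau>_coboundary:
  assumes r: "r \<ge> r0" and g: "g \<in> carrier P" "h \<in> carrier P" "k \<in> carrier P"
  shows "act g (\<tau> r h k) + \<tau> r g (h \<otimes>\<^bsub>P\<^esub> k) =
    \<tau> r (g \<otimes>\<^bsub>P\<^esub> h) k + \<tau> r g h + nscale (p ^ (r + 1)) (\<eta> g h k)"
proof -
  have "r + 1 = (r + 1 - m) + m"
    using r r0 by simp
  then have "nscale (p ^ (r + 1)) (\<eta> g h k) = nscale (p ^ (r + 1 - m)) (nscale (p ^ m) (\<eta> g h k))"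
    by (simp only: nscale_pow)
  moreover have "nscale (p ^ (r + 1 - m)) (act g (\<sigma> h k) + \<sigma> g (h \<otimes>\<^bsub>P\<^esub> k)) =
    nscale (p ^ (r + 1 - m)) (\<sigma> (g \<otimes>\<^bsub>P\<^esub> h) k + \<sigma> g h + nscale (p ^ m) (\<eta> g h k))"
    using \<sigma>_coboundary[OF g] by simp
  ultimately have "nscale (p ^ (r + 1)) (\<eta> g h k) + nscale (p ^ (r + 1 - m)) (\<sigma> (g \<otimes>\<^bsub>P\<^esub> h) k) +
      nscale (p ^ (r + 1 - m)) (\<sigma> g h) =
    nscale (p ^ (r + 1 - m)) (act g (\<sigma> h k)) + nscale (p ^ (r + 1 - m)) (\<sigma> g (h \<otimes>\<^bsub>P\<^esub> k))"
    by (simp add: nscale_add_right algebra_simps)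
  then show ?thesis
    using \<rho>_cocycle[OF g] g by (simp add: \<tau>_def act_add act_nscale algebra_simps)
qed

lemma carrier_HE:
  assumes "r \<ge> r0" "x \<in> carrier (H r)"
  obtains a g where "a \<in> A" "g \<in> carrier P" "x = (q r a, g)"
  using assms by (auto simp: carrier_H)

lemma H_memI: "r \<ge> r0 \<Longrightarrow> a \<in> A \<Longrightarrow> g \<in> carrier P \<Longrightarrow> (q r a, g) \<in> carrier (H r)"
  by (simp add: carrier_H)

lemma group_H: assumes r: "r \<ge> r0" shows "group (H r)"
proof (rule groupI)
  fix x y assume x: "x \<in> carrier (H r)" and y: "y \<in> carrier (H r)"
  obtain a g where x': "a \<in> A" "g \<in> carrier P" "x = (q r a, g)"
    using carrier_HE[OF r x] .
  obtain b h where y': "b \<in> A" "h \<in> carrier P" "y = (q r b, h)"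
    using carrier_HE[OF r y] .
  show "x \<otimes>\<^bsub>H r\<^esub> y \<in> carrier (H r)"
    using x' y' r by (simp add: mult_H' H_memI)
  fix z assume z: "z \<in> carrier (H r)"
  obtain c k where z': "c \<in> A" "k \<in> carrier P" "z = (q r c, k)"
    using carrier_HE[OF r z] .
  \<comment> \<open>On representatives associativity fails by p^(r+1) \<open>\<eta> g h k\<close>,
    which \<open>q r\<close> does not see.\<close>
  have "cong_p (r + 1) (a + act g b + \<tau> r g h + act (g \<otimes>\<^bsub>P\<^esub> h) c + \<tau> r (g \<otimes>\<^bsub>P\<^esub> h) k)
    (a + act g (b + act h c + \<tau> r h k) + \<tau> r g (h \<otimes>\<^bsub>P\<^esub> k))"
    using \<tau>_coboundary[OF r x'(2) y'(2) z'(2)] x' y' z'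
    by (intro cong_pI[of _ _ _ "- \<eta> g h k"]) (simp_all add: act_simps nscale_simps algebra_simps)
  then show "x \<otimes>\<^bsub>H r\<^esub> y \<otimes>\<^bsub>H r\<^esub> z = x \<otimes>\<^bsub>H r\<^esub> (y \<otimes>\<^bsub>H r\<^esub> z)"
    using x' y' z' r by (simp add: mult_H' q_eq_iff P.m_assoc)
next
  show "\<one>\<^bsub>H r\<^esub> \<in> carrier (H r)"
    using r by (simp add: one_H H_memI)
next
  fix x assume "x \<in> carrier (H r)"
  then obtain a g where x': "a \<in> A" "g \<in> carrier P" "x = (q r a, g)"
    using carrier_HE[OF r] by blast
  show "\<one>\<^bsub>H r\<^esub> \<otimes>\<^bsub>H r\<^esub> x = x"
    using x' r by (simp add: mult_H' one_H)
  let ?i = "inv\<^bsub>P\<^esub> g"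
  show "\<exists>y\<in>carrier (H r). y \<otimes>\<^bsub>H r\<^esub> x = \<one>\<^bsub>H r\<^esub>"
  proof (rule bexI[of _ "(q r (- act ?i a - \<tau> r ?i g), ?i)"])
    show "(q r (- act ?i a - \<tau> r ?i g), ?i) \<otimes>\<^bsub>H r\<^esub> x = \<one>\<^bsub>H r\<^esub>"
      using x' r by (simp add: mult_H' one_H)
    show "(q r (- act ?i a - \<tau> r ?i g), ?i) \<in> carrier (H r)"
      using x' r by (simp add: H_memI)
  qed
qed

text \<open>A sequence of level \<omega> \<le> 2m has a correction p^(r-\<omega>) times a value in
  pT, hence a multiple of p^(r+1-\<omega>). Absorbing the factor p^(2m-\<omega>) into \<psi> makes
  one exponent serve all these levels.\<close>

definition F where "F \<phi> \<psi> r u = \<phi> u + nscale (p ^ (r + 1 - 2 * m)) (\<psi> u)"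

text \<open>The data \<open>(U, \<phi>, \<psi>, W)\<close> encode a triple of the paper: \<open>f\<^sub>r\<close> is the class of
  \<open>\<phi> + p\<^sup>r\<^sup>+\<^sup>1\<^sup>-\<^sup>2\<^sup>m\<psi>\<close>, and \<open>W\<close> is replaced by its preimage in \<open>T\<close>.\<close>

definition good where
  "good U \<phi> \<psi> W \<longleftrightarrow> U \<in> elementary_abelian_subgroups p P \<and>
     (\<forall>u\<in>U. \<phi> u \<in> A) \<and> (\<forall>u\<in>U. \<psi> u \<in> A) \<and> \<phi> \<one>\<^bsub>P\<^esub> = 0 \<and> \<psi> \<one>\<^bsub>P\<^esub> = 0 \<and>
     (\<forall>r\<ge>r0. \<forall>u\<in>U. \<forall>v\<in>U.
        cong_p (r + 1) (F \<phi> \<psi> r (u \<otimes>\<^bsub>P\<^esub> v) + \<tau> r u v) (act u (F \<phi> \<psi> r v) + F \<phi> \<psi> r u)) \<and>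
     W \<subseteq> A \<and> 0 \<in> W \<and> (\<forall>w\<in>W. \<forall>w'\<in>W. w + w' \<in> W) \<and> (\<forall>w\<in>W. - w \<in> W) \<and>
     (\<forall>a\<in>A. nscale p a \<in> W) \<and> (\<forall>u\<in>U. \<forall>w\<in>W. cong_p 1 (act u w) w)"

text \<open>The labels (w, u) do not involve the level. The sign is the one for which u -> (-f(u),
  u) is multiplicative exactly when \<Delta>f = \<tau>.\<close>

definition e where
  "e r \<phi> \<psi> = (\<lambda>(w, u). (q r (nscale (p ^ r) w - F \<phi> \<psi> r u), u))"

context
  fixes U \<phi> \<psi> W assumes good: "good U \<phi> \<psi> W"
begin

lemma good_U: "U \<in> elementary_abelian_subgroups p P" "subgroup U P"
  and good_comm: "\<And>u v. u \<in> U \<Longrightarrow> v \<in> U \<Longrightarrow> u \<otimes>\<^bsub>P\<^esub> v = v \<otimes>\<^bsub>P\<^esub> u"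
  and good_exp: "\<And>u. u \<in> U \<Longrightarrow> u [^]\<^bsub>P\<^esub> p = \<one>\<^bsub>P\<^esub>"
  and good_closed [simp]: "\<And>u. u \<in> U \<Longrightarrow> \<phi> u \<in> A" "\<And>u. u \<in> U \<Longrightarrow> \<psi> u \<in> A"
  and good_one [simp]: "\<phi> \<one>\<^bsub>P\<^esub> = 0" "\<psi> \<one>\<^bsub>P\<^esub> = 0"
  and good_F: "\<And>r u v. r \<ge> r0 \<Longrightarrow> u \<in> U \<Longrightarrow> v \<in> U \<Longrightarrow>
    cong_p (r + 1) (F \<phi> \<psi> r (u \<otimes>\<^bsub>P\<^esub> v) + \<tau> r u v) (act u (F \<phi> \<psi> r v) + F \<phi> \<psi> r u)"
  and good_W [simp]: "\<And>w. w \<in> W \<Longrightarrow> w \<in> A" "0 \<in> W" "\<And>w w'. w \<in> W \<Longrightarrow> w' \<in> W \<Longrightarrow> w + w' \<in> W"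
    "\<And>w. w \<in> W \<Longrightarrow> - w \<in> W"
  and good_fixed: "\<And>u w. u \<in> U \<Longrightarrow> w \<in> W \<Longrightarrow> cong_p 1 (act u w) w"
  using good unfolding good_def elementary_abelian_subgroups_def by auto

lemma good_Uc [simp]: "u \<in> U \<Longrightarrow> u \<in> carrier P"
  by (rule subgroup.mem_carrier[OF good_U(2)])

lemma good_U_closed [simp]: "u \<in> U \<Longrightarrow> v \<in> U \<Longrightarrow> u \<otimes>\<^bsub>P\<^esub> v \<in> U" "u \<in> U \<Longrightarrow> inv\<^bsub>P\<^esub> u \<in> U" "\<one>\<^bsub>P\<^esub> \<in> U"
  by (rule subgroup.m_closed[OF good_U(2)] subgroup.m_inv_closed[OF good_U(2)]
    subgroup.one_closed[OF good_U(2)]; assumption?)+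

lemma good_W_nscale [simp]: "w \<in> W \<Longrightarrow> nscale n w \<in> W"
  by (induction n) simp_all

lemma F_closed [simp]: "u \<in> U \<Longrightarrow> F \<phi> \<psi> r u \<in> A"
  by (simp add: F_def)

lemma F_one [simp]: "F \<phi> \<psi> r \<one>\<^bsub>P\<^esub> = 0"
  by (simp add: F_def)

lemma e_carrier: "r \<ge> r0 \<Longrightarrow> w \<in> W \<Longrightarrow> u \<in> U \<Longrightarrow> e r \<phi> \<psi> (w, u) \<in> carrier (H r)"
  by (simp add: e_def H_memI)

text \<open>U fixes w' modulo p, hence p^r w' modulo p^(r+1), so the W-parts simply add;
  \<open>good_F\<close> combines the remaining terms.\<close>

lemma e_mult:
  assumes r: "r \<ge> r0" and w: "w \<in> W" "w' \<in> W" and u: "u \<in> U" "u' \<in> U"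
  shows "e r \<phi> \<psi> (w, u) \<otimes>\<^bsub>H r\<^esub> e r \<phi> \<psi> (w', u') = e r \<phi> \<psi> (w + w', u \<otimes>\<^bsub>P\<^esub> u')"
proof -
  let ?F = "F \<phi> \<psi> r"
  have "cong_p (r + 1) (nscale (p ^ r) (act u w')) (nscale (p ^ r) w')"
    using good_fixed[OF u(1) w(2)] u w by (subst cong_p_nscale_iff) simp_all
  then have "cong_p (r + 1) (nscale (p ^ r) w + nscale (p ^ r) (act u w') - (act u (?F u') + ?F u) + \<tau> r u u')
    (nscale (p ^ r) w + nscale (p ^ r) w' - (?F (u \<otimes>\<^bsub>P\<^esub> u') + \<tau> r u u') + \<tau> r u u')"
    by (intro cong_p_add cong_p_diff cong_p_refl cong_p_sym[OF good_F] r u)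
  then have "cong_p (r + 1) (nscale (p ^ r) w - ?F u + act u (nscale (p ^ r) w' - ?F u') + \<tau> r u u')
    (nscale (p ^ r) (w + w') - ?F (u \<otimes>\<^bsub>P\<^esub> u'))"
    using u w by (simp add: act_simps nscale_simps algebra_simps)
  then show ?thesis
    using u w r by (simp add: e_def mult_H' q_eq_iff)
qed

lemma e_one: "r \<ge> r0 \<Longrightarrow> e r \<phi> \<psi> (0, \<one>\<^bsub>P\<^esub>) = \<one>\<^bsub>H r\<^esub>"
  by (simp add: e_def one_H)

lemma e_pow:
  assumes "r \<ge> r0" "w \<in> W" "u \<in> U"
  shows "e r \<phi> \<psi> (w, u) [^]\<^bsub>H r\<^esub> (n::nat) = e r \<phi> \<psi> (nscale n w, u [^]\<^bsub>P\<^esub> n)"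
proof (induction n)
  case 0 then show ?case using assms by (simp add: e_one)
next
  case (Suc n)
  have "u [^]\<^bsub>P\<^esub> n \<in> U"
    by (induction n) (use assms in simp_all)
  then show ?case
    using Suc assms by (simp add: e_mult add.commute)
qed

text \<open>The right-hand side does not mention the level; this supplies the assumption
  \<open>kernel\<close> of the transport.\<close>

lemma e_eq_iff:
  assumes "r \<ge> r0" "w \<in> W" "u \<in> U" "w' \<in> W" "u' \<in> U"
  shows "e r \<phi> \<psi> (w, u) = e r \<phi> \<psi> (w', u') \<longleftrightarrow> u = u' \<and> cong_p 1 w w'"
proof -
  have "cong_p (r + 1) (nscale (p ^ r) w - F \<phi> \<psi> r u) (nscale (p ^ r) w' - F \<phi> \<psi> r u) \<longleftrightarrow>
    cong_p (r + 1) (nscale (p ^ r) w) (nscale (p ^ r) w')"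
    using cong_p_add[OF _ cong_p_refl[of _ "F \<phi> \<psi> r u"], of "r + 1" "nscale (p ^ r) w - F \<phi> \<psi> r u"]
      cong_p_diff[OF _ cong_p_refl[of _ "F \<phi> \<psi> r u"]] by fastforce
  also have "\<dots> \<longleftrightarrow> cong_p 1 w w'"
    using assms by (intro cong_p_nscale_iff) simp_all
  finally show ?thesis
    using assms by (auto simp: e_def q_eq_iff)
qed

lemma e_image_elementary_abelian:
  assumes r: "r \<ge> r0"
  shows "e r \<phi> \<psi> ` (W \<times> U) \<in> elementary_abelian_subgroups p (H r)"
proof -
  interpret H: group "H r"
    using group_H[OF r] .
  have "subgroup (e r \<phi> \<psi> ` (W \<times> U)) (H r)"
  proof (rule H.subgroupI)
    show "e r \<phi> \<psi> ` (W \<times> U) \<subseteq> carrier (H r)"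
      using e_carrier[OF r] by blast
    have "(0, \<one>\<^bsub>P\<^esub>) \<in> W \<times> U" by simp
    then show "e r \<phi> \<psi> ` (W \<times> U) \<noteq> {}" by blast
  next
    fix a assume "a \<in> e r \<phi> \<psi> ` (W \<times> U)"
    then obtain w u where a: "a = e r \<phi> \<psi> (w, u)" "w \<in> W" "u \<in> U" by blast
    have "e r \<phi> \<psi> (- w, inv\<^bsub>P\<^esub> u) \<otimes>\<^bsub>H r\<^esub> a = \<one>\<^bsub>H r\<^esub>"
      using a r by (simp add: e_mult e_one)
    then have "inv\<^bsub>H r\<^esub> a = e r \<phi> \<psi> (- w, inv\<^bsub>P\<^esub> u)"
      using a r by (intro H.inv_equality) (simp_all add: e_carrier)
    then show "inv\<^bsub>H r\<^esub> a \<in> e r \<phi> \<psi> ` (W \<times> U)"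
      using a by simp
  next
    fix a b assume "a \<in> e r \<phi> \<psi> ` (W \<times> U)" "b \<in> e r \<phi> \<psi> ` (W \<times> U)"
    then show "a \<otimes>\<^bsub>H r\<^esub> b \<in> e r \<phi> \<psi> ` (W \<times> U)"
      using r by (auto simp: e_mult)
  qed
  moreover have "a \<otimes>\<^bsub>H r\<^esub> b = b \<otimes>\<^bsub>H r\<^esub> a"
    if ab: "a \<in> e r \<phi> \<psi> ` (W \<times> U)" "b \<in> e r \<phi> \<psi> ` (W \<times> U)" for a b
    using ab r by (auto simp: e_mult add.commute good_comm)
  moreover have "a [^]\<^bsub>H r\<^esub> p = \<one>\<^bsub>H r\<^esub>" if a: "a \<in> e r \<phi> \<psi> ` (W \<times> U)" for a
  proof -
    obtain w u where a': "a = e r \<phi> \<psi> (w, u)" "w \<in> W" "u \<in> U"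
      using a by blast
    have "cong_p 1 (nscale p w) 0"
      using a' by (intro cong_pI[of _ _ _ w]) simp_all
    then have "e r \<phi> \<psi> (nscale p w, \<one>\<^bsub>P\<^esub>) = e r \<phi> \<psi> (0, \<one>\<^bsub>P\<^esub>)"
      using a' r by (subst e_eq_iff) simp_all
    then show ?thesis
      using a' r good_exp[OF a'(3)] by (simp add: e_pow e_one)
  qed
  ultimately show ?thesis
    unfolding elementary_abelian_subgroups_def by simp
qed

end

section \<open>Every elementary abelian subgroup comes from lattice data\<close>

lemma cong_p_witness:
  assumes "\<And>u v. u \<in> U \<Longrightarrow> v \<in> U \<Longrightarrow> cong_p n (f u v) (g u v)"
  obtains \<chi> where "\<And>u v. u \<in> U \<Longrightarrow> v \<in> U \<Longrightarrow> \<chi> u v \<in> A"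
    "\<And>u v. u \<in> U \<Longrightarrow> v \<in> U \<Longrightarrow> f u v = g u v + nscale (p ^ n) (\<chi> u v)"
proof -
  have "\<forall>u v. \<exists>c. u \<in> U \<longrightarrow> v \<in> U \<longrightarrow> c \<in> A \<and> f u v = g u v + nscale (p ^ n) c"
    using assms unfolding cong_p_def by blast
  then obtain \<chi> where "\<forall>u v. u \<in> U \<longrightarrow> v \<in> U \<longrightarrow> \<chi> u v \<in> A \<and> f u v = g u v + nscale (p ^ n) (\<chi> u v)"
    by metis
  then show thesis
    by (intro that[of \<chi>]) simp_all
qed

text \<open>The comparison of \<open>\<chi>\<close> with \<open>\<sigma>\<close> works because \<open>\<eta> + \<Delta>\<chi> = 0\<close>, so that \<open>\<sigma> + p\<^sup>m\<chi>\<close> is a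
  cocycle and \<open>p\<^sup>m\<close> times it is a coboundary.\<close>

lemma lift_to_sequence:
  assumes r: "r \<ge> r0" and U: "subgroup U P"
    and F: "\<And>u. u \<in> U \<Longrightarrow> G u \<in> A" and F1: "G \<one>\<^bsub>P\<^esub> = 0"
    and cong: "\<And>u v. u \<in> U \<Longrightarrow> v \<in> U \<Longrightarrow> cong_p (r + 1) (act u (G v) + G u) (G (u \<otimes>\<^bsub>P\<^esub> v) + \<tau> r u v)"
  shows "\<exists>\<phi> \<psi>. (\<forall>u\<in>U. \<phi> u \<in> A) \<and> (\<forall>u\<in>U. \<psi> u \<in> A) \<and> \<phi> \<one>\<^bsub>P\<^esub> = 0 \<and> \<psi> \<one>\<^bsub>P\<^esub> = 0 \<and>
    (\<forall>u\<in>U. F \<phi> \<psi> r u = G u) \<and>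
    (\<forall>k\<ge>r0. \<forall>u\<in>U. \<forall>v\<in>U.
       cong_p (k + 1) (F \<phi> \<psi> k (u \<otimes>\<^bsub>P\<^esub> v) + \<tau> k u v) (act u (F \<phi> \<psi> k v) + F \<phi> \<psi> k u))"
proof -
  have Uc [simp]: "u \<in> carrier P" if "u \<in> U" for u
    using subgroup.mem_carrier[OF U that] .
  have Um [simp]: "u \<otimes>\<^bsub>P\<^esub> v \<in> U" if "u \<in> U" "v \<in> U" for u v
    using subgroup.m_closed[OF U that] .
  have U1 [simp]: "\<one>\<^bsub>P\<^esub> \<in> U"
    using subgroup.one_closed[OF U] .
  note F [simp] and F1 [simp]
  obtain \<chi> where \<chi>A [simp]: "\<And>u v. u \<in> U \<Longrightarrow> v \<in> U \<Longrightarrow> \<chi> u v \<in> A"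
    and \<chi>: "\<And>u v. u \<in> U \<Longrightarrow> v \<in> U \<Longrightarrow>
      act u (G v) + G u = G (u \<otimes>\<^bsub>P\<^esub> v) + \<tau> r u v + nscale (p ^ (r + 1)) (\<chi> u v)"
    using cong_p_witness[of U "r + 1" "\<lambda>u v. act u (G v) + G u"
      "\<lambda>u v. G (u \<otimes>\<^bsub>P\<^esub> v) + \<tau> r u v"] cong by blast
  \<comment> \<open>The normalization of \<chi>, found by dividing by p^(r+1), makes
    \<open>z\<close> vanish at 1 and so leads to a normalized \<psi>.\<close>
  have \<chi>1: "\<chi> \<one>\<^bsub>P\<^esub> v = 0" if v: "v \<in> U" for v
    by (rule nscale_p_power_cancel[of _ _ "r + 1"]) (use \<chi>[OF U1 v] v in simp_all)
  \<comment> \<open>The identity \<eta> + \<Delta>\<chi> = 0 comes from \<Delta>\<Delta>G = 0 and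
    \<open>\<tau>_coboundary\<close> after division by p^(r+1). The numbered equations solve for the
    iterated actions, so that substitution leaves no action on \<open>G\<close> or \<tau>.\<close>
  have \<chi>\<eta>: "\<eta> u v w + act u (\<chi> v w) + \<chi> u (v \<otimes>\<^bsub>P\<^esub> w) = \<chi> (u \<otimes>\<^bsub>P\<^esub> v) w + \<chi> u v"
    if u: "u \<in> U" and v: "v \<in> U" and w: "w \<in> U" for u v w
  proof (rule nscale_p_power_cancel)
    have 1: "act u (act v (G w)) + act u (G v) =
      act u (G (v \<otimes>\<^bsub>P\<^esub> w)) + act u (\<tau> r v w) + nscale (p ^ (r + 1)) (act u (\<chi> v w))"
      using arg_cong[OF \<chi>[OF v w], of "act u"] u v w
      by (simp add: act_add act_nscale del: power_Suc power_add)
    have 2: "act u (G (v \<otimes>\<^bsub>P\<^esub> w)) = G (u \<otimes>\<^bsub>P\<^esub> v \<otimes>\<^bsub>P\<^esub> w) + \<tau> r u (v \<otimes>\<^bsub>P\<^esub> w)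
        + nscale (p ^ (r + 1)) (\<chi> u (v \<otimes>\<^bsub>P\<^esub> w)) - G u"
      using \<chi>[OF u Um[OF v w]] u v w by (simp add: P.m_assoc eq_diff_eq)
    have 3: "act u (act v (G w)) = G (u \<otimes>\<^bsub>P\<^esub> v \<otimes>\<^bsub>P\<^esub> w) + \<tau> r (u \<otimes>\<^bsub>P\<^esub> v) w
        + nscale (p ^ (r + 1)) (\<chi> (u \<otimes>\<^bsub>P\<^esub> v) w) - G (u \<otimes>\<^bsub>P\<^esub> v)"
      using \<chi>[OF Um[OF u v] w] u v w by (simp add: act_act eq_diff_eq)
    have 4: "act u (G v) = G (u \<otimes>\<^bsub>P\<^esub> v) + \<tau> r u v + nscale (p ^ (r + 1)) (\<chi> u v) - G u"
      using \<chi>[OF u v] by (simp add: eq_diff_eq)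
    have 5: "act u (\<tau> r v w) + \<tau> r u (v \<otimes>\<^bsub>P\<^esub> w) =
      \<tau> r (u \<otimes>\<^bsub>P\<^esub> v) w + \<tau> r u v + nscale (p ^ (r + 1)) (\<eta> u v w)"
      using u v w by (intro \<tau>_coboundary r) simp_all
    have 6: "act u (\<tau> r v w) =
      \<tau> r (u \<otimes>\<^bsub>P\<^esub> v) w + \<tau> r u v + nscale (p ^ (r + 1)) (\<eta> u v w) - \<tau> r u (v \<otimes>\<^bsub>P\<^esub> w)"
      using 5 by (simp add: eq_diff_eq)
    from 1 show "nscale (p ^ (r + 1)) (\<eta> u v w + act u (\<chi> v w) + \<chi> u (v \<otimes>\<^bsub>P\<^esub> w)) =
      nscale (p ^ (r + 1)) (\<chi> (u \<otimes>\<^bsub>P\<^esub> v) w + \<chi> u v)"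
      unfolding 2 3 4 6 nscale_add_right by (simp add: algebra_simps)
  qed (use u v w in simp_all)
  define z where "z u v = \<sigma> u v + nscale (p ^ m) (\<chi> u v)" for u v
  have "\<exists>\<psi>. (\<forall>u\<in>U. \<psi> u \<in> A) \<and> \<psi> \<one>\<^bsub>P\<^esub> = 0 \<and>
    (\<forall>u\<in>U. \<forall>v\<in>U. nscale (p ^ m) (z u v) = act u (\<psi> v) - \<psi> (u \<otimes>\<^bsub>P\<^esub> v) + \<psi> u)"
  proof (rule two_cocycle_order[OF U])
    fix u v w assume u: "u \<in> U" "v \<in> U" "w \<in> U"
    have \<eta>_eq: "\<eta> u v w = \<chi> (u \<otimes>\<^bsub>P\<^esub> v) w + \<chi> u v - act u (\<chi> v w) - \<chi> u (v \<otimes>\<^bsub>P\<^esub> w)"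
      using \<chi>\<eta>[OF u] by (simp add: eq_diff_eq add_ac)
    have "act u (\<sigma> v w) = \<sigma> (u \<otimes>\<^bsub>P\<^esub> v) w + \<sigma> u v + nscale (p ^ m) (\<chi> (u \<otimes>\<^bsub>P\<^esub> v) w + \<chi> u v
        - act u (\<chi> v w) - \<chi> u (v \<otimes>\<^bsub>P\<^esub> w)) - \<sigma> u (v \<otimes>\<^bsub>P\<^esub> w)"
      using \<sigma>_coboundary[of u v w] u unfolding \<eta>_eq by (simp add: eq_diff_eq)
    then show "act u (z v w) + z u (v \<otimes>\<^bsub>P\<^esub> w) = z (u \<otimes>\<^bsub>P\<^esub> v) w + z u v"
      using u unfolding z_def
      by (simp add: act_add act_nscale nscale_simps algebra_simps)
  qed (simp_all add: z_def \<chi>1)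
  then obtain \<psi> where \<psi>A [simp]: "\<And>u. u \<in> U \<Longrightarrow> \<psi> u \<in> A" and \<psi>1: "\<psi> \<one>\<^bsub>P\<^esub> = 0"
    and \<psi>: "\<And>u v. u \<in> U \<Longrightarrow> v \<in> U \<Longrightarrow>
      nscale (p ^ m) (z u v) = act u (\<psi> v) - \<psi> (u \<otimes>\<^bsub>P\<^esub> v) + \<psi> u"
    by blast
  define \<phi> where "\<phi> u = G u - nscale (p ^ (r + 1 - 2 * m)) (\<psi> u)" for u
  \<comment> \<open>At every level k, not just at r, the coboundary of p^(k+1-2m) \<psi> is
    p^(k+1-m) \<sigma> up to p^(k+1) \<chi>. Exchanging the correction at r for the one at k
    therefore exchanges \<tau> at r for \<tau> at k.\<close>
  have scale: "nscale (p ^ (k + 1 - 2 * m)) (act u (\<psi> v)) - nscale (p ^ (k + 1 - 2 * m)) (\<psi> (u \<otimes>\<^bsub>P\<^esub> v))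
      + nscale (p ^ (k + 1 - 2 * m)) (\<psi> u) =
      nscale (p ^ (k + 1 - m)) (\<sigma> u v) + nscale (p ^ (k + 1)) (\<chi> u v)"
    if "k \<ge> r0" "u \<in> U" "v \<in> U" for k u v
  proof -
    have k: "k + 1 - m = (k + 1 - 2 * m) + m" "k + 1 = (k + 1 - 2 * m) + m + m"
      using that r0 by simp_all
    have "nscale (p ^ (k + 1 - 2 * m)) (nscale (p ^ m) (z u v)) =
      nscale (p ^ (k + 1 - m)) (\<sigma> u v) + nscale (p ^ (k + 1)) (\<chi> u v)"
    proof -
      define n where "n = k + 1 - 2 * m"
      have "nscale (p ^ n) (nscale (p ^ m) (z u v)) = nscale (p ^ (n + m)) (\<sigma> u v) + nscale (p ^ (n + m + m)) (\<chi> u v)"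
        unfolding z_def by (simp add: nscale_add_right nscale_pow add.assoc)
      then show ?thesis
        using k by (simp only: n_def)
    qed
    then show ?thesis
      unfolding \<psi>[OF that(2,3)] by (simp add: nscale_simps)
  qed
  show ?thesis
  proof (rule exI[of _ \<phi>], rule exI[of _ \<psi>], intro conjI ballI allI impI)
    show "\<phi> u \<in> A" "\<psi> u \<in> A" "F \<phi> \<psi> r u = G u" if "u \<in> U" for u
      using that by (simp_all add: \<phi>_def F_def)
    show "\<phi> \<one>\<^bsub>P\<^esub> = 0" "\<psi> \<one>\<^bsub>P\<^esub> = 0"
      by (simp_all add: \<phi>_def \<psi>1)
    fix k u v assume k: "k \<ge> r0" and u: "u \<in> U" and v: "v \<in> U"
    have "act u (F \<phi> \<psi> k v) + F \<phi> \<psi> k u = F \<phi> \<psi> k (u \<otimes>\<^bsub>P\<^esub> v) + \<tau> k u v + nscale (p ^ (k + 1)) (\<chi> u v)"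
    proof -
      have 1: "act u (G v) =
          G (u \<otimes>\<^bsub>P\<^esub> v) + \<rho> u v + nscale (p ^ (r + 1 - 2 * m)) (act u (\<psi> v))
          - nscale (p ^ (r + 1 - 2 * m)) (\<psi> (u \<otimes>\<^bsub>P\<^esub> v)) + nscale (p ^ (r + 1 - 2 * m)) (\<psi> u) - G u"
        using \<chi>[OF u v] scale[OF r u v] unfolding \<tau>_def by (simp add: eq_diff_eq add.assoc)
      have 2: "nscale (p ^ (k + 1 - 2 * m)) (act u (\<psi> v)) =
          nscale (p ^ (k + 1 - m)) (\<sigma> u v) + nscale (p ^ (k + 1)) (\<chi> u v)
          + nscale (p ^ (k + 1 - 2 * m)) (\<psi> (u \<otimes>\<^bsub>P\<^esub> v)) - nscale (p ^ (k + 1 - 2 * m)) (\<psi> u)"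
        using scale[OF k u v] by (simp add: eq_diff_eq diff_add_eq diff_eq_eq)
      show ?thesis
        using 2 u v unfolding F_def \<phi>_def \<tau>_def
        by (simp add: act_add act_diff act_nscale 1 algebra_simps del: power_Suc)
    qed
    then show "cong_p (k + 1) (F \<phi> \<psi> k (u \<otimes>\<^bsub>P\<^esub> v) + \<tau> k u v) (act u (F \<phi> \<psi> k v) + F \<phi> \<psi> k u)"
      using u v by (intro cong_p_sym[OF cong_pI[of _ _ _ "\<chi> u v"]]) simp_all
  qed
qed

text \<open>E consists of the products of its elements over 1 with a section over its image U in P.
  An element over 1 has order dividing p, so torsion-freeness puts it into p^r A modulo p^(r+1);
  this produces W. The section produces \<phi> and \<psi> through
  \<open>lift_to_sequence\<close>.\<close>

lemma elementary_abelian_eq_e_image: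
  assumes r: "r \<ge> r0" and E: "E \<in> elementary_abelian_subgroups p (H r)"
  shows "\<exists>U \<phi> \<psi> W. good U \<phi> \<psi> W \<and> E = e r \<phi> \<psi> ` (W \<times> U)"
proof -
  interpret H: group "H r"
    using group_H[OF r] .
  have sE: "subgroup E (H r)" and commE: "\<And>x y. x \<in> E \<Longrightarrow> y \<in> E \<Longrightarrow> x \<otimes>\<^bsub>H r\<^esub> y = y \<otimes>\<^bsub>H r\<^esub> x"
    and expE: "\<And>x. x \<in> E \<Longrightarrow> x [^]\<^bsub>H r\<^esub> p = \<one>\<^bsub>H r\<^esub>"
    using E by (auto simp: elementary_abelian_subgroups_def)
  note Ec = subgroup.mem_carrier[OF sE] and Em = subgroup.m_closed[OF sE]
    and Ei = subgroup.m_inv_closed[OF sE] and E1 = subgroup.one_closed[OF sE]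
  have snd_hom: "snd \<in> hom (H r) P"
    using r by (auto simp: hom_def carrier_H mult_H')
  interpret snd: group_hom "H r" P snd
    using snd_hom by unfold_locales
  define U where "U = snd ` E"
  have U: "subgroup U P"
    unfolding U_def by (rule snd.subgroup_img_is_subgroup[OF sE])
  have Uea: "U \<in> elementary_abelian_subgroups p P"
    unfolding elementary_abelian_subgroups_def mem_Collect_eq
  proof (intro conjI ballI U)
    show "u \<otimes>\<^bsub>P\<^esub> v = v \<otimes>\<^bsub>P\<^esub> u" if "u \<in> U" "v \<in> U" for u v
      using that commE Ec unfolding U_def by (metis (no_types, lifting) imageE snd.hom_mult)
    show "u [^]\<^bsub>P\<^esub> p = \<one>\<^bsub>P\<^esub>" if "u \<in> U" for u
      using that expE Ec unfolding U_def by (metis (no_types, lifting) imageE snd.hom_nat_pow snd.hom_one)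
  qed
  have Uc [simp]: "u \<in> carrier P" if "u \<in> U" for u
    using subgroup.mem_carrier[OF U that] .
  have Um [simp]: "u \<otimes>\<^bsub>P\<^esub> v \<in> U" if "u \<in> U" "v \<in> U" for u v
    using subgroup.m_closed[OF U that] .
  have U1 [simp]: "\<one>\<^bsub>P\<^esub> \<in> U"
    using subgroup.one_closed[OF U] .
  obtain s where sE: "\<And>u. u \<in> U \<Longrightarrow> s u \<in> E" and s_snd: "\<And>u. u \<in> U \<Longrightarrow> snd (s u) = u"
    and s_mult: "\<And>u v. u \<in> U \<Longrightarrow> v \<in> U \<Longrightarrow> s (u \<otimes>\<^bsub>P\<^esub> v) = s u \<otimes>\<^bsub>H r\<^esub> s v"
    using ex_section_elementary_abelian[OF p H.is_group P.is_group finite_P E snd_hom]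
    unfolding U_def[symmetric] by blast
  have s1: "s \<one>\<^bsub>P\<^esub> = \<one>\<^bsub>H r\<^esub>"
    using s_mult[OF U1 U1] Ec[OF sE[OF U1]] by simp
  have "\<exists>a. a \<in> A \<and> s u = (q r (- a), u)" if u: "u \<in> U" for u
  proof -
    obtain a g where "a \<in> A" "s u = (q r a, g)"
      using carrier_HE[OF r Ec[OF sE[OF u]]] .
    then show ?thesis
      using s_snd[OF u] by (intro exI[of _ "- a"]) simp
  qed
  then obtain G' where G': "\<And>u. u \<in> U \<Longrightarrow> G' u \<in> A \<and> s u = (q r (- G' u), u)"
    by metis
  \<comment> \<open>A representative of the class \<open>q r 0\<close> need not be 0; setting the
    value at 1 to 0 makes the lift normalized.\<close>
  define G where "G u = (if u = \<one>\<^bsub>P\<^esub> then 0 else G' u)" for u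
  have GA [simp]: "G u \<in> A" and sG: "s u = (q r (- G u), u)" if "u \<in> U" for u
    using G'[OF that] s1 one_H[OF r] by (auto simp: G_def)
  have G1 [simp]: "G \<one>\<^bsub>P\<^esub> = 0"
    by (simp add: G_def)
  have congG: "cong_p (r + 1) (act u (G v) + G u) (G (u \<otimes>\<^bsub>P\<^esub> v) + \<tau> r u v)"
    if uv: "u \<in> U" "v \<in> U" for u v
  proof -
    have "q r (- G (u \<otimes>\<^bsub>P\<^esub> v)) = q r (- G u + act u (- G v) + \<tau> r u v)"
      using s_mult[OF uv] r uv by (simp add: sG mult_H')
    then have "cong_p (r + 1) (- G (u \<otimes>\<^bsub>P\<^esub> v)) (- G u + act u (- G v) + \<tau> r u v)"
      using uv by (subst (asm) q_eq_iff) simp_all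
    then have "cong_p (r + 1) (- G (u \<otimes>\<^bsub>P\<^esub> v) + (G u + act u (G v) + G (u \<otimes>\<^bsub>P\<^esub> v)))
      (- G u + act u (- G v) + \<tau> r u v + (G u + act u (G v) + G (u \<otimes>\<^bsub>P\<^esub> v)))"
      by (intro cong_p_add cong_p_refl)
    then show ?thesis
      using uv by (simp add: act_minus algebra_simps)
  qed
  obtain \<phi> \<psi> where \<phi>\<psi>: "\<forall>u\<in>U. \<phi> u \<in> A" "\<forall>u\<in>U. \<psi> u \<in> A" "\<phi> \<one>\<^bsub>P\<^esub> = 0" "\<psi> \<one>\<^bsub>P\<^esub> = 0"
    "\<forall>u\<in>U. F \<phi> \<psi> r u = G u"
    "\<forall>k\<ge>r0. \<forall>u\<in>U. \<forall>v\<in>U.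
       cong_p (k + 1) (F \<phi> \<psi> k (u \<otimes>\<^bsub>P\<^esub> v) + \<tau> k u v) (act u (F \<phi> \<psi> k v) + F \<phi> \<psi> k u)"
    using lift_to_sequence[OF r U GA G1 congG] by blast
  \<comment> \<open>W is the full preimage in \<open>A\<close>, hence contains pA.\<close>
  define W where "W = {w \<in> A. (q r (nscale (p ^ r) w), \<one>\<^bsub>P\<^esub>) \<in> E}"
  have WA: "w \<in> A" if "w \<in> W" for w
    using that by (simp add: W_def)
  have WE: "(q r (nscale (p ^ r) w), \<one>\<^bsub>P\<^esub>) \<in> E" if "w \<in> W" for w
    using that by (simp add: W_def)
  have W_add: "w + w' \<in> W" if "w \<in> W" "w' \<in> W" for w w'
    using Em[OF WE[OF that(1)] WE[OF that(2)]] WA[OF that(1)] WA[OF that(2)] r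
    by (simp add: W_def mult_H' nscale_add_right)
  have W_zero: "0 \<in> W"
    using E1 r by (simp add: W_def one_H)
  have W_minus: "- w \<in> W" if w: "w \<in> W" for w
  proof -
    have "(q r (nscale (p ^ r) (- w)), \<one>\<^bsub>P\<^esub>) \<otimes>\<^bsub>H r\<^esub> (q r (nscale (p ^ r) w), \<one>\<^bsub>P\<^esub>) = \<one>\<^bsub>H r\<^esub>"
      using WA[OF w] r by (simp add: mult_H' one_H nscale_minus)
    then have "inv\<^bsub>H r\<^esub> (q r (nscale (p ^ r) w), \<one>\<^bsub>P\<^esub>) = (q r (nscale (p ^ r) (- w)), \<one>\<^bsub>P\<^esub>)"
      using WA[OF w] r by (intro H.inv_equality) (simp_all add: H_memI)
    then show ?thesis
      using Ei[OF WE[OF w]] WA[OF w] by (simp add: W_def)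
  qed
  have W_pA: "nscale p a \<in> W" if a: "a \<in> A" for a
  proof -
    have "cong_p (r + 1) (nscale (p ^ r) (nscale p a)) 0"
      using a by (intro cong_pI[of _ _ _ a]) (simp_all add: nscale_nscale mult.commute)
    then have "q r (nscale (p ^ r) (nscale p a)) = q r 0"
      using a by (simp add: q_eq_iff)
    then show ?thesis
      using a E1 r by (simp add: W_def one_H)
  qed
  \<comment> \<open>The elements of E over 1 commute with the section, as E is abelian; divided by
    p^r, this says that U fixes W modulo p.\<close>
  have W_fixed: "cong_p 1 (act u w) w" if u: "u \<in> U" and w: "w \<in> W" for u w
  proof -
    have "(q r (nscale (p ^ r) w), \<one>\<^bsub>P\<^esub>) \<otimes>\<^bsub>H r\<^esub> s u = s u \<otimes>\<^bsub>H r\<^esub> (q r (nscale (p ^ r) w), \<one>\<^bsub>P\<^esub>)"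
      using commE[OF WE[OF w] sE[OF u]] .
    then have "q r (nscale (p ^ r) w - G u) = q r (- G u + nscale (p ^ r) (act u w))"
      using u WA[OF w] r by (simp add: sG mult_H' act_nscale)
    then have "cong_p (r + 1) (nscale (p ^ r) w - G u) (- G u + nscale (p ^ r) (act u w))"
      using u WA[OF w] by (simp add: q_eq_iff)
    then have "cong_p (r + 1) (nscale (p ^ r) w - G u + G u) (- G u + nscale (p ^ r) (act u w) + G u)"
      by (intro cong_p_add cong_p_refl)
    then have "cong_p (r + 1) (nscale (p ^ r) w) (nscale (p ^ r) (act u w))"
      by simp
    then show ?thesis
      using u WA[OF w] by (subst (asm) cong_p_nscale_iff) (simp_all add: cong_p_sym)
  qed
  have "good U \<phi> \<psi> W"
    unfolding good_def using Uea \<phi>\<psi> W_add W_zero W_minus W_pA W_fixed WA by blast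
  moreover have "E = e r \<phi> \<psi> ` (W \<times> U)"
  proof (intro equalityI subsetI)
    fix x assume "x \<in> e r \<phi> \<psi> ` (W \<times> U)"
    then obtain w u where x: "x = e r \<phi> \<psi> (w, u)" "w \<in> W" "u \<in> U" by blast
    have "(q r (nscale (p ^ r) w), \<one>\<^bsub>P\<^esub>) \<otimes>\<^bsub>H r\<^esub> s u = x"
      using x(1,3) WA[OF x(2)] r \<phi>\<psi>(5) by (simp add: sG mult_H' e_def)
    then show "x \<in> E"
      using Em[OF WE[OF x(2)] sE[OF x(3)]] by simp
  next
    fix x assume x: "x \<in> E"
    define u where "u = snd x"
    have u: "u \<in> U"
      using x by (simp add: u_def U_def)
    \<comment> \<open>Dividing x by the section over its image leaves an element over 1, which has
      the form p^r c because y^p = 1.\<close>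
    define y where "y = x \<otimes>\<^bsub>H r\<^esub> inv\<^bsub>H r\<^esub> (s u)"
    have yE: "y \<in> E"
      unfolding y_def using Em[OF x Ei[OF sE[OF u]]] .
    have "snd y = \<one>\<^bsub>P\<^esub>"
      unfolding y_def using Ec[OF x] Ec[OF sE[OF u]] u by (simp add: s_snd flip: u_def)
    then obtain b where b: "b \<in> A" "y = (q r b, \<one>\<^bsub>P\<^esub>)"
      using carrier_HE[OF r Ec[OF yE]] by (metis snd_conv)
    have "(q r b, \<one>\<^bsub>P\<^esub>) [^]\<^bsub>H r\<^esub> n = (q r (nscale n b), \<one>\<^bsub>P\<^esub>)" for n :: nat
      by (induction n) (use b r in \<open>simp_all add: one_H mult_H' add.commute\<close>)
    then have "q r (nscale p b) = q r 0"
      using expE[OF yE] r b by (simp add: one_H)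
    then obtain c where c: "c \<in> A" "nscale p b = 0 + nscale (p ^ (r + 1)) c"
      using b by (subst (asm) q_eq_iff) (auto simp: cong_p_def)
    have "b = nscale (p ^ r) c"
      by (rule nscale_p_power_cancel[of _ _ 1]) (use b c in \<open>simp_all add: nscale_nscale\<close>)
    then have cW: "c \<in> W" and y: "y = (q r (nscale (p ^ r) c), \<one>\<^bsub>P\<^esub>)"
      using b c yE by (simp_all add: W_def)
    have "x = y \<otimes>\<^bsub>H r\<^esub> s u"
      unfolding y_def using Ec[OF x] Ec[OF sE[OF u]] by (simp add: H.m_assoc)
    also have "\<dots> = e r \<phi> \<psi> (c, u)"
      using y r u c(1) \<phi>\<psi>(5) by (simp add: sG mult_H' e_def)
    finally show "x \<in> e r \<phi> \<psi> ` (W \<times> U)"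
      using cW u by blast
  qed
  ultimately show ?thesis by blast
qed

text \<open>Modulo p^(r+1-2m) the terms with \<psi> and \<sigma> disappear, and r may be arbitrarily
  large, so \<Delta>\<phi> = \<rho> holds exactly. A single level would give it merely as a
  congruence.\<close>

lemma good_exact:
  assumes good: "good U \<phi> \<psi> W" and u: "u \<in> U" and v: "v \<in> U"
  shows "\<phi> (u \<otimes>\<^bsub>P\<^esub> v) + \<rho> u v = act u (\<phi> v) + \<phi> u"
proof (rule cong_p_eqI)
  note [simp] = good_closed[OF good] good_Uc[OF good] good_U_closed[OF good]
  show "\<phi> (u \<otimes>\<^bsub>P\<^esub> v) + \<rho> u v \<in> A" "act u (\<phi> v) + \<phi> u \<in> A"
    using u v by simp_all
  fix n
  \<comment> \<open>Chosen so that r+1-2m is at least n.\<close>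
  define r where "r = r0 + n + 2 * m"
  have "r \<ge> r0"
    by (simp add: r_def)
  then have "cong_p (r + 1) (F \<phi> \<psi> r (u \<otimes>\<^bsub>P\<^esub> v) + \<tau> r u v) (act u (F \<phi> \<psi> r v) + F \<phi> \<psi> r u)"
    using good_F[OF good _ u v] by simp
  then have 1: "cong_p (r + 1 - 2 * m) (F \<phi> \<psi> r (u \<otimes>\<^bsub>P\<^esub> v) + \<tau> r u v) (act u (F \<phi> \<psi> r v) + F \<phi> \<psi> r u)"
    by (rule cong_p_mono) simp
  have F: "cong_p (r + 1 - 2 * m) (F \<phi> \<psi> r w) (\<phi> w)" if "w \<in> U" for w
    using that by (intro cong_pI[of _ _ _ "\<psi> w"]) (simp_all add: F_def)
  have *: "(r + 1 - 2 * m) + m = r + 1 - m"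
    by (simp add: r_def)
  have \<tau>: "cong_p (r + 1 - 2 * m) (\<tau> r u v) (\<rho> u v)"
    using u v by (intro cong_pI[of _ _ _ "nscale (p ^ m) (\<sigma> u v)"]) (simp_all only: \<tau>_def nscale_pow *, simp_all)
  have "cong_p (r + 1 - 2 * m) (F \<phi> \<psi> r (u \<otimes>\<^bsub>P\<^esub> v) + \<tau> r u v) (\<phi> (u \<otimes>\<^bsub>P\<^esub> v) + \<rho> u v)"
    using u v by (intro cong_p_add F \<tau>) simp
  moreover have "cong_p (r + 1 - 2 * m) (act u (F \<phi> \<psi> r v) + F \<phi> \<psi> r u) (act u (\<phi> v) + \<phi> u)"
    using u v by (intro cong_p_add cong_p_act F) simp_all
  ultimately have "cong_p (r + 1 - 2 * m) (\<phi> (u \<otimes>\<^bsub>P\<^esub> v) + \<rho> u v) (act u (\<phi> v) + \<phi> u)"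
    using 1 cong_p_sym cong_p_trans by blast
  moreover have "n \<le> r + 1 - 2 * m"
    by (simp add: r_def)
  ultimately show "\<exists>k\<ge>n. cong_p k (\<phi> (u \<otimes>\<^bsub>P\<^esub> v) + \<rho> u v) (act u (\<phi> v) + \<phi> u)"
    by blast
qed


section \<open>Conjugations compared at different levels\<close>

lemma cong_p_iff_of_diff_eq: "a - b = c - d \<Longrightarrow> cong_p n a b \<longleftrightarrow> cong_p n c d"
  unfolding cong_p_def by (metis add_diff_cancel_left' diff_add_cancel add.commute)

text \<open>For g u = v g, the lattice components of (t, g)(-f(u), u) and (-f'(v), v)(t, g) are
  compared. Apart from t - v t, the difference has a part independent of the level, namely
  \<open>defect\<close>, and a part p^(k+1-2m) times \<open>defect'\<close>. In the latter \<sigma>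
  keeps a factor p^m because \<tau> contains p^(k+1-m) \<sigma>.\<close>

definition defect where "defect g \<phi> \<phi>' u v = \<phi>' v - act g (\<phi> u) + \<rho> g u - \<rho> v g"

definition defect' where
  "defect' g \<psi> \<psi>' u v = \<psi>' v - act g (\<psi> u) + nscale (p ^ m) (\<sigma> g u) - nscale (p ^ m) (\<sigma> v g)"

context
  fixes U \<phi> \<psi> W U' \<phi>' \<psi>' W'
  assumes good: "good U \<phi> \<psi> W" and good': "good U' \<phi>' \<psi>' W'"
begin

lemmas [simp] = good_closed[OF good] good_closed[OF good'] good_Uc[OF good] good_Uc[OF good']
  good_W(1)[OF good] good_W(1)[OF good'] F_closed[OF good] F_closed[OF good']

text \<open>Conjugacy is written as an equation of products, so that no inverse in
  \<open>H k\<close> has to be computed. The second components give g u = v g, the first ones the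
  congruence.\<close>

lemma conj_e_iff:
  assumes k: "k \<ge> r0" and t: "t \<in> A" and g: "g \<in> carrier P"
    and w: "w \<in> W" "w' \<in> W'" and u: "u \<in> U" "v \<in> U'"
  shows "(q k t, g) \<otimes>\<^bsub>H k\<^esub> e k \<phi> \<psi> (w, u) = e k \<phi>' \<psi>' (w', v) \<otimes>\<^bsub>H k\<^esub> (q k t, g) \<longleftrightarrow>
    g \<otimes>\<^bsub>P\<^esub> u = v \<otimes>\<^bsub>P\<^esub> g \<and>
    cong_p (k + 1) (t - act v t + defect g \<phi> \<phi>' u v + nscale (p ^ (k + 1 - 2 * m)) (defect' g \<psi> \<psi>' u v))
      (nscale (p ^ k) (w' - act g w))"
proof -
  have *: "(k + 1 - 2 * m) + m = k + 1 - m"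
    using k r0 by simp
  have \<tau>_eq: "\<tau> k a b = \<rho> a b + nscale (p ^ (k + 1 - 2 * m)) (nscale (p ^ m) (\<sigma> a b))" for a b
    unfolding \<tau>_def nscale_pow * ..
  have "cong_p (k + 1) (t + act g (nscale (p ^ k) w - F \<phi> \<psi> k u) + \<tau> k g u)
      (nscale (p ^ k) w' - F \<phi>' \<psi>' k v + act v t + \<tau> k v g) \<longleftrightarrow>
    cong_p (k + 1) (t - act v t + defect g \<phi> \<phi>' u v + nscale (p ^ (k + 1 - 2 * m)) (defect' g \<psi> \<psi>' u v))
      (nscale (p ^ k) (w' - act g w))"
    by (rule cong_p_iff_of_diff_eq)
      (use g t u w in \<open>simp add: \<tau>_eq F_def defect_def defect'_def act_add act_diff act_nscale
        nscale_add_right nscale_diff_right algebra_simps\<close>)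
  then show ?thesis
    using assms by (auto simp: e_def mult_H' q_eq_iff)
qed

text \<open>As v is the conjugate of u by g, this is a 1-cocycle identity in v. It is exact because
  \<Delta>\<phi> = \<rho> is exact on both sides; the \<rho>-terms then cancel by three instances of
  the cocycle identity.\<close>

lemma defect_cocycle:
  assumes g: "g \<in> carrier P" and u: "u \<in> U" "u' \<in> U" and v: "v \<in> U'" "v' \<in> U'"
    and gu: "g \<otimes>\<^bsub>P\<^esub> u = v \<otimes>\<^bsub>P\<^esub> g" "g \<otimes>\<^bsub>P\<^esub> u' = v' \<otimes>\<^bsub>P\<^esub> g"
  shows "defect g \<phi> \<phi>' (u \<otimes>\<^bsub>P\<^esub> u') (v \<otimes>\<^bsub>P\<^esub> v') =
    act v (defect g \<phi> \<phi>' u' v') + defect g \<phi> \<phi>' u v"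
proof -
  have c: "u \<in> carrier P" "u' \<in> carrier P" "v \<in> carrier P" "v' \<in> carrier P"
    using u v by simp_all
  have 1: "\<phi>' (v \<otimes>\<^bsub>P\<^esub> v') = act v (\<phi>' v') + \<phi>' v - \<rho> v v'"
    using good_exact[OF good' v] by (simp add: eq_diff_eq)
  have 2: "\<phi> (u \<otimes>\<^bsub>P\<^esub> u') = act u (\<phi> u') + \<phi> u - \<rho> u u'"
    using good_exact[OF good u] by (simp add: eq_diff_eq)
  have 3: "act g (\<rho> u u') = \<rho> (v \<otimes>\<^bsub>P\<^esub> g) u' + \<rho> g u - \<rho> g (u \<otimes>\<^bsub>P\<^esub> u')"
    using \<rho>_cocycle[OF g c(1,2)] gu(1) by (simp add: eq_diff_eq)
  have 4: "act v (\<rho> v' g) = \<rho> (v \<otimes>\<^bsub>P\<^esub> v') g + \<rho> v v' - \<rho> v (v' \<otimes>\<^bsub>P\<^esub> g)"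
    using \<rho>_cocycle[OF c(3,4) g] by (simp add: eq_diff_eq)
  have 5: "act v (\<rho> g u') = \<rho> (v \<otimes>\<^bsub>P\<^esub> g) u' + \<rho> v g - \<rho> v (v' \<otimes>\<^bsub>P\<^esub> g)"
    using \<rho>_cocycle[OF c(3) g c(2)] gu(2) by (simp add: eq_diff_eq)
  show ?thesis
    unfolding defect_def 1 2 using g u v
    by (simp add: act_add act_diff act_act 3 4 5 gu algebra_simps)
qed

lemma conj_subgroup:
  assumes g: "g \<in> carrier P"
  shows "subgroup ((\<lambda>u. g \<otimes>\<^bsub>P\<^esub> u \<otimes>\<^bsub>P\<^esub> inv\<^bsub>P\<^esub> g) ` U) P"
proof (rule P.subgroupI)
  note U = good_U(2)[OF good]
  show "(\<lambda>u. g \<otimes>\<^bsub>P\<^esub> u \<otimes>\<^bsub>P\<^esub> inv\<^bsub>P\<^esub> g) ` U \<subseteq> carrier P"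
    using g by auto
  show "(\<lambda>u. g \<otimes>\<^bsub>P\<^esub> u \<otimes>\<^bsub>P\<^esub> inv\<^bsub>P\<^esub> g) ` U \<noteq> {}"
    using subgroup.one_closed[OF U] by blast
next
  note U = good_U(2)[OF good]
  fix a assume "a \<in> (\<lambda>u. g \<otimes>\<^bsub>P\<^esub> u \<otimes>\<^bsub>P\<^esub> inv\<^bsub>P\<^esub> g) ` U"
  then obtain u where u: "u \<in> U" "a = g \<otimes>\<^bsub>P\<^esub> u \<otimes>\<^bsub>P\<^esub> inv\<^bsub>P\<^esub> g" by blast
  then have "inv\<^bsub>P\<^esub> a = g \<otimes>\<^bsub>P\<^esub> inv\<^bsub>P\<^esub> u \<otimes>\<^bsub>P\<^esub> inv\<^bsub>P\<^esub> g"
    using g by (simp add: P.inv_mult_group P.m_assoc)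
  then show "inv\<^bsub>P\<^esub> a \<in> (\<lambda>u. g \<otimes>\<^bsub>P\<^esub> u \<otimes>\<^bsub>P\<^esub> inv\<^bsub>P\<^esub> g) ` U"
    using subgroup.m_inv_closed[OF U u(1)] by blast
next
  note U = good_U(2)[OF good]
  fix a b assume "a \<in> (\<lambda>u. g \<otimes>\<^bsub>P\<^esub> u \<otimes>\<^bsub>P\<^esub> inv\<^bsub>P\<^esub> g) ` U" "b \<in> (\<lambda>u. g \<otimes>\<^bsub>P\<^esub> u \<otimes>\<^bsub>P\<^esub> inv\<^bsub>P\<^esub> g) ` U"
  then obtain u v where u: "u \<in> U" "a = g \<otimes>\<^bsub>P\<^esub> u \<otimes>\<^bsub>P\<^esub> inv\<^bsub>P\<^esub> g"
    and v: "v \<in> U" "b = g \<otimes>\<^bsub>P\<^esub> v \<otimes>\<^bsub>P\<^esub> inv\<^bsub>P\<^esub> g" by blast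
  have "inv\<^bsub>P\<^esub> g \<otimes>\<^bsub>P\<^esub> (g \<otimes>\<^bsub>P\<^esub> z) = z" if "z \<in> carrier P" for z
    using g that by (simp flip: P.m_assoc)
  then have "a \<otimes>\<^bsub>P\<^esub> b = g \<otimes>\<^bsub>P\<^esub> (u \<otimes>\<^bsub>P\<^esub> v) \<otimes>\<^bsub>P\<^esub> inv\<^bsub>P\<^esub> g"
    using g u v by (simp add: P.m_assoc)
  then show "a \<otimes>\<^bsub>P\<^esub> b \<in> (\<lambda>u. g \<otimes>\<^bsub>P\<^esub> u \<otimes>\<^bsub>P\<^esub> inv\<^bsub>P\<^esub> g) ` U"
    using subgroup.m_closed[OF U u(1) v(1)] by blast
qed

text \<open>The defect is a coboundary \<open>v \<mapsto> v t\<^sub>0 - t\<^sub>0\<close>, because it is one modulo \<open>p\<^sup>r\<^sup>+\<^sup>1\<^sup>-\<^sup>2\<^sup>m\<close> and \<open>p\<^sup>m\<close>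
  annihilates \<open>H\<^sup>1\<close>. Conjugating at level \<open>k\<close> by \<open>t\<^sub>0 - p\<^sup>k\<^sup>+\<^sup>1\<^sup>-\<^sup>3\<^sup>ma\<close> then gives a condition modulo
  \<open>p\<^sup>3\<^sup>m\<close> that no longer involves \<open>k\<close>.\<close>

lemma conj_transfer:
  assumes r: "r \<ge> r0" and s: "s \<ge> r0" and h: "h \<in> carrier (H r)"
    and into: "\<And>a. a \<in> W \<times> U \<Longrightarrow> \<exists>b\<in>W' \<times> U'.
      h \<otimes>\<^bsub>H r\<^esub> e r \<phi> \<psi> a = e r \<phi>' \<psi>' b \<otimes>\<^bsub>H r\<^esub> h"
  shows "\<exists>h'\<in>carrier (H s). \<forall>a\<in>W \<times> U. \<forall>b\<in>W' \<times> U'.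
    h \<otimes>\<^bsub>H r\<^esub> e r \<phi> \<psi> a = e r \<phi>' \<psi>' b \<otimes>\<^bsub>H r\<^esub> h \<longleftrightarrow>
    h' \<otimes>\<^bsub>H s\<^esub> e s \<phi> \<psi> a = e s \<phi>' \<psi>' b \<otimes>\<^bsub>H s\<^esub> h'"
proof -
  obtain t g where t: "t \<in> A" and g: "g \<in> carrier P" and h_eq: "h = (q r t, g)"
    using carrier_HE[OF r h] .
  \<comment> \<open>On the conjugate of U by g, the element v determines u as \<open>pre v\<close>,
    so the defect becomes a function of v alone.\<close>
  define V where "V = (\<lambda>u. g \<otimes>\<^bsub>P\<^esub> u \<otimes>\<^bsub>P\<^esub> inv\<^bsub>P\<^esub> g) ` U"
  define pre where "pre v = inv\<^bsub>P\<^esub> g \<otimes>\<^bsub>P\<^esub> v \<otimes>\<^bsub>P\<^esub> g" for v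
  have V: "subgroup V P"
    unfolding V_def by (rule conj_subgroup[OF g])
  have cancel: "inv\<^bsub>P\<^esub> g \<otimes>\<^bsub>P\<^esub> (g \<otimes>\<^bsub>P\<^esub> z) = z" "g \<otimes>\<^bsub>P\<^esub> (inv\<^bsub>P\<^esub> g \<otimes>\<^bsub>P\<^esub> z) = z"
    if "z \<in> carrier P" for z
    using g that by (simp_all flip: P.m_assoc)
  have eq_pre: "v \<in> V \<and> u = pre v" if "u \<in> U" "v \<in> carrier P" "g \<otimes>\<^bsub>P\<^esub> u = v \<otimes>\<^bsub>P\<^esub> g" for u v
  proof -
    have "v = g \<otimes>\<^bsub>P\<^esub> u \<otimes>\<^bsub>P\<^esub> inv\<^bsub>P\<^esub> g"
      using g that by (simp add: P.m_assoc)
    moreover have "u = pre v"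
      unfolding pre_def using g that cancel(1)[of u] by (simp add: P.m_assoc)
    ultimately show ?thesis
      using that(1) unfolding V_def by blast
  qed
  have pre: "pre v \<in> U \<and> g \<otimes>\<^bsub>P\<^esub> pre v = v \<otimes>\<^bsub>P\<^esub> g" if v: "v \<in> V" for v
  proof -
    obtain u where u: "u \<in> U" "v = g \<otimes>\<^bsub>P\<^esub> u \<otimes>\<^bsub>P\<^esub> inv\<^bsub>P\<^esub> g"
      using v unfolding V_def by blast
    then have "g \<otimes>\<^bsub>P\<^esub> u = v \<otimes>\<^bsub>P\<^esub> g"
      using g by (simp add: P.m_assoc)
    then show ?thesis
      using eq_pre[OF u(1)] u g by auto
  qed
  let ?n = "r + 1 - 2 * m"
  let ?\<alpha> = "\<lambda>v. defect g \<phi> \<phi>' (pre v) v" and ?\<beta> = "\<lambda>v. defect' g \<psi> \<psi>' (pre v) v"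
  \<comment> \<open>Applying \<open>into\<close> to the label (0, pre v) shows that v lies in U'.
    Since w = 0, the right-hand side of the congruence is p^r w'.\<close>
  have VU': "v \<in> U'" and C_ex: "\<exists>c\<in>A. ?\<alpha> v = act v t - t + nscale (p ^ ?n) c" if v: "v \<in> V" for v
  proof -
    have b: "pre v \<in> U" "g \<otimes>\<^bsub>P\<^esub> pre v = v \<otimes>\<^bsub>P\<^esub> g"
      using pre[OF v] by auto
    have v': "v \<in> carrier P"
      using subgroup.mem_carrier[OF V v] .
    obtain w' v0 where w': "w' \<in> W'" and v0: "v0 \<in> U'"
      and rel: "h \<otimes>\<^bsub>H r\<^esub> e r \<phi> \<psi> (0, pre v) = e r \<phi>' \<psi>' (w', v0) \<otimes>\<^bsub>H r\<^esub> h"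
      using into[of "(0, pre v)"] b(1) good_W(2)[OF good] by auto
    note rel' = rel[unfolded h_eq conj_e_iff[OF r t g good_W(2)[OF good] w' b(1) v0]]
    have "v0 = v"
      using rel' b(2) g v' good_Uc[OF good' v0] by (metis P.right_cancel)
    then show vU': "v \<in> U'"
      using v0 by simp
    have dA: "?\<alpha> v \<in> A" "?\<beta> v \<in> A"
      using b g vU' v' by (simp_all add: defect_def defect'_def)
    have "cong_p (r + 1) (t - act v t + ?\<alpha> v + nscale (p ^ ?n) (?\<beta> v)) (nscale (p ^ r) w')"
      using rel' \<open>v0 = v\<close> g by simp
    then have "cong_p ?n (t - act v t + ?\<alpha> v + nscale (p ^ ?n) (?\<beta> v)) (nscale (p ^ r) w')"
      by (rule cong_p_mono) simp
    moreover have "cong_p ?n (nscale (p ^ r) w') 0"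
    proof -
      \<comment> \<open>Here m \<ge> 1 matters: it gives r+1-2m \<le> r, so p^r w' vanishes modulo
        p^(r+1-2m).\<close>
      have "?n + (2 * m - 1) = r"
        using r r0 m_pos by simp
      then have "nscale (p ^ r) w' = nscale (p ^ ?n) (nscale (p ^ (2 * m - 1)) w')"
        unfolding nscale_pow by (simp only:)
      then show ?thesis
        using w' by (intro cong_pI[of _ _ _ "nscale (p ^ (2 * m - 1)) w'"]) simp_all
    qed
    ultimately have "cong_p ?n (t - act v t + ?\<alpha> v + nscale (p ^ ?n) (?\<beta> v)) 0"
      by (rule cong_p_trans)
    then obtain c where c: "c \<in> A" "t - act v t + ?\<alpha> v + nscale (p ^ ?n) (?\<beta> v) = 0 + nscale (p ^ ?n) c"
      unfolding cong_p_def by blast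
    have "?\<alpha> v = act v t - t + nscale (p ^ ?n) (c - ?\<beta> v)"
      using c(2) unfolding nscale_diff_right by (simp add: algebra_simps)
    then show "\<exists>c\<in>A. ?\<alpha> v = act v t - t + nscale (p ^ ?n) c"
      using c(1) dA by (intro bexI[of _ "c - ?\<beta> v"]) simp_all
  qed
  obtain C where CA: "\<And>v. v \<in> V \<Longrightarrow> C v \<in> A"
    and C: "\<And>v. v \<in> V \<Longrightarrow> ?\<alpha> v = act v t - t + nscale (p ^ ?n) (C v)"
    using C_ex by metis
  have Vc: "v \<in> carrier P" if "v \<in> V" for v
    using subgroup.mem_carrier[OF V that] .
  \<comment> \<open>The defect and v -> v t - t are both cocycles; their difference is divided by
    p^(r+1-2m).\<close>
  have C_cocycle: "C (v \<otimes>\<^bsub>P\<^esub> v') = act v (C v') + C v" if v: "v \<in> V" "v' \<in> V" for v v'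
  proof (rule nscale_p_power_cancel)
    have vv: "v \<otimes>\<^bsub>P\<^esub> v' \<in> V"
      using subgroup.m_closed[OF V v] .
    show "C (v \<otimes>\<^bsub>P\<^esub> v') \<in> A" "act v (C v') + C v \<in> A"
      using CA[OF vv] CA[OF v(1)] CA[OF v(2)] Vc[OF v(1)] by simp_all
    have bb: "pre (v \<otimes>\<^bsub>P\<^esub> v') = pre v \<otimes>\<^bsub>P\<^esub> pre v'"
      unfolding pre_def using g Vc[OF v(1)] Vc[OF v(2)] cancel by (simp add: P.m_assoc)
    have "?\<alpha> (v \<otimes>\<^bsub>P\<^esub> v') = act v (?\<alpha> v') + ?\<alpha> v"
      unfolding bb using pre[OF v(1)] pre[OF v(2)] VU'[OF v(1)] VU'[OF v(2)] g
      by (intro defect_cocycle) auto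
    then show "nscale (p ^ ?n) (C (v \<otimes>\<^bsub>P\<^esub> v')) = nscale (p ^ ?n) (act v (C v') + C v)"
      unfolding C[OF vv] C[OF v(1)] C[OF v(2)]
      using t CA[OF v(1)] CA[OF v(2)] Vc[OF v(1)] Vc[OF v(2)]
      by (simp add: act_add act_diff act_nscale act_act nscale_add_right algebra_simps)
  qed
  obtain a where aA: "a \<in> A" and a: "\<And>v. v \<in> V \<Longrightarrow> nscale (p ^ m) (C v) = act v a - a"
    using one_cocycle_order[OF V CA C_cocycle] by blast
  \<comment> \<open>Since p^(r+1-2m) C = p^(r+1-3m) (p^m C) and p^m C is the coboundary of a, this
    shift of t absorbs C.\<close>
  define t0 where "t0 = t + nscale (p ^ (r + 1 - 3 * m)) a"
  have t0A: "t0 \<in> A"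
    using t aA by (simp add: t0_def)
  have \<alpha>_eq: "?\<alpha> v = act v t0 - t0" if v: "v \<in> V" for v
  proof -
    have "(r + 1 - 3 * m) + m = ?n"
      using r r0 by simp
    then have "nscale (p ^ ?n) (C v) = nscale (p ^ (r + 1 - 3 * m)) (nscale (p ^ m) (C v))"
      unfolding nscale_pow by (simp only:)
    then show ?thesis
      unfolding C[OF v] a[OF v] t0_def using t aA Vc[OF v]
      by (simp add: act_add act_nscale nscale_diff_right algebra_simps)
  qed
  \<comment> \<open>At k = r this is the given t, so a single criterion covers the given element and
    its replacement at s.\<close>
  define t' where "t' k = t0 - nscale (p ^ (k + 1 - 3 * m)) a" for k
  have t'A: "t' k \<in> A" for k
    using t0A aA by (simp add: t'_def)
  have t'r: "t' r = t"
    by (simp add: t'_def t0_def)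
  have rel_iff: "(q k (t' k), g) \<otimes>\<^bsub>H k\<^esub> e k \<phi> \<psi> (w, u) = e k \<phi>' \<psi>' (w', v) \<otimes>\<^bsub>H k\<^esub> (q k (t' k), g) \<longleftrightarrow>
      g \<otimes>\<^bsub>P\<^esub> u = v \<otimes>\<^bsub>P\<^esub> g \<and>
      cong_p (3 * m) (act v a - a + nscale (p ^ m) (?\<beta> v)) (nscale (p ^ (3 * m - 1)) (w' - act g w))"
    if k: "k \<ge> r0" and w: "w \<in> W" "w' \<in> W'" and u: "u \<in> U" "v \<in> U'" for k w u w' v
  proof (cases "g \<otimes>\<^bsub>P\<^esub> u = v \<otimes>\<^bsub>P\<^esub> g")
    case True
    then have v: "v \<in> V" and ub: "u = pre v"
      using eq_pre[OF u(1) _ True] u(2) by auto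
    \<comment> \<open>All terms are multiples of p^n: the exponents k+1-2m, k+1 and k leave m, 3m
      and 3m-1, none of which involves k.\<close>
    define n where "n = k + 1 - 3 * m"
    have n: "k + 1 - 2 * m = n + m" "k + 1 = n + 3 * m" "k = n + (3 * m - 1)"
      using k r0 m_pos by (simp_all add: n_def)
    have \<beta>A: "?\<beta> v \<in> A"
      using u ub g by (simp add: defect'_def)
    have "t' k - act v (t' k) + ?\<alpha> v + nscale (p ^ (n + m)) (?\<beta> v) =
        nscale (p ^ n) (act v a - a + nscale (p ^ m) (?\<beta> v))"
      unfolding \<alpha>_eq[OF v] t'_def n_def[symmetric] nscale_pow[symmetric] nscale_add_right
      using t0A aA Vc[OF v] by (simp add: act_diff act_nscale nscale_diff_right algebra_simps)
    moreover have "nscale (p ^ (n + (3 * m - 1))) (w' - act g w) =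
        nscale (p ^ n) (nscale (p ^ (3 * m - 1)) (w' - act g w))"
      unfolding nscale_pow ..
    ultimately have "cong_p (n + 3 * m) (t' k - act v (t' k) + ?\<alpha> v + nscale (p ^ (n + m)) (?\<beta> v))
        (nscale (p ^ (n + (3 * m - 1))) (w' - act g w)) \<longleftrightarrow>
      cong_p (3 * m) (act v a - a + nscale (p ^ m) (?\<beta> v)) (nscale (p ^ (3 * m - 1)) (w' - act g w))"
      using aA \<beta>A Vc[OF v] w g by (simp only:) (rule cong_p_nscale_iff; simp)
    then show ?thesis
      unfolding conj_e_iff[OF k t'A g w u] ub[symmetric] n(1) unfolding n(2)
      using True n(3) by (simp only: simp_thms)
  next
    case False
    then show ?thesis
      unfolding conj_e_iff[OF k t'A g w u] by simp
  qed
  show ?thesis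
  proof (intro bexI[of _ "(q s (t' s), g)"] ballI)
    show "(q s (t' s), g) \<in> carrier (H s)"
      using s t'A g by (simp add: H_memI)
    fix x y assume "x \<in> W \<times> U" "y \<in> W' \<times> U'"
    then obtain w u w' v where "x = (w, u)" "y = (w', v)" "w \<in> W" "u \<in> U" "w' \<in> W'" "v \<in> U'"
      by blast
    then show "h \<otimes>\<^bsub>H r\<^esub> e r \<phi> \<psi> x = e r \<phi>' \<psi>' y \<otimes>\<^bsub>H r\<^esub> h \<longleftrightarrow>
      (q s (t' s), g) \<otimes>\<^bsub>H s\<^esub> e s \<phi> \<psi> x = e s \<phi>' \<psi>' y \<otimes>\<^bsub>H s\<^esub> (q s (t' s), g)"
      using rel_iff[OF r] rel_iff[OF s] unfolding t'r h_eq by simp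
  qed
qed

end

definition admissible where "admissible = {(U, \<phi>, \<psi>, W). good U \<phi> \<psi> W}"

text \<open>\<open>transfer\<close> speaks of conjugates and \<open>conj_transfer\<close> of
  products; \<open>conj_by_eq_iff\<close> translates between them.\<close>

sublocale quillen: quillen_transport p "{r0..}" H admissible "\<lambda>(U, \<phi>, \<psi>, W). W \<times> U"
  "\<lambda>r (U, \<phi>, \<psi>, W). e r \<phi> \<psi>"
proof (rule quillen_transport.intro)
  fix r assume r: "r \<in> {r0..}"
  then show "group (H r)"
    by (simp add: group_H)
  show "elementary_abelian_subgroups p (H r) =
      (\<lambda>x. (case x of (U, \<phi>, \<psi>, W) \<Rightarrow> e r \<phi> \<psi>) ` (case x of (U, \<phi>, \<psi>, W) \<Rightarrow> W \<times> U)) ` admissible"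
  proof (intro equalityI subsetI)
    fix E assume "E \<in> elementary_abelian_subgroups p (H r)"
    then obtain U \<phi> \<psi> W where "good U \<phi> \<psi> W" "E = e r \<phi> \<psi> ` (W \<times> U)"
      using elementary_abelian_eq_e_image r by (metis atLeast_iff)
    then show "E \<in> (\<lambda>x. (case x of (U, \<phi>, \<psi>, W) \<Rightarrow> e r \<phi> \<psi>) ` (case x of (U, \<phi>, \<psi>, W) \<Rightarrow> W \<times> U)) ` admissible"
      by (intro image_eqI[of _ _ "(U, \<phi>, \<psi>, W)"]) (simp_all add: admissible_def)
  qed (use r e_image_elementary_abelian in \<open>auto simp: admissible_def\<close>)
next
  fix r s x a b
  assume "r \<in> {r0..}" "s \<in> {r0..}" "x \<in> admissible"
    and "a \<in> (case x of (U, \<phi>, \<psi>, W) \<Rightarrow> W \<times> U)" "b \<in> (case x of (U, \<phi>, \<psi>, W) \<Rightarrow> W \<times> U)"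
    and "(case x of (U, \<phi>, \<psi>, W) \<Rightarrow> e r \<phi> \<psi>) a = (case x of (U, \<phi>, \<psi>, W) \<Rightarrow> e r \<phi> \<psi>) b"
  then show "(case x of (U, \<phi>, \<psi>, W) \<Rightarrow> e s \<phi> \<psi>) a = (case x of (U, \<phi>, \<psi>, W) \<Rightarrow> e s \<phi> \<psi>) b"
    by (auto simp: admissible_def e_eq_iff)
next
  fix r s x y h
  assume rs: "r \<in> {r0..}" "s \<in> {r0..}" and x: "x \<in> admissible" and y: "y \<in> admissible"
    and h: "h \<in> carrier (H r)"
    and into: "conj_by (H r) h ` (case x of (U, \<phi>, \<psi>, W) \<Rightarrow> e r \<phi> \<psi>) ` (case x of (U, \<phi>, \<psi>, W) \<Rightarrow> W \<times> U)
      \<subseteq> (case y of (U, \<phi>, \<psi>, W) \<Rightarrow> e r \<phi> \<psi>) ` (case y of (U, \<phi>, \<psi>, W) \<Rightarrow> W \<times> U)"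
  obtain U \<phi> \<psi> W where x': "x = (U, \<phi>, \<psi>, W)" and good: "good U \<phi> \<psi> W"
    using x unfolding admissible_def by blast
  obtain U' \<phi>' \<psi>' W' where y': "y = (U', \<phi>', \<psi>', W')" and good': "good U' \<phi>' \<psi>' W'"
    using y unfolding admissible_def by blast
  have rs': "r \<ge> r0" "s \<ge> r0"
    using rs by auto
  interpret r: group "H r" using group_H[OF rs'(1)] .
  interpret s: group "H s" using group_H[OF rs'(2)] .
  have mem: "e k \<phi> \<psi> a \<in> carrier (H k)" "e k \<phi>' \<psi>' b \<in> carrier (H k)"
    if "k \<ge> r0" "a \<in> W \<times> U" "b \<in> W' \<times> U'" for a b k
    using that e_carrier[OF good] e_carrier[OF good'] by auto
  have "\<exists>b\<in>W' \<times> U'. h \<otimes>\<^bsub>H r\<^esub> e r \<phi> \<psi> a = e r \<phi>' \<psi>' b \<otimes>\<^bsub>H r\<^esub> h" if a: "a \<in> W \<times> U" for a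
  proof -
    have "conj_by (H r) h (e r \<phi> \<psi> a) \<in> e r \<phi>' \<psi>' ` (W' \<times> U')"
      using into[THEN subsetD, OF imageI[OF imageI]] a unfolding x' y' prod.case by blast
    then obtain b where "b \<in> W' \<times> U'" "conj_by (H r) h (e r \<phi> \<psi> a) = e r \<phi>' \<psi>' b"
      by (elim imageE)
    then show ?thesis
      using r.conj_by_eq_iff[OF h] mem[OF rs'(1) a] by blast
  qed
  then obtain h' where h': "h' \<in> carrier (H s)" "\<forall>a\<in>W \<times> U. \<forall>b\<in>W' \<times> U'.
    h \<otimes>\<^bsub>H r\<^esub> e r \<phi> \<psi> a = e r \<phi>' \<psi>' b \<otimes>\<^bsub>H r\<^esub> h \<longleftrightarrow>
    h' \<otimes>\<^bsub>H s\<^esub> e s \<phi> \<psi> a = e s \<phi>' \<psi>' b \<otimes>\<^bsub>H s\<^esub> h'"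
    using conj_transfer[OF good good' rs' h] by blast
  have "conj_by (H r) h (e r \<phi> \<psi> a) = e r \<phi>' \<psi>' b \<longleftrightarrow> conj_by (H s) h' (e s \<phi> \<psi> a) = e s \<phi>' \<psi>' b"
    if ab: "a \<in> W \<times> U" "b \<in> W' \<times> U'" for a b
    using h'(2) ab unfolding r.conj_by_eq_iff[OF h mem[OF rs'(1) ab]]
      s.conj_by_eq_iff[OF h'(1) mem[OF rs'(2) ab]] by blast
  then show "\<exists>h'\<in>carrier (H s). \<forall>a\<in>case x of (U, \<phi>, \<psi>, W) \<Rightarrow> W \<times> U. \<forall>b\<in>case y of (U, \<phi>, \<psi>, W) \<Rightarrow> W \<times> U.
    conj_by (H r) h ((case x of (U, \<phi>, \<psi>, W) \<Rightarrow> e r \<phi> \<psi>) a) = (case y of (U, \<phi>, \<psi>, W) \<Rightarrow> e r \<phi> \<psi>) b \<longleftrightarrow>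
    conj_by (H s) h' ((case x of (U, \<phi>, \<psi>, W) \<Rightarrow> e s \<phi> \<psi>) a) = (case y of (U, \<phi>, \<psi>, W) \<Rightarrow> e s \<phi> \<psi>) b"
    unfolding x' y' prod.case using h'(1) by blast
qed

end

section \<open>Coset modules\<close>

lemma (in comm_group) coboundary_1:
  assumes "u \<in> carrier K" "v \<in> carrier K"
    and "act u (f [v]) \<in> carrier G" "f [u \<otimes>\<^bsub>K\<^esub> v] \<in> carrier G" "f [u] \<in> carrier G"
  shows "coboundary 1 K G act f [u, v] = act u (f [v]) \<otimes> inv (f [u \<otimes>\<^bsub>K\<^esub> v]) \<otimes> f [u]"
  using assms by (simp add: coboundary_def tuples_def lessThan_Suc int_pow_neg)

lemma (in comm_group) coboundary_2:
  assumes "u \<in> carrier K" "v \<in> carrier K" "w \<in> carrier K"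
    and "act u (f [v, w]) \<in> carrier G" "f [u \<otimes>\<^bsub>K\<^esub> v, w] \<in> carrier G"
      "f [u, v \<otimes>\<^bsub>K\<^esub> w] \<in> carrier G" "f [u, v] \<in> carrier G"
  shows "coboundary 2 K G act f [u, v, w] =
    act u (f [v, w]) \<otimes> (inv (f [u \<otimes>\<^bsub>K\<^esub> v, w]) \<otimes> f [u, v \<otimes>\<^bsub>K\<^esub> w]) \<otimes> inv (f [u, v])"
proof -
  have "{..<2::nat} = {0, 1}"
    by auto
  then show ?thesis
    using assms by (simp add: coboundary_def tuples_def int_pow_neg numeral_eq_Suc)
qed

lemma tuples_1: "tuples 1 A = (\<lambda>u. [u]) ` A"
  by (auto simp: tuples_def length_Suc_conv)

lemma tuples_2: "tuples 2 A = (\<lambda>(u, v). [u, v]) ` (A \<times> A)"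
  by (auto simp: tuples_def length_Suc_conv numeral_eq_Suc image_iff)

text \<open>T is written multiplicatively inside S, and \<iota> identifies it with a subgroup of an
  additive type, where the preceding arithmetic takes place. The p-adic structure enters as
  torsion-freeness and separatedness.\<close>

locale lattice_extension =
  fixes p m r0 :: nat and S :: "'s monoid" and T :: "'s set" and \<rho> \<sigma> \<eta> :: "'s set list \<Rightarrow> 's"
    and \<iota> :: "'s \<Rightarrow> 'b::ab_group_add"
  assumes p: "prime p" and group_S: "group S" and T_normal: "T \<lhd> S"
    and T_comm: "\<And>s t. s \<in> T \<Longrightarrow> t \<in> T \<Longrightarrow> s \<otimes>\<^bsub>S\<^esub> t = t \<otimes>\<^bsub>S\<^esub> s"
    and order_P: "order (S Mod T) = p ^ m" and m_pos: "m \<ge> 1" and r0: "3 * m \<le> r0"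
    and \<iota>_mult: "\<And>s t. s \<in> T \<Longrightarrow> t \<in> T \<Longrightarrow> \<iota> (s \<otimes>\<^bsub>S\<^esub> t) = \<iota> s + \<iota> t" and \<iota>_inj: "inj_on \<iota> T"
    and T_torsion_free: "\<And>t. t \<in> T \<Longrightarrow> t [^]\<^bsub>S\<^esub> p = \<one>\<^bsub>S\<^esub> \<Longrightarrow> t = \<one>\<^bsub>S\<^esub>"
    and T_separated: "\<And>t. t \<in> T \<Longrightarrow> (\<And>k. t \<in> p_mult p S T k) \<Longrightarrow> t = \<one>\<^bsub>S\<^esub>"
    and \<rho>: "\<rho> \<in> cocycles 2 (S Mod T) (sub_group S T) (conj_action S)"
    and \<eta>: "\<eta> \<in> cochains 3 (S Mod T) (sub_group S T)"
    and \<sigma>: "\<sigma> \<in> cochains 2 (S Mod T) (sub_group S T)"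
    and \<sigma>_coboundary: "coboundary 2 (S Mod T) (sub_group S T) (conj_action S) \<sigma> =
      (\<lambda>gs\<in>tuples 3 (carrier (S Mod T)). \<eta> gs [^]\<^bsub>S\<^esub> (p ^ m))"
begin

sublocale S: group S by (rule group_S)
sublocale T: normal T S by (rule T_normal)

abbreviation "P \<equiv> S Mod T"

sublocale P: group P by (rule T.factorgroup_is_group)

lemma T_subgroup: "subgroup T S" by (rule T.subgroup_axioms)

lemma carrier_M [simp]: "carrier (sub_group S T) = T" "\<one>\<^bsub>sub_group S T\<^esub> = \<one>\<^bsub>S\<^esub>"
  "x \<otimes>\<^bsub>sub_group S T\<^esub> y = x \<otimes>\<^bsub>S\<^esub> y"
  by (simp_all add: sub_group_def)

lemma M_group: "group (sub_group S T)"
  unfolding sub_group_def by (rule S.subgroup_imp_group[OF T_subgroup])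

sublocale M: comm_group "sub_group S T"
  by (rule group.group_comm_groupI[OF M_group]) (simp add: T_comm)

lemma M_pow: "x [^]\<^bsub>sub_group S T\<^esub> (n::nat) = x [^]\<^bsub>S\<^esub> n"
  by (simp add: sub_group_def flip: S.nat_pow_consistent)

lemma M_inv: "x \<in> T \<Longrightarrow> inv\<^bsub>sub_group S T\<^esub> x = inv\<^bsub>S\<^esub> x"
  by (simp add: sub_group_def S.m_inv_consistent[OF T_subgroup])

lemma T_closed [simp]: "s \<in> T \<Longrightarrow> t \<in> T \<Longrightarrow> s \<otimes>\<^bsub>S\<^esub> t \<in> T" "\<one>\<^bsub>S\<^esub> \<in> T" "t \<in> T \<Longrightarrow> inv\<^bsub>S\<^esub> t \<in> T"
  "t \<in> T \<Longrightarrow> t [^]\<^bsub>S\<^esub> (n::nat) \<in> T" "t \<in> T \<Longrightarrow> t \<in> carrier S"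
  using M.nat_pow_closed[of t n] by (simp_all add: M_pow T.m_inv_closed T.mem_carrier)

section \<open>The additive copy of T and the action on it\<close>

definition A where "A = \<iota> ` T"
definition \<kappa> where "\<kappa> = inv_into T \<iota>"

lemma \<kappa>_\<iota> [simp]: "t \<in> T \<Longrightarrow> \<kappa> (\<iota> t) = t"
  unfolding \<kappa>_def by (rule inv_into_f_f[OF \<iota>_inj])

lemma \<iota>_A [simp]: "t \<in> T \<Longrightarrow> \<iota> t \<in> A"
  by (simp add: A_def)

lemma \<kappa>_T [simp]: "a \<in> A \<Longrightarrow> \<kappa> a \<in> T" and \<iota>_\<kappa> [simp]: "a \<in> A \<Longrightarrow> \<iota> (\<kappa> a) = a"
  unfolding A_def \<kappa>_def by (auto simp: inv_into_into f_inv_into_f)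

lemma \<iota>_one [simp]: "\<iota> \<one>\<^bsub>S\<^esub> = 0"
  using \<iota>_mult[of "\<one>\<^bsub>S\<^esub>" "\<one>\<^bsub>S\<^esub>"] by simp

lemma \<iota>_inv: "t \<in> T \<Longrightarrow> \<iota> (inv\<^bsub>S\<^esub> t) = - \<iota> t"
  using \<iota>_mult[of t "inv\<^bsub>S\<^esub> t"] by (simp add: eq_neg_iff_add_eq_0 add.commute)

lemma \<iota>_pow: "t \<in> T \<Longrightarrow> \<iota> (t [^]\<^bsub>S\<^esub> (n::nat)) = nscale n (\<iota> t)"
  by (induction n) (simp_all add: \<iota>_mult add.commute)

lemmas \<iota>_simps = \<iota>_mult \<iota>_inv \<iota>_pow

lemma \<iota>_eq_iff: "s \<in> T \<Longrightarrow> t \<in> T \<Longrightarrow> \<iota> s = \<iota> t \<longleftrightarrow> s = t"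
  using \<iota>_inj by (auto simp: inj_on_def)

lemma A_closed: "0 \<in> A" "a \<in> A \<Longrightarrow> b \<in> A \<Longrightarrow> a + b \<in> A" "a \<in> A \<Longrightarrow> - a \<in> A"
    "a \<in> A \<Longrightarrow> nscale n a \<in> A"
  using \<iota>_A[of "\<one>\<^bsub>S\<^esub>"] \<iota>_A[of "\<kappa> a \<otimes>\<^bsub>S\<^esub> \<kappa> b"] \<iota>_A[of "inv\<^bsub>S\<^esub> \<kappa> a"] \<iota>_A[of "\<kappa> a [^]\<^bsub>S\<^esub> n"]
  by (simp_all add: \<iota>_simps del: \<iota>_A)

lemma \<kappa>_add: "a \<in> A \<Longrightarrow> b \<in> A \<Longrightarrow> \<kappa> (a + b) = \<kappa> a \<otimes>\<^bsub>S\<^esub> \<kappa> b"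
  and \<kappa>_minus: "a \<in> A \<Longrightarrow> \<kappa> (- a) = inv\<^bsub>S\<^esub> \<kappa> a" and \<kappa>_zero: "\<kappa> 0 = \<one>\<^bsub>S\<^esub>"
  and \<kappa>_nscale: "a \<in> A \<Longrightarrow> \<kappa> (nscale n a) = \<kappa> a [^]\<^bsub>S\<^esub> n"
  by (rule \<iota>_eq_iff[THEN iffD1]; simp add: A_closed \<iota>_simps)+

definition act where "act g a = \<iota> (conj_action S g (\<kappa> a))"

lemma carrier_PE:
  assumes "g \<in> carrier P" obtains s where "s \<in> carrier S" "g = T #>\<^bsub>S\<^esub> s"
  using assms unfolding carrier_FactGroup by blast

lemma coset_memE:
  assumes "x \<in> T #>\<^bsub>S\<^esub> s" obtains t where "t \<in> T" "x = t \<otimes>\<^bsub>S\<^esub> s"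
  using assms unfolding r_coset_def by blast

lemma conj_T: "s \<in> carrier S \<Longrightarrow> t \<in> T \<Longrightarrow> conj_by S s t \<in> T"
  unfolding conj_by_def by (rule T.inv_op_closed2)

lemma conj_by_T_T: "s \<in> T \<Longrightarrow> t \<in> T \<Longrightarrow> conj_by S s t = t"
  unfolding conj_by_def using T_comm[of s t] by (simp add: S.m_assoc)

text \<open>Another representative differs by an element of T, which acts trivially on T by
  \<open>conj_by_T_T\<close>; so \<open>THE\<close> has a single candidate.\<close>

lemma conj_action_coset:
  assumes s: "s \<in> carrier S" and t: "t \<in> T"
  shows "conj_action S (T #>\<^bsub>S\<^esub> s) t = conj_by S s t"
  unfolding conj_action_def
proof (rule the_equality)
  show "\<exists>s'\<in>T #>\<^bsub>S\<^esub> s. conj_by S s t = conj_by S s' t"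
    using S.rcos_self[OF s T_subgroup] by blast
  fix u assume "\<exists>s'\<in>T #>\<^bsub>S\<^esub> s. u = conj_by S s' t"
  then obtain z where z: "z \<in> T" "u = conj_by S (z \<otimes>\<^bsub>S\<^esub> s) t"
    by (auto elim: coset_memE)
  then have "u = conj_by S z (conj_by S s t)"
    using s t by (simp add: S.conj_by_conj_by)
  then show "u = conj_by S s t"
    using conj_by_T_T[OF z(1) conj_T[OF s t]] by simp
qed

lemma conj_by_mult: "s \<in> carrier S \<Longrightarrow> t \<in> T \<Longrightarrow> t' \<in> T \<Longrightarrow>
    conj_by S s (t \<otimes>\<^bsub>S\<^esub> t') = conj_by S s t \<otimes>\<^bsub>S\<^esub> conj_by S s t'"
  unfolding conj_by_def by (simp add: S.m_assoc S.inv_solve_left)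

lemma conj_action_closed [simp]: "g \<in> carrier P \<Longrightarrow> t \<in> T \<Longrightarrow> conj_action S g t \<in> T"
  by (elim carrier_PE) (simp add: conj_action_coset conj_T)

lemma conj_action_mult: "g \<in> carrier P \<Longrightarrow> t \<in> T \<Longrightarrow> t' \<in> T \<Longrightarrow>
    conj_action S g (t \<otimes>\<^bsub>S\<^esub> t') = conj_action S g t \<otimes>\<^bsub>S\<^esub> conj_action S g t'"
  by (elim carrier_PE) (simp add: conj_action_coset conj_by_mult)

lemma conj_action_one: "t \<in> T \<Longrightarrow> conj_action S \<one>\<^bsub>P\<^esub> t = t"
  using conj_action_coset[of "\<one>\<^bsub>S\<^esub>" t] S.coset_mult_one[OF T.subset] by (simp add: S.conj_by_one)

lemma conj_action_conj_action:
  assumes "g \<in> carrier P" "h \<in> carrier P" "t \<in> T"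
  shows "conj_action S g (conj_action S h t) = conj_action S (g \<otimes>\<^bsub>P\<^esub> h) t"
proof -
  obtain s s' where s: "s \<in> carrier S" "g = T #>\<^bsub>S\<^esub> s" "s' \<in> carrier S" "h = T #>\<^bsub>S\<^esub> s'"
    using assms by (elim carrier_PE)
  then show ?thesis
    using assms(3) by (simp add: conj_action_coset conj_T S.conj_by_conj_by T.rcos_sum)
qed

lemma act_\<iota>: "t \<in> T \<Longrightarrow> act g (\<iota> t) = \<iota> (conj_action S g t)"
  by (simp add: act_def)

section \<open>The quotients T/p^k T\<close>

definition proj where "proj k t = p_proj p S T k t"

lemma p_mult_subset: "p_mult p S T k \<subseteq> T"
  by (auto simp: p_mult_def)

lemma p_mult_iff: "t \<in> T \<Longrightarrow> t \<in> p_mult p S T k \<longleftrightarrow> (\<exists>a\<in>A. \<iota> t = nscale (p ^ k) a)"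
proof -
  assume t: "t \<in> T"
  have "t \<in> p_mult p S T k \<longleftrightarrow> (\<exists>s\<in>T. \<iota> t = \<iota> (s [^]\<^bsub>S\<^esub> (p ^ k)))"
    unfolding p_mult_def using t by (auto simp: \<iota>_eq_iff simp del: \<iota>_A)
  then show ?thesis
    unfolding A_def by (auto simp: \<iota>_pow)
qed

lemma p_mult_subgroup: "subgroup (p_mult p S T k) (sub_group S T)"
proof (rule M.subgroupI)
  show "p_mult p S T k \<subseteq> carrier (sub_group S T)"
    using p_mult_subset by simp
  show "p_mult p S T k \<noteq> {}"
    using T_closed(2) unfolding p_mult_def by blast
  fix x y assume x: "x \<in> p_mult p S T k" and y: "y \<in> p_mult p S T k"
  have xT: "x \<in> T" "y \<in> T"
    using p_mult_subset x y by auto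
  obtain a b where "a \<in> A" "\<iota> x = nscale (p ^ k) a" "b \<in> A" "\<iota> y = nscale (p ^ k) b"
    using x[unfolded p_mult_iff[OF xT(1)]] y[unfolded p_mult_iff[OF xT(2)]] by (elim bexE)
  then have "- a \<in> A" "\<iota> (inv\<^bsub>S\<^esub> x) = nscale (p ^ k) (- a)"
    "a + b \<in> A" "\<iota> (x \<otimes>\<^bsub>S\<^esub> y) = nscale (p ^ k) (a + b)"
    using xT by (simp_all add: A_closed \<iota>_simps nscale_simps)
  then show "inv\<^bsub>sub_group S T\<^esub> x \<in> p_mult p S T k" "x \<otimes>\<^bsub>sub_group S T\<^esub> y \<in> p_mult p S T k"
    using xT p_mult_iff[of "inv\<^bsub>S\<^esub> x" k] p_mult_iff[of "x \<otimes>\<^bsub>S\<^esub> y" k] by (auto simp: M_inv)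
qed

lemma p_mult_normal: "p_mult p S T k \<lhd> sub_group S T"
  by (rule M.subgroup_imp_normal[OF p_mult_subgroup])

lemma proj_coset: "proj k t = p_mult p S T k #>\<^bsub>sub_group S T\<^esub> t"
  by (simp add: proj_def p_proj_def r_coset_def)

lemma comm_group_quotient: "comm_group (p_quotient p S T k)"
  unfolding p_quotient_def by (rule M.abelian_FactGroup[OF p_mult_subgroup])

lemma carrier_quotient: "carrier (p_quotient p S T k) = proj k ` T"
  unfolding p_quotient_def carrier_FactGroup by (simp add: proj_coset)

lemma mult_quotient: "s \<in> T \<Longrightarrow> t \<in> T \<Longrightarrow> proj k s \<otimes>\<^bsub>p_quotient p S T k\<^esub> proj k t = proj k (s \<otimes>\<^bsub>S\<^esub> t)"
  unfolding p_quotient_def proj_coset using normal.rcos_sum[OF p_mult_normal, of s t k] by simp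

lemma one_quotient: "\<one>\<^bsub>p_quotient p S T k\<^esub> = proj k \<one>\<^bsub>S\<^esub>"
  unfolding p_quotient_def proj_coset using M.coset_mult_one[of "p_mult p S T k"] p_mult_subset by simp

lemma inv_quotient: "t \<in> T \<Longrightarrow> inv\<^bsub>p_quotient p S T k\<^esub> (proj k t) = proj k (inv\<^bsub>S\<^esub> t)"
proof -
  assume t: "t \<in> T"
  interpret Q: comm_group "p_quotient p S T k" by (rule comm_group_quotient)
  show ?thesis
    by (rule Q.inv_equality) (use t in \<open>simp_all add: mult_quotient one_quotient carrier_quotient\<close>)
qed

text \<open>The bridge from cosets to congruences: equal cosets means that s t^(-1) is a p^k-th
  power in T.\<close>

lemma proj_eq_iff:
  assumes "s \<in> T" "t \<in> T"
  shows "proj k s = proj k t \<longleftrightarrow> (\<exists>a\<in>A. \<iota> s = \<iota> t + nscale (p ^ k) a)"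
proof -
  have "proj k s = proj k t \<longleftrightarrow> s \<in> proj k t"
    unfolding proj_coset using assms M.repr_independence[OF _ _ p_mult_subgroup, of s k t]
      M.rcos_self[OF _ p_mult_subgroup, of s k] by auto
  also have "\<dots> \<longleftrightarrow> s \<otimes>\<^bsub>S\<^esub> inv\<^bsub>S\<^esub> t \<in> p_mult p S T k"
  proof
    assume "s \<in> proj k t"
    then obtain z where "z \<in> p_mult p S T k" "s = z \<otimes>\<^bsub>S\<^esub> t"
      unfolding proj_coset r_coset_def by auto
    then show "s \<otimes>\<^bsub>S\<^esub> inv\<^bsub>S\<^esub> t \<in> p_mult p S T k"
      using assms p_mult_subset[of k] by (auto simp: S.m_assoc subset_iff)
  next
    assume "s \<otimes>\<^bsub>S\<^esub> inv\<^bsub>S\<^esub> t \<in> p_mult p S T k"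
    moreover have "s = (s \<otimes>\<^bsub>S\<^esub> inv\<^bsub>S\<^esub> t) \<otimes>\<^bsub>S\<^esub> t"
      using assms by (simp add: S.m_assoc)
    ultimately show "s \<in> proj k t"
      unfolding proj_coset r_coset_def by auto
  qed
  also have "\<dots> \<longleftrightarrow> (\<exists>a\<in>A. \<iota> s = \<iota> t + nscale (p ^ k) a)"
    using assms by (simp add: p_mult_iff \<iota>_simps algebra_simps)
  finally show ?thesis .
qed

text \<open>As c runs through T, (c^p t)^(p^r) = c^(p^(r+1)) t^(p^r) runs through the whole
  coset.\<close>

lemma proj_pow_shift:
  assumes "t \<in> T"
  shows "p_shift p S r (proj 1 t) = proj (r + 1) (t [^]\<^bsub>S\<^esub> (p ^ r))"
proof -
  have *: "(c [^]\<^bsub>S\<^esub> p \<otimes>\<^bsub>S\<^esub> t) [^]\<^bsub>S\<^esub> (p ^ r) = c [^]\<^bsub>S\<^esub> (p ^ (r + 1)) \<otimes>\<^bsub>S\<^esub> t [^]\<^bsub>S\<^esub> (p ^ r)"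
    if "c \<in> T" for c
    by (rule \<iota>_eq_iff[THEN iffD1]) (use assms that in \<open>simp_all add: \<iota>_simps nscale_add_right nscale_nscale mult.commute\<close>)
  show ?thesis
    unfolding p_shift_def proj_def p_proj_def p_mult_def r_coset_def
    by (auto simp: image_iff * simp del: power_Suc)
qed

lemma conj_action_pow: "g \<in> carrier P \<Longrightarrow> t \<in> T \<Longrightarrow>
    conj_action S g (t [^]\<^bsub>S\<^esub> (n::nat)) = conj_action S g t [^]\<^bsub>S\<^esub> n"
proof (induction n)
  case 0
  then show ?case
    using conj_action_mult[of g "\<one>\<^bsub>S\<^esub>" "\<one>\<^bsub>S\<^esub>"] S.l_cancel_one'[of "conj_action S g \<one>\<^bsub>S\<^esub>" "conj_action S g \<one>\<^bsub>S\<^esub>"]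
    by simp
qed (simp add: conj_action_mult)

lemma quotient_action_proj:
  assumes g: "g \<in> carrier P" and t: "t \<in> T"
  shows "quotient_action S g (proj k t) = proj k (conj_action S g t)"
proof
  show "quotient_action S g (proj k t) \<subseteq> proj k (conj_action S g t)"
  proof
    fix x assume "x \<in> quotient_action S g (proj k t)"
    then obtain c where c: "c \<in> T" "x = conj_action S g (c [^]\<^bsub>S\<^esub> (p ^ k) \<otimes>\<^bsub>S\<^esub> t)"
      unfolding quotient_action_def proj_def p_proj_def p_mult_def r_coset_def by blast
    have "x = conj_action S g c [^]\<^bsub>S\<^esub> (p ^ k) \<otimes>\<^bsub>S\<^esub> conj_action S g t"
      unfolding c(2) using c(1) g t by (simp only: conj_action_mult conj_action_pow T_closed)
    then show "x \<in> proj k (conj_action S g t)"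
      unfolding proj_def p_proj_def p_mult_def r_coset_def using conj_action_closed[OF g c(1)] by blast
  qed
  show "proj k (conj_action S g t) \<subseteq> quotient_action S g (proj k t)"
  proof
    fix x assume "x \<in> proj k (conj_action S g t)"
    then obtain c where c: "c \<in> T" "x = c [^]\<^bsub>S\<^esub> (p ^ k) \<otimes>\<^bsub>S\<^esub> conj_action S g t"
      unfolding proj_def p_proj_def p_mult_def r_coset_def by blast
    \<comment> \<open>The action of g on T is invertible, so c has a preimage.\<close>
    define c' where "c' = conj_action S (inv\<^bsub>P\<^esub> g) c"
    have c': "c' \<in> T" "conj_action S g c' = c"
      unfolding c'_def using g c(1) by (simp_all add: conj_action_conj_action conj_action_one del: one_FactGroup mult_FactGroup)
    have "x = conj_action S g (c' [^]\<^bsub>S\<^esub> (p ^ k) \<otimes>\<^bsub>S\<^esub> t)"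
      using c c' g t by (simp add: conj_action_mult conj_action_pow)
    then show "x \<in> quotient_action S g (proj k t)"
      unfolding quotient_action_def proj_def p_proj_def p_mult_def r_coset_def using c'(1) by blast
  qed
qed

end

text \<open>These rules would expand products and the identity of P into operations on cosets; from
  here on P is treated as an abstract group.\<close>

declare mult_FactGroup [simp del] one_FactGroup [simp del]

section \<open>The coclass family as an instance of the abstract family\<close>

lemma cochainD:
  assumes "f \<in> cochains n K M" "gs \<in> tuples n (carrier K)"
  shows "f gs \<in> carrier M" "\<one>\<^bsub>K\<^esub> \<in> set gs \<Longrightarrow> f gs = \<one>\<^bsub>M\<^esub>"
  using assms unfolding cochains_def by auto

lemma cochain_2D:
  assumes "f \<in> cochains 2 K M" "g \<in> carrier K" "h \<in> carrier K"
  shows "f [g, h] \<in> carrier M" "g = \<one>\<^bsub>K\<^esub> \<or> h = \<one>\<^bsub>K\<^esub> \<Longrightarrow> f [g, h] = \<one>\<^bsub>M\<^esub>"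
  using cochainD[OF assms(1), of "[g, h]"] assms(2,3) by (auto simp: tuples_def)

context lattice_extension
begin

definition q where "q r a = proj (r + 1) (\<kappa> a)"

abbreviation (input) "lift2 f \<equiv> (\<lambda>g h. \<iota> (f [g, h]))"
abbreviation (input) "lift3 f \<equiv> (\<lambda>g h k. \<iota> (f [g, h, k]))"

lemma \<rho>_cochain: "\<rho> \<in> cochains 2 P (sub_group S T)"
  using \<rho> by (simp add: cocycles_def)

lemma cochain_2_T [simp]: "g \<in> carrier P \<Longrightarrow> h \<in> carrier P \<Longrightarrow> \<rho> [g, h] \<in> T"
  "g \<in> carrier P \<Longrightarrow> h \<in> carrier P \<Longrightarrow> \<sigma> [g, h] \<in> T"
  using cochain_2D(1)[OF \<rho>_cochain] cochain_2D(1)[OF \<sigma>] by simp_all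

lemma \<eta>_T [simp]: "g \<in> carrier P \<Longrightarrow> h \<in> carrier P \<Longrightarrow> k \<in> carrier P \<Longrightarrow> \<eta> [g, h, k] \<in> T"
  using cochainD(1)[OF \<eta>, of "[g, h, k]"] by (simp add: tuples_def)

lemma \<iota>_coboundary_2:
  assumes f: "\<And>g h. g \<in> carrier P \<Longrightarrow> h \<in> carrier P \<Longrightarrow> f [g, h] \<in> T"
    and g: "g \<in> carrier P" "h \<in> carrier P" "k \<in> carrier P"
  shows "\<iota> (coboundary 2 P (sub_group S T) (conj_action S) f [g, h, k]) =
    act g (\<iota> (f [h, k])) + (- \<iota> (f [g \<otimes>\<^bsub>P\<^esub> h, k]) + \<iota> (f [g, h \<otimes>\<^bsub>P\<^esub> k])) + - \<iota> (f [g, h])"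
  using f g by (subst M.coboundary_2) (simp_all add: M_inv \<iota>_simps act_\<iota>)

lemma q_\<iota>: "t \<in> T \<Longrightarrow> q r (\<iota> t) = proj (r + 1) t"
  by (simp add: q_def)

lemma carrier_coeff: "carrier (coeff p S T r) = q r ` A"
  unfolding coeff_def carrier_quotient A_def q_def image_image by simp

lemma group_coeff: "comm_group (coeff p S T r)"
  unfolding coeff_def by (rule comm_group_quotient)

lemma mult_coeff: "a \<in> A \<Longrightarrow> b \<in> A \<Longrightarrow> q r a \<otimes>\<^bsub>coeff p S T r\<^esub> q r b = q r (a + b)"
  unfolding coeff_def q_def by (simp add: mult_quotient \<kappa>_add)

lemma one_coeff: "\<one>\<^bsub>coeff p S T r\<^esub> = q r 0"
  unfolding coeff_def q_def by (simp add: one_quotient \<kappa>_zero)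

lemma inv_coeff: "a \<in> A \<Longrightarrow> inv\<^bsub>coeff p S T r\<^esub> (q r a) = q r (- a)"
  unfolding coeff_def q_def by (simp add: inv_quotient \<kappa>_minus)

lemma quotient_action_q: "g \<in> carrier P \<Longrightarrow> a \<in> A \<Longrightarrow> quotient_action S g (q r a) = q r (act g a)"
  by (simp add: q_def quotient_action_proj act_def)

lemma p_shift_q: "a \<in> A \<Longrightarrow> p_shift p S r (q 0 a) = q r (nscale (p ^ r) a)"
  using proj_pow_shift[of "\<kappa> a" r] by (simp add: q_def \<kappa>_nscale)

lemma q_eq: "a \<in> A \<Longrightarrow> b \<in> A \<Longrightarrow> q r a = q r b \<longleftrightarrow> (\<exists>c\<in>A. a = b + nscale (p ^ (r + 1)) c)"
  unfolding q_def by (simp add: proj_eq_iff)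

lemma p_proj_q: "t \<in> T \<Longrightarrow> p_proj p S T (r + 1) t = q r (\<iota> t)"
  by (simp add: q_\<iota> proj_def)

lemma tau_q:
  assumes "g \<in> carrier P" "h \<in> carrier P"
  shows "tau p S T m \<rho> \<sigma> r [g, h] = q r (\<iota> (\<rho> [g, h]) + nscale (p ^ (r + 1 - m)) (\<iota> (\<sigma> [g, h])))"
proof -
  have "[g, h] \<in> tuples 2 (carrier P)"
    using assms by (simp add: tuples_def)
  then show ?thesis
    unfolding tau_def using assms p_proj_q[of "\<rho> [g, h] \<otimes>\<^bsub>S\<^esub> \<sigma> [g, h] [^]\<^bsub>S\<^esub> (p ^ (r + 1 - m))" r]
    by (simp add: \<iota>_simps)
qed

lemma act_closed: "g \<in> carrier P \<Longrightarrow> a \<in> A \<Longrightarrow> act g a \<in> A"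
  by (simp add: act_def)

text \<open>Cochains on lists become curried functions with values in \<open>A\<close>;
  normalization gives their vanishing at 1, and the multiplicative coboundary formula becomes the
  additive identities.\<close>

sublocale ext: extension_family p m P A act "lift2 \<rho>" "lift2 \<sigma>" "lift3 \<eta>" r0 q "coclass_group p S T m \<rho> \<sigma>"
proof (rule extension_family.intro)
  show "extension_data p m P A act (lift2 \<rho>) (lift2 \<sigma>) (lift3 \<eta>)"
  proof (rule extension_data.intro)
    show "prime p" "group P" "order P = p ^ m"
      using p P.is_group order_P by auto
    show "0 \<in> A" "\<And>a b. a \<in> A \<Longrightarrow> b \<in> A \<Longrightarrow> a + b \<in> A" "\<And>a. a \<in> A \<Longrightarrow> - a \<in> A"
      by (simp_all add: A_closed)
    show "\<And>g a. g \<in> carrier P \<Longrightarrow> a \<in> A \<Longrightarrow> act g a \<in> A"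
      by (rule act_closed)
    show "act g (a + b) = act g a + act g b" if "g \<in> carrier P" "a \<in> A" "b \<in> A" for g a b
      using that by (simp add: act_def \<kappa>_add conj_action_mult \<iota>_mult)
    show "act \<one>\<^bsub>P\<^esub> a = a" if "a \<in> A" for a
      using that by (simp add: act_def conj_action_one)
    show "act g (act h a) = act (g \<otimes>\<^bsub>P\<^esub> h) a" if "g \<in> carrier P" "h \<in> carrier P" "a \<in> A" for g h a
      using that by (simp add: act_def conj_action_conj_action)
    show "a = 0" if a: "a \<in> A" "nscale p a = 0" for a
    proof -
      have "\<kappa> a [^]\<^bsub>S\<^esub> p = \<one>\<^bsub>S\<^esub>"
        using \<kappa>_nscale[OF a(1), of p] a(2) by (simp add: \<kappa>_zero)
      then have "\<kappa> a = \<one>\<^bsub>S\<^esub>"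
        by (rule T_torsion_free[OF \<kappa>_T[OF a(1)]])
      then show ?thesis
        using \<iota>_\<kappa>[OF a(1)] by simp
    qed
    show "a = 0" if a: "a \<in> A" "\<And>k. \<exists>b\<in>A. a = nscale (p ^ k) b" for a
    proof -
      have "\<kappa> a = \<one>\<^bsub>S\<^esub>"
        by (rule T_separated) (use a in \<open>simp_all add: p_mult_iff\<close>)
      then show ?thesis
        using \<iota>_\<kappa>[OF a(1)] by simp
    qed
    show "\<iota> (\<rho> [g, h]) \<in> A" "\<iota> (\<sigma> [g, h]) \<in> A" if "g \<in> carrier P" "h \<in> carrier P" for g h
      using that by simp_all
    show "\<iota> (\<eta> [g, h, k]) \<in> A" if "g \<in> carrier P" "h \<in> carrier P" "k \<in> carrier P" for g h k
      using that by simp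
    show "\<iota> (\<rho> [g, \<one>\<^bsub>P\<^esub>]) = 0" "\<iota> (\<rho> [\<one>\<^bsub>P\<^esub>, g]) = 0"
      "\<iota> (\<sigma> [g, \<one>\<^bsub>P\<^esub>]) = 0" "\<iota> (\<sigma> [\<one>\<^bsub>P\<^esub>, g]) = 0" if "g \<in> carrier P" for g
      using that cochain_2D(2)[OF \<rho>_cochain] cochain_2D(2)[OF \<sigma>] by simp_all
    fix g h k assume g: "g \<in> carrier P" "h \<in> carrier P" "k \<in> carrier P"
    then have tup: "[g, h, k] \<in> tuples 3 (carrier P)"
      by (simp add: tuples_def)
    have "coboundary 2 P (sub_group S T) (conj_action S) \<rho> [g, h, k] = \<one>\<^bsub>S\<^esub>"
      using \<rho> tup by (simp add: cocycles_def)
    then have "act g (\<iota> (\<rho> [h, k])) + (- \<iota> (\<rho> [g \<otimes>\<^bsub>P\<^esub> h, k]) + \<iota> (\<rho> [g, h \<otimes>\<^bsub>P\<^esub> k])) + - \<iota> (\<rho> [g, h]) = 0"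
      using \<iota>_coboundary_2[of \<rho>, OF _ g] by simp
    then show "act g (\<iota> (\<rho> [h, k])) + \<iota> (\<rho> [g, h \<otimes>\<^bsub>P\<^esub> k]) = \<iota> (\<rho> [g \<otimes>\<^bsub>P\<^esub> h, k]) + \<iota> (\<rho> [g, h])"
      by (simp add: algebra_simps eq_neg_iff_add_eq_0)
    have "coboundary 2 P (sub_group S T) (conj_action S) \<sigma> [g, h, k] = \<eta> [g, h, k] [^]\<^bsub>S\<^esub> (p ^ m)"
      using \<sigma>_coboundary tup by simp
    then have "act g (\<iota> (\<sigma> [h, k])) + (- \<iota> (\<sigma> [g \<otimes>\<^bsub>P\<^esub> h, k]) + \<iota> (\<sigma> [g, h \<otimes>\<^bsub>P\<^esub> k])) + - \<iota> (\<sigma> [g, h]) =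
      nscale (p ^ m) (\<iota> (\<eta> [g, h, k]))"
      using \<iota>_coboundary_2[of \<sigma>, OF _ g] g by (simp add: \<iota>_pow)
    then show "act g (\<iota> (\<sigma> [h, k])) + \<iota> (\<sigma> [g, h \<otimes>\<^bsub>P\<^esub> k]) =
      \<iota> (\<sigma> [g \<otimes>\<^bsub>P\<^esub> h, k]) + \<iota> (\<sigma> [g, h]) + nscale (p ^ m) (\<iota> (\<eta> [g, h, k]))"
      by (simp add: algebra_simps)
  qed
  then interpret extension_data p m P A act "lift2 \<rho>" "lift2 \<sigma>" "lift3 \<eta>" .
  show "extension_family_axioms p m P A act (lift2 \<rho>) (lift2 \<sigma>) r0 q (coclass_group p S T m \<rho> \<sigma>)"
  proof (rule extension_family_axioms.intro)
    show "1 \<le> m" "3 * m \<le> r0"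
      using m_pos r0 by auto
    show "q r a = q r b \<longleftrightarrow> cong_p (r + 1) a b" if "a \<in> A" "b \<in> A" for a b r
      unfolding cong_p_def by (rule q_eq[OF that])
    fix r
    show "carrier (coclass_group p S T m \<rho> \<sigma> r) = q r ` A \<times> carrier P"
      by (simp add: coclass_group_def extension_group_def carrier_coeff)
    show "\<one>\<^bsub>coclass_group p S T m \<rho> \<sigma> r\<^esub> = (q r 0, \<one>\<^bsub>P\<^esub>)"
      by (simp add: coclass_group_def extension_group_def one_coeff)
    show "(q r a, g) \<otimes>\<^bsub>coclass_group p S T m \<rho> \<sigma> r\<^esub> (q r b, h) =
        (q r (a + act g b + (\<iota> (\<rho> [g, h]) + nscale (p ^ (r + 1 - m)) (\<iota> (\<sigma> [g, h])))), g \<otimes>\<^bsub>P\<^esub> h)"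
      if "a \<in> A" "b \<in> A" "g \<in> carrier P" "h \<in> carrier P" for a b g h
      using that by (simp add: coclass_group_def extension_group_def mult_coeff
        quotient_action_q tau_q act_closed A_closed)
  qed
qed

section \<open>Triples and lattice data\<close>

lemma coboundary_1_q:
  assumes U: "subgroup U P" and f: "\<And>u. u \<in> U \<Longrightarrow> f [u] = q r (G u) \<and> G u \<in> A"
    and u: "u \<in> U" "v \<in> U"
  shows "coboundary 1 (sub_P S T U) (coeff p S T r) (quotient_action S) f [u, v] =
    q r (act u (G v) + - G (u \<otimes>\<^bsub>P\<^esub> v) + G u)"
proof -
  interpret C: comm_group "coeff p S T r" by (rule group_coeff)
  have c: "u \<in> carrier P" "u \<otimes>\<^bsub>P\<^esub> v \<in> U"
    using U u subgroup.mem_carrier subgroup.m_closed by metis+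
  show ?thesis
    using f[OF u(1)] f[OF u(2)] f[OF c(2)] u c(1)
    by (subst C.coboundary_1) (simp_all add: carrier_coeff quotient_action_q act_closed A_closed
      inv_coeff mult_coeff)
qed

text \<open>The index of \<open>q\<close> is one less than the exponent, so \<open>q 0\<close>
  projects onto T/pT and the third component of the triple is the image of W there.\<close>

lemma E_sub_eq_e_image:
  assumes U: "subgroup U P" and f: "\<And>u. u \<in> U \<Longrightarrow> f r [u] = q r (ext.F \<phi> \<psi> r u)"
    and FA: "\<And>u. u \<in> U \<Longrightarrow> ext.F \<phi> \<psi> r u \<in> A" and W: "W \<subseteq> A"
  shows "E_sub p S T r (U, f, q 0 ` W) = ext.e r \<phi> \<psi> ` (W \<times> U)"
proof -
  have *: "p_shift p S r (q 0 w) \<otimes>\<^bsub>coeff p S T r\<^esub> inv\<^bsub>coeff p S T r\<^esub> (f r [u]) =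
    q r (nscale (p ^ r) w - ext.F \<phi> \<psi> r u)" if "w \<in> W" "u \<in> U" for w u
    using that f FA W by (auto simp: p_shift_q inv_coeff mult_coeff A_closed subset_iff)
  show ?thesis
  proof (intro equalityI subsetI)
    fix x assume "x \<in> E_sub p S T r (U, f, q 0 ` W)"
    then obtain u w where "u \<in> U" "w \<in> W" "x = (p_shift p S r (q 0 w) \<otimes>\<^bsub>coeff p S T r\<^esub>
        inv\<^bsub>coeff p S T r\<^esub> (f r [u]), u)"
      unfolding E_sub_def by auto
    then show "x \<in> ext.e r \<phi> \<psi> ` (W \<times> U)"
      by (intro image_eqI[of _ _ "(w, u)"]) (simp_all add: * ext.e_def)
  next
    fix x assume "x \<in> ext.e r \<phi> \<psi> ` (W \<times> U)"
    then obtain w u where "w \<in> W" "u \<in> U" "x = ext.e r \<phi> \<psi> (w, u)"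
      by auto
    then show "x \<in> E_sub p S T r (U, f, q 0 ` W)"
      unfolding E_sub_def ext.e_def prod.case mem_Collect_eq
      by (intro exI[of _ u] exI[of _ "q 0 w"]) (simp add: *)
  qed
qed


lemma quotient_1_eq_coeff_0: "p_quotient p S T 1 = coeff p S T 0"
  by (simp add: coeff_def)

text \<open>Values in pT are written as p times \<open>\<psi>1\<close>, so that the correction of
  level \<omega> becomes p^(r+1-\<omega>) \<open>\<psi>1\<close>; the surplus p^(2m-\<omega>) goes
  into \<psi>. The subgroup of T/pT is replaced by its preimage in \<open>A\<close>.\<close>

lemma good_of_triple:
  assumes "x \<in> triples p S T m \<rho> \<sigma> r0"
  shows "\<exists>U \<phi> \<psi> W. ext.good U \<phi> \<psi> W \<and> (\<forall>r\<ge>r0. E_sub p S T r x = ext.e r \<phi> \<psi> ` (W \<times> U))"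
proof -
  obtain U f W where x: "x = (U, f, W)"
    by (cases x)
  have Uea: "U \<in> elementary_abelian_subgroups p P" and f: "f \<in> cochain_seqs p S T r0 U"
    and level: "level p S T r0 U f \<le> 2 * m"
    and cob: "\<And>r. r \<ge> r0 \<Longrightarrow> coboundary 1 (sub_P S T U) (coeff p S T r) (quotient_action S) (f r) =
        restrict (tau p S T m \<rho> \<sigma> r) (tuples 2 U)"
    and W: "subgroup W (coeff p S T 0)" "W \<subseteq> fixed_points p S T U"
    using assms unfolding x triples_def quotient_1_eq_coeff_0 by auto
  have U: "subgroup U P"
    using Uea unfolding elementary_abelian_subgroups_def by blast
  have Uc: "u \<in> carrier P" if "u \<in> U" for u
    using subgroup.mem_carrier[OF U that] .
  have Um: "u \<otimes>\<^bsub>P\<^esub> v \<in> U" if "u \<in> U" "v \<in> U" for u v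
    using subgroup.m_closed[OF U that] .
  have U1: "\<one>\<^bsub>P\<^esub> \<in> U"
    using subgroup.one_closed[OF U] .
  define \<omega> where "\<omega> = level p S T r0 U f"
  have "\<exists>\<omega>. \<omega> \<in> {0..r0} \<and> cochain_seq_with p S T r0 U \<omega> f"
    using f unfolding cochain_seqs_def by blast
  then have \<omega>: "\<omega> \<le> r0" "cochain_seq_with p S T r0 U \<omega> f" "\<omega> \<le> 2 * m"
    using LeastI_ex[of "\<lambda>\<omega>. \<omega> \<in> {0..r0} \<and> cochain_seq_with p S T r0 U \<omega> f"] level
    unfolding \<omega>_def level_def by auto
  obtain \<phi>c \<psi>c where \<phi>c: "\<phi>c \<in> cochains 1 (sub_P S T U) (sub_group S T)"
    and \<psi>c: "\<psi>c \<in> cochains 1 (sub_P S T U) (sub_group S (p_mult p S T 1))"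
    and f_eq: "\<And>r us. r \<ge> r0 \<Longrightarrow> us \<in> tuples 1 U \<Longrightarrow>
      f r us = p_proj p S T (r + 1) (\<phi>c us \<otimes>\<^bsub>S\<^esub> \<psi>c us [^]\<^bsub>S\<^esub> (p ^ (r - \<omega>)))"
    using \<omega>(2) unfolding cochain_seq_with_def by blast
  have tup: "[u] \<in> tuples 1 U" if "u \<in> U" for u
    using that by (simp add: tuples_def)
  have \<phi>T: "\<phi>c [u] \<in> T" and \<psi>p: "\<psi>c [u] \<in> p_mult p S T 1" if "u \<in> U" for u
    using cochainD(1)[OF \<phi>c, of "[u]"] cochainD(1)[OF \<psi>c, of "[u]"] tup[OF that]
    by (simp_all add: sub_group_def)
  have \<psi>T: "\<psi>c [u] \<in> T" if "u \<in> U" for u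
    using \<psi>p[OF that] p_mult_subset by blast
  have one: "\<phi>c [\<one>\<^bsub>P\<^esub>] = \<one>\<^bsub>S\<^esub>" "\<psi>c [\<one>\<^bsub>P\<^esub>] = \<one>\<^bsub>S\<^esub>"
    using cochainD(2)[OF \<phi>c, of "[\<one>\<^bsub>P\<^esub>]"] cochainD(2)[OF \<psi>c, of "[\<one>\<^bsub>P\<^esub>]"] tup[OF U1]
    by (simp_all add: sub_group_def)
  have "\<exists>b. b \<in> A \<and> \<iota> (\<psi>c [u]) = nscale p b" if "u \<in> U" for u
    using \<psi>p[OF that] p_mult_iff[OF \<psi>T[OF that], of 1] by auto
  then obtain \<psi>1 where \<psi>1: "\<And>u. u \<in> U \<Longrightarrow> \<psi>1 u \<in> A \<and> \<iota> (\<psi>c [u]) = nscale p (\<psi>1 u)"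
    by metis
  \<comment> \<open>Division by p is unique in \<open>A\<close>, so \<open>\<psi>1\<close> inherits
    normalization.\<close>
  have \<psi>1_one: "\<psi>1 \<one>\<^bsub>P\<^esub> = 0"
    by (rule ext.torsion_free) (use \<psi>1[OF U1] one(2) in simp_all)
  define \<phi> where "\<phi> u = \<iota> (\<phi>c [u])" for u
  define \<psi> where "\<psi> u = nscale (p ^ (2 * m - \<omega>)) (\<psi>1 u)" for u
  have \<phi>A: "\<phi> u \<in> A" and \<psi>A: "\<psi> u \<in> A" if "u \<in> U" for u
    using \<phi>T[OF that] \<psi>1[OF that] by (simp_all add: \<phi>_def \<psi>_def)
  have FA: "ext.F \<phi> \<psi> r u \<in> A" if "u \<in> U" for r u
    using \<phi>A[OF that] \<psi>A[OF that] by (simp add: ext.F_def)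
  have f_q: "f r [u] = q r (ext.F \<phi> \<psi> r u)" if r: "r \<ge> r0" and u: "u \<in> U" for r u
  proof -
    have e: "r + 1 - 2 * m + (2 * m - \<omega>) = r - \<omega> + 1"
      using \<omega> r r0 by simp
    have "ext.F \<phi> \<psi> r u = \<phi> u + nscale (p ^ (r - \<omega>)) (nscale p (\<psi>1 u))"
      unfolding ext.F_def \<psi>_def nscale_pow e by (simp add: nscale_nscale mult.commute)
    then show ?thesis
      using f_eq[OF r tup[OF u]] \<phi>T[OF u] \<psi>T[OF u] \<psi>1[OF u]
        p_proj_q[of "\<phi>c [u] \<otimes>\<^bsub>S\<^esub> \<psi>c [u] [^]\<^bsub>S\<^esub> (p ^ (r - \<omega>))" r]
      by (simp add: \<iota>_simps \<phi>_def)
  qed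
  have good_cong: "ext.cong_p (r + 1) (ext.F \<phi> \<psi> r (u \<otimes>\<^bsub>P\<^esub> v) + ext.\<tau> r u v)
      (act u (ext.F \<phi> \<psi> r v) + ext.F \<phi> \<psi> r u)" if r: "r \<ge> r0" and u: "u \<in> U" and v: "v \<in> U" for r u v
  proof -
    let ?d = "act u (ext.F \<phi> \<psi> r v) + - ext.F \<phi> \<psi> r (u \<otimes>\<^bsub>P\<^esub> v) + ext.F \<phi> \<psi> r u"
    have "[u, v] \<in> tuples 2 U"
      using u v by (simp add: tuples_def)
    then have "q r ?d = tau p S T m \<rho> \<sigma> r [u, v]"
      using fun_cong[OF cob[OF r], of "[u, v]"] f_q[OF r] FA
        coboundary_1_q[OF U, of "f r" r "ext.F \<phi> \<psi> r", OF _ u v] by simp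
    also have "\<dots> = q r (ext.\<tau> r u v)"
      using tau_q[OF Uc[OF u] Uc[OF v]] by (simp add: ext.\<tau>_def)
    finally have "ext.cong_p (r + 1) ?d (ext.\<tau> r u v)"
      using FA[OF u] FA[OF v] FA[OF Um[OF u v]] Uc[OF u] Uc[OF v]
      by (subst (asm) ext.q_eq_iff) simp_all
    then have "ext.cong_p (r + 1) (act u (ext.F \<phi> \<psi> r v) + ext.F \<phi> \<psi> r u)
        (ext.F \<phi> \<psi> r (u \<otimes>\<^bsub>P\<^esub> v) + ext.\<tau> r u v)"
      by (subst (asm) ext.cong_p_iff_of_diff_eq) (auto simp: algebra_simps)
    then show ?thesis
      by (rule ext.cong_p_sym)
  qed
  define W' where "W' = {a \<in> A. q 0 a \<in> W}"
  have WW': "W = q 0 ` W'"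
    using subgroup.subset[OF W(1)] unfolding W'_def carrier_coeff by blast
  have W'A: "w \<in> A" and W'W: "q 0 w \<in> W" if "w \<in> W'" for w
    using that by (simp_all add: W'_def)
  have W_zero: "q 0 0 \<in> W"
    using subgroup.one_closed[OF W(1)] by (simp add: one_coeff)
  have W_add: "w + w' \<in> W'" if "w \<in> W'" "w' \<in> W'" for w w'
    using subgroup.m_closed[OF W(1) W'W[OF that(1)] W'W[OF that(2)]] W'A[OF that(1)] W'A[OF that(2)]
    by (simp add: W'_def mult_coeff)
  have W_minus: "- w \<in> W'" if "w \<in> W'" for w
    using subgroup.m_inv_closed[OF W(1) W'W[OF that]] W'A[OF that]
    by (simp add: W'_def inv_coeff)
  have W_pA: "nscale p a \<in> W'" if "a \<in> A" for a
  proof -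
    have "q 0 (nscale p a) = q 0 0"
      using that by (subst q_eq) (auto simp: A_closed intro!: bexI[of _ a])
    then show ?thesis
      using that W_zero by (simp add: W'_def)
  qed
  have W_fixed: "ext.cong_p 1 (act u w) w" if u: "u \<in> U" and w: "w \<in> W'" for u w
  proof -
    have "quotient_action S u (q 0 w) = q 0 w"
      using W(2) W'W[OF w] u unfolding fixed_points_def by blast
    then have "q 0 (act u w) = q 0 w"
      using quotient_action_q[OF Uc[OF u] W'A[OF w]] by simp
    then show ?thesis
      using ext.q_eq_iff[of "act u w" w 0] W'A[OF w] Uc[OF u] by simp
  qed
  have "0 \<in> W'"
    using W_zero by (simp add: W'_def)
  then have "ext.good U \<phi> \<psi> W'"
    unfolding ext.good_def using Uea \<phi>A \<psi>A good_cong W'A W_add W_minus W_pA W_fixed one \<psi>1_one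
    by (auto simp: \<phi>_def \<psi>_def)
  moreover have "E_sub p S T r x = ext.e r \<phi> \<psi> ` (W' \<times> U)" if "r \<ge> r0" for r
    unfolding x WW' using that FA by (intro E_sub_eq_e_image U f_q) (auto simp: W'_def)
  ultimately show ?thesis by blast
qed

text \<open>Here p\<psi> has values in pT and comes with the factor p^(r-2m), so the sequence has
  level at most 2m; by 2m \<le> r0 this is an allowed exponent.\<close>

lemma triple_of_good:
  assumes good: "ext.good U \<phi> \<psi> W"
  shows "\<exists>x\<in>triples p S T m \<rho> \<sigma> r0. \<forall>r\<ge>r0. E_sub p S T r x = ext.e r \<phi> \<psi> ` (W \<times> U)"
proof -
  note U = ext.good_U(2)[OF good] and Uc = ext.good_Uc[OF good] and Um = ext.good_U_closed[OF good]
  note \<phi>A = ext.good_closed(1)[OF good] and \<psi>A = ext.good_closed(2)[OF good] and one = ext.good_one[OF good]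
  note FA = ext.F_closed[OF good] and WA = ext.good_W(1)[OF good]
  define f where "f = (\<lambda>r\<in>{r0..}. \<lambda>us\<in>tuples 1 U. q r (ext.F \<phi> \<psi> r (hd us)))"
  define \<phi>c where "\<phi>c = (\<lambda>us\<in>tuples 1 U. \<kappa> (\<phi> (hd us)))"
  define \<psi>c where "\<psi>c = (\<lambda>us\<in>tuples 1 U. \<kappa> (nscale p (\<psi> (hd us))))"
  have tup_1: "us \<in> tuples 1 U \<longleftrightarrow> (\<exists>u\<in>U. us = [u])" for us
    unfolding tuples_1 by auto
  note tup = tup_1 tup_1[unfolded One_nat_def]
  have f_q: "f r [u] = q r (ext.F \<phi> \<psi> r u)" if "r \<ge> r0" "u \<in> U" for r u
    using that by (simp add: f_def tup)
  have cochain_f: "f r \<in> cochains 1 (sub_P S T U) (coeff p S T r)" if "r \<ge> r0" for r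
    unfolding cochains_def using that
    by (auto simp: f_def tup carrier_coeff one_coeff FA ext.F_one[OF good])
  have cochain_\<phi>: "\<phi>c \<in> cochains 1 (sub_P S T U) (sub_group S T)"
    unfolding cochains_def by (auto simp: \<phi>c_def tup \<phi>A one \<kappa>_zero)
  have "\<kappa> (nscale p (\<psi> u)) \<in> p_mult p S T 1" if "u \<in> U" for u
    using \<psi>A[OF that] by (auto simp: p_mult_iff A_closed)
  then have cochain_\<psi>: "\<psi>c \<in> cochains 1 (sub_P S T U) (sub_group S (p_mult p S T 1))"
    unfolding cochains_def by (auto simp: \<psi>c_def tup one \<kappa>_zero sub_group_def)
  have seq: "cochain_seq_with p S T r0 U (2 * m) f"
    unfolding cochain_seq_with_def
  proof (intro bexI[OF _ cochain_\<phi>] bexI[OF _ cochain_\<psi>] allI ballI impI)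
    fix r us assume r: "r \<ge> r0" and "us \<in> tuples 1 U"
    then obtain u where u: "u \<in> U" "us = [u]"
      unfolding tup by blast
    have e: "r + 1 - 2 * m = (r - 2 * m) + 1"
      using r r0 by simp
    have "ext.F \<phi> \<psi> r u = \<phi> u + nscale (p ^ (r - 2 * m)) (nscale p (\<psi> u))"
      unfolding ext.F_def e by (simp add: nscale_nscale mult.commute)
    then show "f r us = p_proj p S T (r + 1) (\<phi>c us \<otimes>\<^bsub>S\<^esub> \<psi>c us [^]\<^bsub>S\<^esub> (p ^ (r - 2 * m)))"
      using p_proj_q[of "\<phi>c us \<otimes>\<^bsub>S\<^esub> \<psi>c us [^]\<^bsub>S\<^esub> (p ^ (r - 2 * m))" r] u f_q[OF r u(1)]
      by (simp add: \<phi>c_def \<psi>c_def tup \<phi>A \<psi>A A_closed \<iota>_simps)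
  qed
  have "2 * m \<le> r0"
    using r0 by simp
  then have "f \<in> cochain_seqs p S T r0 U" "level p S T r0 U f \<le> 2 * m"
    unfolding cochain_seqs_def level_def using seq cochain_f
    by (auto simp: f_def intro!: Least_le)
  moreover have "coboundary 1 (sub_P S T U) (coeff p S T r) (quotient_action S) (f r) =
      restrict (tau p S T m \<rho> \<sigma> r) (tuples 2 U)" if r: "r \<ge> r0" for r
  proof
    fix us
    show "coboundary 1 (sub_P S T U) (coeff p S T r) (quotient_action S) (f r) us =
      restrict (tau p S T m \<rho> \<sigma> r) (tuples 2 U) us"
    proof (cases "us \<in> tuples 2 U")
      case True
      then obtain u v where us: "us = [u, v]" and uv: "u \<in> U" "v \<in> U"
        unfolding tuples_2 by auto
      let ?d = "act u (ext.F \<phi> \<psi> r v) + - ext.F \<phi> \<psi> r (u \<otimes>\<^bsub>P\<^esub> v) + ext.F \<phi> \<psi> r u"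
      have "ext.cong_p (r + 1) (act u (ext.F \<phi> \<psi> r v) + ext.F \<phi> \<psi> r u)
        (ext.F \<phi> \<psi> r (u \<otimes>\<^bsub>P\<^esub> v) + ext.\<tau> r u v)"
        by (rule ext.cong_p_sym[OF ext.good_F[OF good r uv]])
      then have "ext.cong_p (r + 1) ?d (ext.\<tau> r u v)"
        by (subst (asm) ext.cong_p_iff_of_diff_eq) (auto simp: algebra_simps)
      then have "q r ?d = q r (ext.\<tau> r u v)"
        using uv Uc Um FA by (subst ext.q_eq_iff) simp_all
      then show ?thesis
        using True f_q[OF r] FA coboundary_1_q[OF U, of "f r" r "ext.F \<phi> \<psi> r", OF _ uv]
          tau_q[OF Uc[OF uv(1)] Uc[OF uv(2)]] unfolding us by (simp add: ext.\<tau>_def)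
    next
      case False
      then show ?thesis
        by (simp add: coboundary_def numeral_2_eq_2)
    qed
  qed
  moreover have "subgroup (q 0 ` W) (coeff p S T 0)"
  proof -
    interpret C: comm_group "coeff p S T 0" by (rule group_coeff)
    show ?thesis
    proof (rule C.subgroupI)
      show "q 0 ` W \<subseteq> carrier (coeff p S T 0)"
        using WA unfolding carrier_coeff by blast
      show "q 0 ` W \<noteq> {}"
        using ext.good_W(2)[OF good] by blast
    next
      fix a b assume "a \<in> q 0 ` W" "b \<in> q 0 ` W"
      then show "inv\<^bsub>coeff p S T 0\<^esub> a \<in> q 0 ` W" "a \<otimes>\<^bsub>coeff p S T 0\<^esub> b \<in> q 0 ` W"
        using ext.good_W[OF good] by (auto simp: inv_coeff mult_coeff)
    qed
  qed
  moreover have "q 0 ` W \<subseteq> fixed_points p S T U"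
  proof -
    have "quotient_action S u (q 0 w) = q 0 w" if "u \<in> U" "w \<in> W" for u w
      using ext.good_fixed[OF good that] that WA Uc ext.q_eq_iff[of "act u w" w 0]
      by (simp add: quotient_action_q)
    then show ?thesis
      unfolding fixed_points_def quotient_1_eq_coeff_0 carrier_coeff using WA by auto
  qed
  ultimately have "(U, f, q 0 ` W) \<in> triples p S T m \<rho> \<sigma> r0"
    using ext.good_U(1)[OF good] unfolding triples_def quotient_1_eq_coeff_0 by simp
  moreover have "E_sub p S T r (U, f, q 0 ` W) = ext.e r \<phi> \<psi> ` (W \<times> U)" if "r \<ge> r0" for r
    using that FA WA by (intro E_sub_eq_e_image U f_q) auto
  ultimately show ?thesis by blast
qed

text \<open>The lattice data are chosen once for each triple and serve all levels simultaneously;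
  \<open>triple_of_good\<close> ensures that every subgroup is still reached.\<close>

lemma triples_transport:
  obtains D :: "'s triple \<Rightarrow> ('b \<times> 's set) set" and e
  where "quillen_transport p {r0..} (coclass_group p S T m \<rho> \<sigma>) (triples p S T m \<rho> \<sigma> r0) D e"
    and "\<And>r x. r \<ge> r0 \<Longrightarrow> x \<in> triples p S T m \<rho> \<sigma> r0 \<Longrightarrow> E_sub p S T r x = e r x ` D x"
proof -
  let ?D = "\<lambda>(U, \<phi>, \<psi>, W). W \<times> U" and ?e = "\<lambda>r (U, \<phi>, \<psi>, W). ext.e r \<phi> \<psi>"
  have "\<forall>x\<in>triples p S T m \<rho> \<sigma> r0.
      \<exists>y. y \<in> ext.admissible \<and> (\<forall>r\<ge>r0. E_sub p S T r x = ?e r y ` ?D y)"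
  proof
    fix x assume x: "x \<in> triples p S T m \<rho> \<sigma> r0"
    obtain U \<phi> \<psi> W where "ext.good U \<phi> \<psi> W" "\<forall>r\<ge>r0. E_sub p S T r x = ext.e r \<phi> \<psi> ` (W \<times> U)"
      using good_of_triple[OF x] by blast
    then show "\<exists>y. y \<in> ext.admissible \<and> (\<forall>r\<ge>r0. E_sub p S T r x = ?e r y ` ?D y)"
      by (intro exI[of _ "(U, \<phi>, \<psi>, W)"]) (simp add: ext.admissible_def)
  qed
  then obtain y where y_all: "\<forall>x\<in>triples p S T m \<rho> \<sigma> r0.
      y x \<in> ext.admissible \<and> (\<forall>r\<ge>r0. E_sub p S T r x = ?e r (y x) ` ?D (y x))"
    by (rule bchoice[THEN exE])
  note y = y_all[rule_format]
  have "quillen_transport p {r0..} (coclass_group p S T m \<rho> \<sigma>) (triples p S T m \<rho> \<sigma> r0)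
      (\<lambda>x. ?D (y x)) (\<lambda>r x. ?e r (y x))"
  proof (rule quillen_transport_reindex[OF ext.quillen.quillen_transport_axioms])
    show "y x \<in> ext.admissible" if "x \<in> triples p S T m \<rho> \<sigma> r0" for x
      using y[OF that] by blast
    fix z assume "z \<in> ext.admissible"
    then obtain U \<phi> \<psi> W where z: "z = (U, \<phi>, \<psi>, W)" "ext.good U \<phi> \<psi> W"
      unfolding ext.admissible_def by blast
    obtain x where x: "x \<in> triples p S T m \<rho> \<sigma> r0" "\<forall>r\<ge>r0. E_sub p S T r x = ext.e r \<phi> \<psi> ` (W \<times> U)"
      using triple_of_good[OF z(2)] by blast
    show "\<exists>x\<in>triples p S T m \<rho> \<sigma> r0. \<forall>r\<in>{r0..}. ?e r (y x) ` ?D (y x) = ?e r z ` ?D z"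
    proof (intro bexI[OF _ x(1)] ballI)
      fix r assume "r \<in> {r0..}"
      then have "r \<ge> r0" by simp
      then have "?e r (y x) ` ?D (y x) = ext.e r \<phi> \<psi> ` (W \<times> U)"
        using y[OF x(1)] x(2) by metis
      then show "?e r (y x) ` ?D (y x) = ?e r z ` ?D z"
        unfolding z(1) prod.case .
    qed
  qed
  then show thesis
    by (rule that) (rule y[THEN conjunct2, rule_format])
qed

text \<open>The existence of a transversal is part of the claim, which keeps the statement about all
  transversals from being empty.\<close>

theorem quillen_categories:
  "(\<exists>E0. transversal p S T m \<rho> \<sigma> r0 E0) \<and>
    (\<forall>E0. transversal p S T m \<rho> \<sigma> r0 E0 \<longrightarrow>
       (\<forall>r\<ge>r0. is_skeleton (cat_C p S T m \<rho> \<sigma> E0 r)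
                  (quillen_cat p (coclass_group p S T m \<rho> \<sigma> r))) \<and>
       (\<forall>r\<ge>r0. \<forall>s\<ge>r0. isomorphic_cats (cat_C p S T m \<rho> \<sigma> E0 r) (cat_C p S T m \<rho> \<sigma> E0 s))) \<and>
    (\<forall>r\<ge>r0. \<forall>s\<ge>r0. equivalent_cats
       (quillen_cat p (coclass_group p S T m \<rho> \<sigma> r))
       (quillen_cat p (coclass_group p S T m \<rho> \<sigma> s)))"
proof -
  obtain D :: "'s triple \<Rightarrow> ('b \<times> 's set) set" and e where
    qt: "quillen_transport p {r0..} (coclass_group p S T m \<rho> \<sigma>) (triples p S T m \<rho> \<sigma> r0) D e"
    and E: "\<And>r x. r \<ge> r0 \<Longrightarrow> x \<in> triples p S T m \<rho> \<sigma> r0 \<Longrightarrow> E_sub p S T r x = e r x ` D x"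
    by (rule triples_transport) (rule that)
  interpret qt: quillen_transport p "{r0..}" "coclass_group p S T m \<rho> \<sigma>" "triples p S T m \<rho> \<sigma> r0" D e
    by (rule qt)
  have transversal_iff: "transversal p S T m \<rho> \<sigma> r0 E0 \<longleftrightarrow> qt.representatives r0 E0" for E0
  proof -
    have "x \<in> E0 \<and> E_sub p S T r0 x \<in> C \<longleftrightarrow> x \<in> E0 \<and> e r0 x ` D x \<in> C"
      if "E0 \<subseteq> triples p S T m \<rho> \<sigma> r0" for x C
      using E[of r0 x] that by (metis order_refl subsetD)
    then show ?thesis
      unfolding transversal_def qt.representatives_def
      by (intro conj_cong ball_cong refl) presburger
  qed
  have cat_eq: "cat_C p S T m \<rho> \<sigma> E0 r =
      full_subcat (quillen_cat p (coclass_group p S T m \<rho> \<sigma> r)) ((\<lambda>x. e r x ` D x) ` E0)"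
    if "qt.representatives r0 E0" "r \<ge> r0" for E0 r
  proof -
    have "E_sub p S T r ` E0 = (\<lambda>x. e r x ` D x) ` E0"
      using that(1) E[OF that(2)] unfolding qt.representatives_def by (intro image_cong refl) blast
    then show ?thesis
      by (simp only: cat_C_def)
  qed
  have reps: "qt.representatives r E0" if "qt.representatives r0 E0" "r \<ge> r0" for E0 r
    using that by (intro qt.representatives_cong[of r0 r]) simp_all
  show ?thesis
    unfolding transversal_iff
  proof (intro conjI allI impI)
    show "\<exists>E0. qt.representatives r0 E0"
      by (rule qt.ex_representatives) simp
  next
    fix E0 r assume "qt.representatives r0 E0" "r \<ge> r0"
    then show "is_skeleton (cat_C p S T m \<rho> \<sigma> E0 r) (quillen_cat p (coclass_group p S T m \<rho> \<sigma> r))"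
      using qt.skeleton[OF _ reps[of E0 r], of] cat_eq by simp
  next
    fix E0 r s assume rep: "qt.representatives r0 E0" and rs: "r \<ge> r0" "s \<ge> r0"
    have "isomorphic_cats
        (full_subcat (quillen_cat p (coclass_group p S T m \<rho> \<sigma> r)) ((\<lambda>x. e r x ` D x) ` E0))
        (full_subcat (quillen_cat p (coclass_group p S T m \<rho> \<sigma> s)) ((\<lambda>x. e s x ` D x) ` E0))"
      by (rule qt.isomorphic_subcats[OF _ _ reps[OF rep rs(1)]]) (use rs in simp_all)
    then show "isomorphic_cats (cat_C p S T m \<rho> \<sigma> E0 r) (cat_C p S T m \<rho> \<sigma> E0 s)"
      by (simp only: cat_eq[OF rep rs(1)] cat_eq[OF rep rs(2)])
  next
    fix r s assume "r \<ge> r0" "s \<ge> r0"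
    then show "equivalent_cats (quillen_cat p (coclass_group p S T m \<rho> \<sigma> r))
        (quillen_cat p (coclass_group p S T m \<rho> \<sigma> s))"
      by (intro qt.equivalent_quillen_cats) simp_all
  qed
qed

end

section \<open>The closed lower central series\<close>

lemma continuous_map_image_closure_in:
  assumes "continuous_map X Y f" "f ` K \<subseteq> L"
  shows "f ` (X closure_of K) \<subseteq> Y closure_of L"
  using continuous_map_image_closure_subset[OF assms(1), of K] closure_of_mono[OF assms(2), of Y]
  by (rule order_trans)

text \<open>Multiplication, inversion and conjugation are continuous and preserve N, so they
  preserve its closure; for multiplication the closure of N x N is the product of the
  closures.\<close>

lemma normal_closure_of:
  fixes G (structure)
  assumes G: "topological_group G \<T>" and N: "N \<lhd> G"
  shows "\<T> closure_of N \<lhd> G"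
proof -
  interpret group G
    using G by (simp add: topological_group_def)
  interpret N: normal N G by (rule N)
  have top: "topspace \<T> = carrier G" and mult: "continuous_map (prod_topology \<T> \<T>) \<T> (\<lambda>(x, y). x \<otimes> y)"
    and inv: "continuous_map \<T> \<T> (\<lambda>x. inv x)"
    using G by (simp_all add: topological_group_def)
  have sub: "\<T> closure_of N \<subseteq> carrier G"
    using closure_of_subset_topspace top by metis
  have incl: "N \<subseteq> \<T> closure_of N"
    using N.subset top closure_of_subset by metis
  have "x \<otimes> y \<in> \<T> closure_of N" if "x \<in> \<T> closure_of N" "y \<in> \<T> closure_of N" for x y
  proof -
    have "(\<lambda>(x, y). x \<otimes> y) ` (prod_topology \<T> \<T> closure_of (N \<times> N)) \<subseteq> \<T> closure_of N"
      by (rule continuous_map_image_closure_in[OF mult]) auto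
    then show ?thesis
      using that by (auto simp: closure_of_Times)
  qed
  moreover have "inv x \<in> \<T> closure_of N" if "x \<in> \<T> closure_of N" for x
  proof -
    have "(\<lambda>x. inv x) ` (\<T> closure_of N) \<subseteq> \<T> closure_of N"
      by (rule continuous_map_image_closure_in[OF inv]) auto
    then show ?thesis
      using that by auto
  qed
  moreover have "\<T> closure_of N \<noteq> {}"
    using incl N.one_closed by blast
  ultimately have "subgroup (\<T> closure_of N) G"
    using sub by (intro subgroupI) auto
  moreover have "g \<otimes> x \<otimes> inv g \<in> \<T> closure_of N" if g: "g \<in> carrier G" and x: "x \<in> \<T> closure_of N" for g x
  proof -
    have const: "continuous_map \<T> \<T> (\<lambda>x. a)" if "a \<in> carrier G" for a
      using that by (simp add: top)
    have "continuous_map \<T> (prod_topology \<T> \<T>) (\<lambda>x. (g, x))"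
      using g by (intro continuous_map_pairedI const) simp_all
    from continuous_map_compose[OF this mult] have 1: "continuous_map \<T> \<T> (\<lambda>x. g \<otimes> x)"
      by (simp add: o_def)
    have "continuous_map \<T> (prod_topology \<T> \<T>) (\<lambda>x. (g \<otimes> x, inv g))"
      using g by (intro continuous_map_pairedI const 1) simp_all
    from continuous_map_compose[OF this mult] have "continuous_map \<T> \<T> (\<lambda>x. g \<otimes> x \<otimes> inv g)"
      by (simp add: o_def)
    from continuous_map_image_closure_in[OF this, of N N] show ?thesis
      using N.inv_op_closed2[OF g] x by auto
  qed
  ultimately show ?thesis
    by (simp add: normal_inv_iff)
qed

text \<open>A conjugate of a commutator is the commutator of the conjugates, so the generating set
  is invariant; and [h, k] = h (k h^(-1) k^(-1)) lies in N.\<close>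

lemma (in group) commutator_subgroup_normal:
  assumes "N \<lhd> G"
  shows "commutator_subgroup G N (carrier G) \<lhd> G" "commutator_subgroup G N (carrier G) \<subseteq> N"
proof -
  interpret N: normal N G by fact
  let ?K = "{h \<otimes> k \<otimes> inv h \<otimes> inv k | h k. h \<in> N \<and> k \<in> carrier G}"
  have "g \<otimes> (h \<otimes> k \<otimes> inv h \<otimes> inv k) \<otimes> inv g \<in> ?K"
    if "g \<in> carrier G" "h \<in> N" "k \<in> carrier G" for g h k
  proof -
    have h: "h \<in> carrier G" using that(2) by simp
    have cancel: "inv g \<otimes> (g \<otimes> z) = z" if "z \<in> carrier G" for z
      using \<open>g \<in> carrier G\<close> that by (simp flip: m_assoc)
    have "g \<otimes> (h \<otimes> k \<otimes> inv h \<otimes> inv k) \<otimes> inv g =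
      (g \<otimes> h \<otimes> inv g) \<otimes> (g \<otimes> k \<otimes> inv g) \<otimes> inv (g \<otimes> h \<otimes> inv g) \<otimes> inv (g \<otimes> k \<otimes> inv g)"
      using that h by (simp add: inv_mult_group m_assoc cancel)
    moreover have "g \<otimes> h \<otimes> inv g \<in> N" "g \<otimes> k \<otimes> inv g \<in> carrier G"
      using that N.inv_op_closed2 by auto
    ultimately show ?thesis by blast
  qed
  then show "commutator_subgroup G N (carrier G) \<lhd> G"
    unfolding commutator_subgroup_def by (intro normal_generateI) auto
  have "h \<otimes> k \<otimes> inv h \<otimes> inv k \<in> N" if "h \<in> N" "k \<in> carrier G" for h k
  proof -
    have "h \<otimes> (k \<otimes> inv h \<otimes> inv k) \<in> N"
      by (rule N.m_closed[OF that(1) N.inv_op_closed2[OF that(2) N.m_inv_closed[OF that(1)]]])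
    then show ?thesis
      using that by (simp add: m_assoc)
  qed
  then show "commutator_subgroup G N (carrier G) \<subseteq> N"
    unfolding commutator_subgroup_def by (intro generate_subgroup_incl N.subgroup_axioms) auto
qed

text \<open>Closedness is carried along because it makes the series descend: the closure of the
  commutator subgroup stays inside a closed term.\<close>

lemma closed_lower_central_normal_closed:
  assumes G: "topological_group G \<T>"
  shows "closed_lower_central G \<T> (Suc n) \<lhd> G \<and> closedin \<T> (closed_lower_central G \<T> (Suc n))"
proof (induction n)
  interpret group G
    using G by (simp add: topological_group_def)
  case 0
  have "carrier G = topspace \<T>"
    using G by (simp add: topological_group_def)
  moreover have "carrier G \<lhd> G"
    by (simp add: normal_inv_iff subgroup_self)
  ultimately show ?case
    by (metis closed_lower_central.simps(2) closedin_topspace)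
next
  interpret group G
    using G by (simp add: topological_group_def)
  case (Suc n)
  then show ?case
    using normal_closure_of[OF G commutator_subgroup_normal(1)] by simp
qed

lemma closed_lower_central_Suc_subset:
  assumes G: "topological_group G \<T>"
  shows "closed_lower_central G \<T> (Suc (Suc n)) \<subseteq> closed_lower_central G \<T> (Suc n)"
proof -
  interpret group G
    using G by (simp add: topological_group_def)
  show ?thesis
    using commutator_subgroup_normal(2) closed_lower_central_normal_closed[OF G, of n]
    by (simp add: closure_of_minimal)
qed

text \<open>With k = ell this places T inside the p-adic lattice.\<close>

lemma closed_lower_central_antimono:
  assumes "topological_group G \<T>"
  shows "closed_lower_central G \<T> (Suc (n + k)) \<subseteq> closed_lower_central G \<T> (Suc n)"
  by (induction k) (use closed_lower_central_Suc_subset[OF assms] in force)+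

section \<open>The group of rationals modulo the integers\<close>

text \<open>The p-adic integers embed into the sequences \<open>(x\<^sub>n / p\<^sup>n)\<^sub>n\<close> in \<open>\<rat>/\<int>\<close>; in this way the
  lattice becomes a subgroup of a type of class \<open>ab_group_add\<close>.\<close>

quotient_type rat_mod_int = rat / "\<lambda>x y :: rat. x - y \<in> \<int>"
proof (intro equivpI reflpI sympI transpI)
  show "x - x \<in> \<int>" for x :: rat by simp
  show "y - x \<in> \<int>" if "x - y \<in> \<int>" for x y :: rat
    using Ints_minus[OF that] by simp
  show "x - z \<in> \<int>" if "x - y \<in> \<int>" "y - z \<in> \<int>" for x y z :: rat
    using Ints_add[OF that] by simp
qed

instantiation rat_mod_int :: ab_group_add
begin

lift_definition zero_rat_mod_int :: rat_mod_int is 0 .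

lift_definition plus_rat_mod_int :: "rat_mod_int \<Rightarrow> rat_mod_int \<Rightarrow> rat_mod_int" is "(+)"
proof -
  fix a b c d :: rat assume "a - b \<in> \<int>" "c - d \<in> \<int>"
  then have "(a - b) + (c - d) \<in> \<int>" by (rule Ints_add)
  then show "a + c - (b + d) \<in> \<int>" by (simp add: algebra_simps)
qed

lift_definition uminus_rat_mod_int :: "rat_mod_int \<Rightarrow> rat_mod_int" is uminus
proof -
  fix a b :: rat assume "a - b \<in> \<int>"
  then have "- (a - b) \<in> \<int>" by (rule Ints_minus)
  then show "- a - - b \<in> \<int>" by (simp add: algebra_simps)
qed

lift_definition minus_rat_mod_int :: "rat_mod_int \<Rightarrow> rat_mod_int \<Rightarrow> rat_mod_int" is "(-)"
proof -
  fix a b c d :: rat assume "a - b \<in> \<int>" "c - d \<in> \<int>"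
  then have "(a - b) - (c - d) \<in> \<int>" by (rule Ints_diff)
  then show "a - c - (b - d) \<in> \<int>" by (simp add: algebra_simps)
qed

instance
  by (standard; transfer) (simp_all add: algebra_simps)

end

lift_definition of_rat_mod_int :: "rat \<Rightarrow> rat_mod_int" is "\<lambda>x. x" .

lemma of_rat_mod_int_add: "of_rat_mod_int (x + y) = of_rat_mod_int x + of_rat_mod_int y"
  by transfer simp

lemma of_rat_mod_int_eq_iff: "of_rat_mod_int x = of_rat_mod_int y \<longleftrightarrow> x - y \<in> \<int>"
  by transfer simp

text \<open>Reduction modulo k changes the fraction by an integer, so sums of residues become plain
  sums in Q/Z.\<close>

lemma of_rat_mod_int_mod:
  assumes "k > 0"
  shows "of_rat_mod_int (of_int (a mod k) / of_int k) = of_rat_mod_int (of_int a / of_int k)"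
proof -
  have "(of_int a :: rat) = of_int (a div k) * of_int k + of_int (a mod k)"
    by (simp flip: of_int_mult of_int_add)
  then have "of_int (a mod k) / of_int k - of_int a / of_int k = (- of_int (a div k) :: rat)"
    using assms by (simp add: field_simps)
  then show ?thesis
    unfolding of_rat_mod_int_eq_iff by simp
qed

lemma of_rat_mod_int_inj:
  assumes "of_rat_mod_int (of_int a / of_int k) = of_rat_mod_int (of_int b / of_int k)"
    and "0 \<le> a" "a < k" "0 \<le> b" "b < k"
  shows "a = b"
proof -
  obtain z where "(of_int a / of_int k - of_int b / of_int k :: rat) = of_int z"
    using assms(1) unfolding of_rat_mod_int_eq_iff by (elim Ints_cases)
  then have "(of_int a :: rat) - of_int b = of_int z * of_int k"
    using assms by (simp add: field_simps)
  then have "a - b = z * k"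
    by (metis of_int_diff of_int_eq_iff of_int_mult)
  then have "a mod k = b mod k"
    by (metis mod_mult_self3 diff_add_cancel)
  then show ?thesis
    using assms by simp
qed

section \<open>Lattices over the p-adic integers\<close>

text \<open>\<open>\<phi> t i n\<close> is the residue modulo p^n of the i-th p-adic coordinate of
  t.\<close>

locale padic_lattice =
  fixes p d :: nat and S :: "'s monoid" and N :: "'s set" and \<phi> :: "'s \<Rightarrow> nat \<Rightarrow> nat \<Rightarrow> int"
  assumes prime_p: "prime p"
    and \<phi>: "\<phi> \<in> iso (sub_group S N) (product_group {..<d} (\<lambda>i. padic_int p))"
    and N: "subgroup N S" and S: "group S"
begin

sublocale S: group S by (rule S)

lemma \<phi>_carrier:
  assumes "t \<in> N" "i < d"
  shows "0 \<le> \<phi> t i n" "\<phi> t i n < int p ^ n" "\<phi> t i (Suc n) mod int p ^ n = \<phi> t i n"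
proof -
  have "\<phi> t \<in> carrier (product_group {..<d} (\<lambda>i. padic_int p))"
    using \<phi> assms(1) by (auto simp: iso_def hom_def sub_group_def)
  then have "\<phi> t i \<in> carrier (padic_int p)"
    using assms(2) by auto
  then show "0 \<le> \<phi> t i n" "\<phi> t i n < int p ^ n" "\<phi> t i (Suc n) mod int p ^ n = \<phi> t i n"
    by (simp_all add: padic_int_def)
qed

lemma \<phi>_mult:
  assumes "t \<in> N" "u \<in> N" "i < d"
  shows "\<phi> (t \<otimes>\<^bsub>S\<^esub> u) i n = (\<phi> t i n + \<phi> u i n) mod int p ^ n"
proof -
  have "\<phi> (t \<otimes>\<^bsub>S\<^esub> u) = \<phi> t \<otimes>\<^bsub>product_group {..<d} (\<lambda>i. padic_int p)\<^esub> \<phi> u"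
    using \<phi> assms(1,2) by (auto simp: iso_def hom_def sub_group_def)
  then show ?thesis
    using assms(3) by (simp add: padic_int_def)
qed

lemma \<phi>_eqI:
  assumes t: "t \<in> N" "u \<in> N" and eq: "\<And>i n. i < d \<Longrightarrow> \<phi> t i n = \<phi> u i n"
  shows "t = u"
proof -
  have mem: "\<phi> t \<in> carrier (product_group {..<d} (\<lambda>i. padic_int p))"
    "\<phi> u \<in> carrier (product_group {..<d} (\<lambda>i. padic_int p))"
    using \<phi> t by (auto simp: iso_def hom_def sub_group_def)
  have "\<phi> t = \<phi> u"
  proof
    fix i show "\<phi> t i = \<phi> u i"
      using eq mem by (cases "i < d") (auto simp: PiE_def extensional_def)
  qed
  moreover have "inj_on \<phi> N"
    using \<phi> by (auto simp: iso_def bij_betw_def sub_group_def)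
  ultimately show ?thesis
    using t by (auto dest: inj_onD)
qed

lemma \<phi>_one: "i < d \<Longrightarrow> \<phi> \<one>\<^bsub>S\<^esub> i n = 0"
proof -
  assume i: "i < d"
  have N1: "\<one>\<^bsub>S\<^esub> \<in> N"
    using subgroup.one_closed[OF N] .
  have "\<phi> \<one>\<^bsub>S\<^esub> i n = (\<phi> \<one>\<^bsub>S\<^esub> i n + \<phi> \<one>\<^bsub>S\<^esub> i n) mod int p ^ n"
    using \<phi>_mult[OF N1 N1 i] by simp
  moreover have "\<phi> \<one>\<^bsub>S\<^esub> i n = \<phi> \<one>\<^bsub>S\<^esub> i n mod int p ^ n"
    using \<phi>_carrier[OF N1 i] by simp
  ultimately have "(0 + \<phi> \<one>\<^bsub>S\<^esub> i n) mod int p ^ n = (\<phi> \<one>\<^bsub>S\<^esub> i n + \<phi> \<one>\<^bsub>S\<^esub> i n) mod int p ^ n"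
    by simp
  then have "int p ^ n dvd \<phi> \<one>\<^bsub>S\<^esub> i n"
    by (simp add: mod_eq_dvd_iff)
  then show ?thesis
    using \<phi>_carrier(1,2)[OF N1 i, of n] by (metis dvd_imp_mod_0 mod_pos_pos_trivial)
qed

lemma \<phi>_pow:
  assumes "t \<in> N" "i < d"
  shows "t [^]\<^bsub>S\<^esub> (k::nat) \<in> N \<and> \<phi> (t [^]\<^bsub>S\<^esub> k) i n = (int k * \<phi> t i n) mod int p ^ n"
proof (induction k)
  case 0 then show ?case
    using \<phi>_one[OF assms(2)] subgroup.one_closed[OF N] by simp
next
  case (Suc k)
  then show ?case
    using \<phi>_mult[of "t [^]\<^bsub>S\<^esub> k" t i n] assms subgroup.m_closed[OF N, of "t [^]\<^bsub>S\<^esub> k" t]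
    by (simp add: mod_simps algebra_simps)
qed

lemma comm: "t \<in> N \<Longrightarrow> u \<in> N \<Longrightarrow> t \<otimes>\<^bsub>S\<^esub> u = u \<otimes>\<^bsub>S\<^esub> t"
  by (rule \<phi>_eqI) (simp_all add: subgroup.m_closed[OF N] \<phi>_mult add.commute)

text \<open>From p x = 0 modulo p^(n+1) one gets merely that p^n divides x; so the residue modulo
  p^n is read off from the one modulo p^(n+1).\<close>

lemma torsion_free:
  assumes t: "t \<in> N" "t [^]\<^bsub>S\<^esub> p = \<one>\<^bsub>S\<^esub>"
  shows "t = \<one>\<^bsub>S\<^esub>"
proof (rule \<phi>_eqI[OF t(1) subgroup.one_closed[OF N]])
  fix i n assume i: "i < d"
  have "(int p * \<phi> t i (Suc n)) mod int p ^ Suc n = 0"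
    using \<phi>_pow[OF t(1) i, of p "Suc n"] t(2) \<phi>_one[OF i] by simp
  then have "int p ^ n dvd \<phi> t i (Suc n)"
    using prime_gt_0_nat[OF prime_p] by (simp add: mod_eq_0_iff_dvd)
  then show "\<phi> t i n = \<phi> \<one>\<^bsub>S\<^esub> i n"
    using \<phi>_carrier(3)[OF t(1) i, of n] \<phi>_one[OF i] by simp
qed

text \<open>The residue modulo p^n of a p^n-th power is 0.\<close>

lemma separated:
  assumes t: "t \<in> N" and div: "\<And>k. \<exists>u\<in>N. t = u [^]\<^bsub>S\<^esub> (p ^ k)"
  shows "t = \<one>\<^bsub>S\<^esub>"
proof (rule \<phi>_eqI[OF t subgroup.one_closed[OF N]])
  fix i n assume i: "i < d"
  obtain u where "u \<in> N" "t = u [^]\<^bsub>S\<^esub> (p ^ n)"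
    using div by blast
  then show "\<phi> t i n = \<phi> \<one>\<^bsub>S\<^esub> i n"
    using \<phi>_pow[of u i "p ^ n" n] i \<phi>_one[OF i] by simp
qed

text \<open>Residues modulo p^n are additive up to reduction; divided by p^n in Q/Z they are
  additive outright. The value 0 for \<open>i \<ge> d\<close> keeps this true on the whole function
  type.\<close>

definition embed :: "'s \<Rightarrow> nat \<Rightarrow> nat \<Rightarrow> rat_mod_int" where
  "embed t = (\<lambda>i n. if i < d then of_rat_mod_int (of_int (\<phi> t i n) / of_int (int p ^ n)) else 0)"

lemma embed_mult:
  assumes "t \<in> N" "u \<in> N"
  shows "embed (t \<otimes>\<^bsub>S\<^esub> u) = embed t + embed u"
proof (intro ext)
  fix i n
  have p: "int p ^ n > 0"
    using prime_gt_0_nat[OF prime_p] by simp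
  show "embed (t \<otimes>\<^bsub>S\<^esub> u) i n = (embed t + embed u) i n"
    using \<phi>_mult[OF assms, of i n] of_rat_mod_int_mod[OF p]
    by (simp add: embed_def add_divide_distrib of_rat_mod_int_add del: of_int_power)
qed

lemma embed_inj: "inj_on embed N"
proof (rule inj_onI)
  fix t u assume tu: "t \<in> N" "u \<in> N" "embed t = embed u"
  show "t = u"
  proof (rule \<phi>_eqI[OF tu(1,2)])
    fix i n assume i: "i < d"
    have "embed t i n = embed u i n"
      using tu(3) by simp
    then have "of_rat_mod_int (of_int (\<phi> t i n) / of_int (int p ^ n)) =
      of_rat_mod_int (of_int (\<phi> u i n) / of_int (int p ^ n))"
      using i by (simp add: embed_def)
    then show "\<phi> t i n = \<phi> u i n"
      by (rule of_rat_mod_int_inj) (use \<phi>_carrier[OF tu(1) i] \<phi>_carrier[OF tu(2) i] in simp_all)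
  qed
qed

end

text \<open>T is a subgroup of the term with index l, a copy of Z_p^d, and inherits commutativity,
  torsion-freeness, separatedness and the embedding; a p^k-th power of an element of T is also one
  of an element of that term.\<close>

lemma (in coclass_family) lattice_extension_embed:
  assumes "m \<ge> 1" "r0 \<ge> 3 * m"
  shows "\<exists>\<iota> :: 's \<Rightarrow> nat \<Rightarrow> nat \<Rightarrow> rat_mod_int. lattice_extension p m r0 S T \<rho> \<sigma> \<eta> \<iota>"
proof -
  define N where "N = closed_lower_central S \<T> l"
  have top: "topological_group S \<T>"
    using pro_p by (simp add: pro_p_group_of_coclass_def pro_p_group_def profinite_group_def)
  then have S: "group S"
    by (simp add: topological_group_def)
  obtain l' where l': "l = Suc l'"
    using l_pos by (cases l) auto
  have normal_N: "N \<lhd> S" and normal_T: "T \<lhd> S"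
    using closed_lower_central_normal_closed[OF top, of l'] closed_lower_central_normal_closed[OF top, of "l' + ell"]
    by (simp_all add: N_def T_eq l')
  have TN: "T \<subseteq> N"
    using closed_lower_central_antimono[OF top, of l' ell] by (simp add: N_def T_eq l')
  obtain \<phi> where \<phi>: "\<phi> \<in> iso (sub_group S N) (product_group {..<d} (\<lambda>i. padic_int p))"
    using padic unfolding topologically_isomorphic_def N_def by blast
  interpret padic_lattice p d S N \<phi>
    by (rule padic_lattice.intro[OF prime \<phi> normal_imp_subgroup[OF normal_N] S])
  have "lattice_extension p m r0 S T \<rho> \<sigma> \<eta> embed"
  proof (rule lattice_extension.intro)
    show "prime p" "group S" "T \<lhd> S" "order (S Mod T) = p ^ m" "1 \<le> m" "3 * m \<le> r0"
      using prime S normal_T order_P assms by auto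
    show "\<rho> \<in> cocycles 2 (S Mod T) (sub_group S T) (conj_action S)"
      "\<eta> \<in> cochains 3 (S Mod T) (sub_group S T)" "\<sigma> \<in> cochains 2 (S Mod T) (sub_group S T)"
      using rho_cocycle eta_cocycle sigma_cochain by (simp_all add: cocycles_def)
    show "coboundary 2 (S Mod T) (sub_group S T) (conj_action S) \<sigma> =
        (\<lambda>gs\<in>tuples 3 (carrier (S Mod T)). \<eta> gs [^]\<^bsub>S\<^esub> (p ^ m))"
      by (rule coboundary_sigma)
    show "inj_on embed T"
      using inj_on_subset[OF embed_inj TN] .
    fix s t assume "s \<in> T" "t \<in> T"
    then have "s \<in> N" "t \<in> N"
      using TN by auto
    then show "s \<otimes>\<^bsub>S\<^esub> t = t \<otimes>\<^bsub>S\<^esub> s" "embed (s \<otimes>\<^bsub>S\<^esub> t) = embed s + embed t"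
      by (rule comm, rule embed_mult)
  next
    show "t = \<one>\<^bsub>S\<^esub>" if "t \<in> T" "t [^]\<^bsub>S\<^esub> p = \<one>\<^bsub>S\<^esub>" for t
      using torsion_free[OF _ that(2)] that(1) TN by blast
    show "t = \<one>\<^bsub>S\<^esub>" if t: "t \<in> T" "\<And>k. t \<in> p_mult p S T k" for t
    proof (rule separated)
      show "t \<in> N"
        using t(1) TN by blast
      show "\<exists>u\<in>N. t = u [^]\<^bsub>S\<^esub> (p ^ k)" for k
        using t(2)[of k] TN unfolding p_mult_def by blast
    qed
  qed
  then show ?thesis by blast
qed

theorem proposition7p3:
  fixes p c :: nat and S :: "'s monoid" and \<T> :: "'s topology" and l d ell m r0 :: nat
    and \<rho> \<eta> \<sigma> :: "'s set list \<Rightarrow> 's" and T :: "'s set"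
  assumes "coclass_family p c S \<T> l d ell m \<rho> \<eta> \<sigma> T"
    and "m \<ge> 1" and "r0 \<ge> 3 * m"
  shows "(\<exists>E0. transversal p S T m \<rho> \<sigma> r0 E0) \<and>
    (\<forall>E0. transversal p S T m \<rho> \<sigma> r0 E0 \<longrightarrow>
       (\<forall>r\<ge>r0. is_skeleton (cat_C p S T m \<rho> \<sigma> E0 r)
                  (quillen_cat p (coclass_group p S T m \<rho> \<sigma> r))) \<and>
       (\<forall>r\<ge>r0. \<forall>s\<ge>r0. isomorphic_cats (cat_C p S T m \<rho> \<sigma> E0 r) (cat_C p S T m \<rho> \<sigma> E0 s))) \<and>
    (\<forall>r\<ge>r0. \<forall>s\<ge>r0. equivalent_cats
       (quillen_cat p (coclass_group p S T m \<rho> \<sigma> r))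
       (quillen_cat p (coclass_group p S T m \<rho> \<sigma> s)))"
proof -
  obtain \<iota> :: "'s \<Rightarrow> nat \<Rightarrow> nat \<Rightarrow> rat_mod_int" where "lattice_extension p m r0 S T \<rho> \<sigma> \<eta> \<iota>"
    using coclass_family.lattice_extension_embed[OF assms] by blast
  then show ?thesis
    by (rule lattice_extension.quillen_categories)
qed

end
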